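(* For the Online Joint Replenishment Problem with holding and backlog costs (with any number $n$ of items), there exists a deterministic online algorithm running in polynomial time that is 30-competitive: for every instance $I$, the total cost (service costs plus holding costs plus backlog costs) incurred by the algorithm is at most $30\cdot \mathrm{OPT}(I)$, where $\mathrm{OPT}(I)$ is the minimum total cost of any (offline) solution for $I$.
   Context: Online Joint Replenishment Problem (Online JRP) with holding and backlog costs: Let $T$ be a two-level rooted tree with root $r$ and leaves $v_1,\dots,v_n$ (the leaves are items). Each node $u$ has a nonnegative cost $c(u)$ ($c(r)$ is the joint ordering cost, $c(v_i)$ is the item-specific cost). Fixed constants $h\ge 0$ (holding rate) and $b\ge 0$ (backlog rate) are common to all requests and items. Requests arrive online over (continuous) time; each request is a tuple $\rho=(v_\rho,a_\rho,d_\rho)$ with leaf $v_\rho$, arrival time $a_\rho$ and soft deadline $d_\rho\ge a_\rho$, and asks for one unit of item $v_\rho$. Several requests may arrive at the same time. At time $t$ the algorithm knows only requests with arrival time at most $t$; the number of requests and the time horizon are unknown. A service at time $t$ is a subtree $T'$ of $T$ containing $r$; it costs $\sum_{u\in V(T')}c(u)$ and can satisfy any subset of not-yet-satisfied requests $\rho$ with $v_\rho\in V(T')$ and $a_\rho\le t$. A request satisfied at time $t\in[a_\rho,d_\rho]$ incurs holding cost $h\cdot(d_\rho-t)$; satisfied at time $t>d_\rho$ it incurs backlog cost $b\cdot(t-d_\rho)$. Every request must eventually be satisfied; the goal is to minimize total service cost plus holding cost plus backlog cost.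
   Formalization: The ratio 30 is claimed only for backlog rate b > 0: for b = 0 no online algorithm has any finite ratio, as a new request can arrive after each service while OPT pays for one. Polynomial time counts exact real arithmetic operations, in the number of items plus requests. *)

theory Defs
  imports Complex_Main "HOL-Computational_Algebra.Polynomial"
begin

section \<open>The joint replenishment problem with holding and backlog costs\<close>

text \<open>
  The two-level tree has root \<open>Root\<close> and leaves \<open>Leaf i\<close> for \<open>i < n\<close>, where \<open>n\<close> is the length of
  \<open>item_costs\<close>.  Requests are identified by their position in the list \<open>requests\<close>, so that
  several requests with the same item, arrival time and deadline remain distinct.
\<close>

datatype node = Root | Leaf nat

record request =
  item :: nat
  arrival :: real
  deadline :: real

record jrp_instance =
  root_cost :: real
  item_costs :: "real list"
  holding_rate :: real
  backlog_rate :: real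
  requests :: "request list"

definition nodes :: "jrp_instance \<Rightarrow> node set" where
  "nodes I = insert Root (Leaf ` {..<length (item_costs I)})"

fun node_cost :: "jrp_instance \<Rightarrow> node \<Rightarrow> real" where
  "node_cost I Root = root_cost I"
| "node_cost I (Leaf i) = item_costs I ! i"

text \<open>Requests are listed in order of arrival, ties being broken arbitrarily.\<close>

definition valid_instance :: "jrp_instance \<Rightarrow> bool" where
  "valid_instance I \<longleftrightarrow>
     (\<forall>u\<in>nodes I. 0 \<le> node_cost I u) \<and> 0 \<le> holding_rate I \<and> 0 \<le> backlog_rate I \<and>
     (\<forall>\<rho>\<in>set (requests I). Leaf (item \<rho>) \<in> nodes I \<and> arrival \<rho> \<le> deadline \<rho>) \<and>
     sorted (map arrival (requests I))"

text \<open>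
  \<open>served\<close> contains the positions of the requests satisfied by the service.  In a two-level tree,
  the vertex sets of the subtrees containing the root are exactly the sets of nodes containing it.
\<close>

record service =
  time :: real
  subtree :: "node set"
  served :: "nat set"

type_synonym schedule = "service list"

definition valid_service :: "jrp_instance \<Rightarrow> service \<Rightarrow> bool" where
  "valid_service I s \<longleftrightarrow>
     Root \<in> subtree s \<and> subtree s \<subseteq> nodes I \<and>
     (\<forall>j\<in>served s. j < length (requests I) \<and>
        Leaf (item (requests I ! j)) \<in> subtree s \<and> arrival (requests I ! j) \<le> time s)"

definition feasible :: "jrp_instance \<Rightarrow> schedule \<Rightarrow> bool" where
  "feasible I S \<longleftrightarrow>
     (\<forall>s\<in>set S. valid_service I s) \<and>
     (\<forall>j<length (requests I). \<exists>!k. k < length S \<and> j \<in> served (S ! k))"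

definition service_cost :: "jrp_instance \<Rightarrow> service \<Rightarrow> real" where
  "service_cost I s = (\<Sum>u\<in>subtree s. node_cost I u)"

definition delay_cost :: "jrp_instance \<Rightarrow> request \<Rightarrow> real \<Rightarrow> real" where
  "delay_cost I \<rho> t =
     (if t \<le> deadline \<rho> then holding_rate I * (deadline \<rho> - t)
      else backlog_rate I * (t - deadline \<rho>))"

definition cost :: "jrp_instance \<Rightarrow> schedule \<Rightarrow> real" where
  "cost I S =
     (\<Sum>s\<leftarrow>S. service_cost I s + (\<Sum>j\<in>served s. delay_cost I (requests I ! j) (time s)))"

definition opt :: "jrp_instance \<Rightarrow> real" where
  "opt I = Inf {cost I S | S. feasible I S}"

text \<open>The infimum is taken over a nonempty set that is bounded below.\<close>

lemma cost_nonneg: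
  assumes I: "valid_instance I" and S: "feasible I S"
  shows "0 \<le> cost I S"
proof -
  have "0 \<le> service_cost I s" if "s \<in> set S" for s
  proof -
    have "subtree s \<subseteq> nodes I" using S that by (simp add: feasible_def valid_service_def)
    then show ?thesis
      unfolding service_cost_def using I by (intro sum_nonneg) (auto simp: valid_instance_def)
  qed
  moreover have "0 \<le> delay_cost I \<rho> t" for \<rho> t
    using I by (simp add: valid_instance_def delay_cost_def)
  ultimately show ?thesis
    unfolding cost_def by (auto intro!: sum_list_nonneg add_nonneg_nonneg sum_nonneg)
qed

lemma opt_well_defined:
  assumes I: "valid_instance I"
  shows "bdd_below {cost I S | S. feasible I S}" "\<exists>S. feasible I S"
proof -
  show "bdd_below {cost I S | S. feasible I S}"
    using cost_nonneg[OF I] by (intro bdd_belowI[of _ 0]) auto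
  define t where "t = Max (insert 0 (set (map arrival (requests I))))"
  define s where
    "s = \<lparr>time = t, subtree = nodes I, served = {..<length (requests I)}\<rparr>"
  have "arrival (requests I ! j) \<le> t" if "j < length (requests I)" for j
    unfolding t_def using that by (intro Max_ge) auto
  moreover have "Leaf (item (requests I ! j)) \<in> nodes I" if "j < length (requests I)" for j
    using I that by (simp add: valid_instance_def)
  ultimately have "valid_service I s"
    by (simp add: valid_service_def s_def nodes_def)
  moreover have "\<exists>!k. k < length [s] \<and> j \<in> served ([s] ! k)" if "j < length (requests I)" for j
    using that by (intro ex1I[of _ 0]) (auto simp: s_def)
  ultimately have "feasible I [s]" by (simp add: feasible_def)
  then show "\<exists>S. feasible I S" ..
qed


section \<open>Online algorithms\<close>

text \<open>
  What is known at time \<open>t\<close>: the costs and rates, and the requests with arrival time at most \<open>t\<close>.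
  As requests are listed by arrival time, the known ones keep their positions.
\<close>

definition known :: "real \<Rightarrow> jrp_instance \<Rightarrow> jrp_instance" where
  "known t I = I\<lparr>requests := filter (\<lambda>\<rho>. arrival \<rho> \<le> t) (requests I)\<rparr>"

text \<open>
  A deterministic online algorithm is a function from instances to feasible schedules whose
  services up to any time \<open>t\<close> depend only on what is known at time \<open>t\<close>.  In particular, the
  services of \<open>A I\<close> up to time \<open>t\<close> are those of \<open>A (known t I)\<close>.
\<close>

definition online_algorithm :: "(jrp_instance \<Rightarrow> schedule) \<Rightarrow> bool" where
  "online_algorithm A \<longleftrightarrow>
     (\<forall>I. valid_instance I \<longrightarrow> feasible I (A I)) \<and>
     (\<forall>I J t. valid_instance I \<longrightarrow> valid_instance J \<longrightarrow> known t I = known t J \<longrightarrow>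
        filter (\<lambda>s. time s \<le> t) (A I) = filter (\<lambda>s. time s \<le> t) (A J))"

text \<open>
  If backlog is free, no finite ratio is possible, as every request must be satisfied at some finite
  time and the horizon is unknown: whenever the algorithm has served all known requests, another
  one arrives.  Hence a competitive ratio can be claimed only for positive backlog rates.
\<close>

definition free_backlog :: "real list \<Rightarrow> jrp_instance" where
  "free_backlog xs = \<lparr>root_cost = 1, item_costs = [0], holding_rate = 0, backlog_rate = 0,
     requests = map (\<lambda>x. \<lparr>item = 0, arrival = x, deadline = x\<rparr>) xs\<rparr>"

lemma nodes_free_backlog: "nodes (free_backlog xs) = {Root, Leaf 0}"
  by (auto simp: nodes_def free_backlog_def)

lemma valid_free_backlog: "sorted xs \<Longrightarrow> valid_instance (free_backlog xs)"
  unfolding valid_instance_def nodes_free_backlog by (simp add: free_backlog_def comp_def)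

lemma service_cost_free_backlog:
  assumes "valid_service (free_backlog xs) s" shows "service_cost (free_backlog xs) s = 1"
proof -
  have "Root \<in> subtree s" "subtree s \<subseteq> {Root, Leaf 0}"
    using assms unfolding valid_service_def nodes_free_backlog by simp_all
  then have "subtree s = {Root} \<or> subtree s = {Root, Leaf 0}" by blast
  then show ?thesis by (elim disjE) (simp_all add: service_cost_def free_backlog_def)
qed

lemma cost_free_backlog:
  assumes "feasible (free_backlog xs) S" shows "cost (free_backlog xs) S = length S"
proof -
  have "\<forall>s\<in>set S. service_cost (free_backlog xs) s = 1"
    using assms service_cost_free_backlog by (auto simp: feasible_def)
  moreover have "delay_cost (free_backlog xs) r t = 0" for r t by (simp add: delay_cost_def free_backlog_def)
  ultimately have "cost (free_backlog xs) S = (\<Sum>s\<leftarrow>S. 1)"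
    unfolding cost_def by (intro arg_cong[where f=sum_list] map_cong) simp_all
  then show ?thesis by (simp add: sum_list_triv)
qed

lemma free_backlog_many_services:
  assumes "online_algorithm A"
  shows "\<exists>xs. sorted xs \<and> length xs = k \<and> k \<le> length (A (free_backlog xs))"
proof (induction k)
  case 0 show ?case by auto
next
  case (Suc k)
  then obtain xs where xs: "sorted xs" "length xs = k" "k \<le> length (A (free_backlog xs))" by auto
  define t where "t = Max (insert 0 (set xs \<union> time ` set (A (free_backlog xs))))"
  have tx: "x \<le> t" if "x \<in> set xs" for x unfolding t_def using that by (intro Max_ge) auto
  have ts: "time s \<le> t" if "s \<in> set (A (free_backlog xs))" for s unfolding t_def using that by (intro Max_ge) auto
  define ys where "ys = xs @ [t + 1]"
  have sy: "sorted ys" using xs(1) tx by (fastforce simp: ys_def sorted_append)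
  have "known t (free_backlog xs) = known t (free_backlog ys)"
    by (simp add: known_def free_backlog_def ys_def)
  then have eq: "filter (\<lambda>s. time s \<le> t) (A (free_backlog xs)) = filter (\<lambda>s. time s \<le> t) (A (free_backlog ys))"
    using assms valid_free_backlog[OF xs(1)] valid_free_backlog[OF sy] unfolding online_algorithm_def by blast
  have "filter (\<lambda>s. time s \<le> t) (A (free_backlog xs)) = A (free_backlog xs)" using ts by (simp add: filter_id_conv)
  with eq have len: "k \<le> length (filter (\<lambda>s. time s \<le> t) (A (free_backlog ys)))" using xs(3) by simp
  have f: "feasible (free_backlog ys) (A (free_backlog ys))" using assms valid_free_backlog[OF sy] by (auto simp: online_algorithm_def)
  have "k < length (requests (free_backlog ys))" by (simp add: free_backlog_def ys_def xs(2))
  then obtain i where i: "i < length (A (free_backlog ys))" "k \<in> served (A (free_backlog ys) ! i)"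
    using f unfolding feasible_def by blast
  then have "arrival (requests (free_backlog ys) ! k) \<le> time (A (free_backlog ys) ! i)"
    using f unfolding feasible_def valid_service_def by (meson nth_mem)
  moreover have "arrival (requests (free_backlog ys) ! k) = t + 1"
    using xs(2) by (simp add: free_backlog_def ys_def nth_append)
  ultimately have "\<not> time (A (free_backlog ys) ! i) \<le> t" by simp
  then have "length (filter (\<lambda>s. time s \<le> t) (A (free_backlog ys))) < length (A (free_backlog ys))"
    using i(1) by (meson length_filter_less nth_mem)
  then show ?case using len sy xs(2) by (intro exI[of _ ys]) (auto simp: ys_def)
qed

lemma opt_free_backlog:
  assumes "sorted xs" shows "opt (free_backlog xs) \<le> 1"
proof -
  define S where "S = [\<lparr>time = Max (insert 0 (set xs)), subtree = {Root, Leaf 0}, served = {..<length xs}\<rparr>]"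
  have f: "feasible (free_backlog xs) S"
    unfolding feasible_def valid_service_def nodes_free_backlog by (auto simp: S_def free_backlog_def)
  have "1 \<in> {cost (free_backlog xs) S | S. feasible (free_backlog xs) S}"
    using f cost_free_backlog[OF f] by (force simp: S_def)
  moreover have "bdd_below {cost (free_backlog xs) S | S. feasible (free_backlog xs) S}"
    by (rule bdd_belowI[of _ 0]) (auto simp: cost_free_backlog)
  ultimately show ?thesis unfolding opt_def by (rule cInf_lower)
qed

lemma no_competitive_free_backlog:
  assumes "online_algorithm A"
  shows "\<exists>I. valid_instance I \<and> backlog_rate I = 0 \<and> \<not> cost I (A I) \<le> K * opt I"
proof -
  obtain k :: nat where k: "real k > \<bar>K\<bar>" using reals_Archimedean2 by blast
  obtain xs where xs: "sorted xs" "k \<le> length (A (free_backlog xs))" using free_backlog_many_services[OF assms] by blast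
  have f: "feasible (free_backlog xs) (A (free_backlog xs))" using assms valid_free_backlog[OF xs(1)] by (auto simp: online_algorithm_def)
  have o0: "0 \<le> opt (free_backlog xs)" unfolding opt_def
    by (rule cInf_greatest) (use f in \<open>auto simp: cost_free_backlog\<close>)
  have "K * opt (free_backlog xs) \<le> \<bar>K\<bar> * 1"
    using opt_free_backlog[OF xs(1)] o0 by (intro mult_mono) auto
  then have "\<not> cost (free_backlog xs) (A (free_backlog xs)) \<le> K * opt (free_backlog xs)" using k xs(2) cost_free_backlog[OF f] by simp
  then show ?thesis using valid_free_backlog[OF xs(1)] by (intro exI[of _ "free_backlog xs"]) (auto simp: free_backlog_def)
qed


section \<open>Polynomial time\<close>

text \<open>
  Times and costs are arbitrary real numbers, so running time is measured on a real-number machine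
  (in the sense of Blum, Shub and Smale) in which an exact arithmetic operation or comparison is
  one step.  The machine is presented as a first-order call-by-value functional language over lists
  with real-number atoms.  There is no rounding, and the only numeric constants are integers.
\<close>

datatype val = Num real | Nl | Cs val val

datatype arith_op = Add | Sub | Mul | Div

fun apply_op :: "arith_op \<Rightarrow> real \<Rightarrow> real \<Rightarrow> real" where
  "apply_op Add x y = x + y"
| "apply_op Sub x y = x - y"
| "apply_op Mul x y = x * y"
| "apply_op Div x y = x / y"

text \<open>Variables are de Bruijn indices; \<open>Call f e\<close> calls the \<open>f\<close>-th function with one argument.\<close>

datatype exp =
    Var nat
  | Lit int
  | Arith arith_op exp exp
  | Empty
  | Cell exp exp
  | Fst exp
  | Snd exp
  | IfLe exp exp exp exp
  | IfEmpty exp exp exp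
  | LetIn exp exp
  | Call nat exp

text \<open>A program is the list of its function bodies; execution starts with the first one.\<close>

type_synonym program = "exp list"

text \<open>
  \<open>evaluates P env e v t\<close>: in environment \<open>env\<close> the expression \<open>e\<close> evaluates to \<open>v\<close> in \<open>t\<close> steps.
  Ill-typed operations and division by zero have no value.
\<close>

inductive evaluates :: "program \<Rightarrow> val list \<Rightarrow> exp \<Rightarrow> val \<Rightarrow> nat \<Rightarrow> bool" for P :: program where
  Var: "i < length env \<Longrightarrow> evaluates P env (Var i) (env ! i) 1"
| Lit: "evaluates P env (Lit z) (Num (of_int z)) 1"
| Arith: "\<lbrakk>evaluates P env e1 (Num x) t1; evaluates P env e2 (Num y) t2; p = Div \<Longrightarrow> y \<noteq> 0\<rbrakk>
     \<Longrightarrow> evaluates P env (Arith p e1 e2) (Num (apply_op p x y)) (t1 + t2 + 1)"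
| Empty: "evaluates P env Empty Nl 1"
| Cell: "\<lbrakk>evaluates P env e1 v1 t1; evaluates P env e2 v2 t2\<rbrakk>
     \<Longrightarrow> evaluates P env (Cell e1 e2) (Cs v1 v2) (t1 + t2 + 1)"
| Fst: "evaluates P env e (Cs v1 v2) t \<Longrightarrow> evaluates P env (Fst e) v1 (t + 1)"
| Snd: "evaluates P env e (Cs v1 v2) t \<Longrightarrow> evaluates P env (Snd e) v2 (t + 1)"
| IfLe_True: "\<lbrakk>evaluates P env e1 (Num x) t1; evaluates P env e2 (Num y) t2; x \<le> y; evaluates P env e3 v t3\<rbrakk>
     \<Longrightarrow> evaluates P env (IfLe e1 e2 e3 e4) v (t1 + t2 + t3 + 1)"
| IfLe_False: "\<lbrakk>evaluates P env e1 (Num x) t1; evaluates P env e2 (Num y) t2; \<not> x \<le> y; evaluates P env e4 v t3\<rbrakk>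
     \<Longrightarrow> evaluates P env (IfLe e1 e2 e3 e4) v (t1 + t2 + t3 + 1)"
| IfEmpty_True: "\<lbrakk>evaluates P env e1 Nl t1; evaluates P env e2 v t2\<rbrakk>
     \<Longrightarrow> evaluates P env (IfEmpty e1 e2 e3) v (t1 + t2 + 1)"
| IfEmpty_False: "\<lbrakk>evaluates P env e1 (Cs v1 v2) t1; evaluates P env e3 v t2\<rbrakk>
     \<Longrightarrow> evaluates P env (IfEmpty e1 e2 e3) v (t1 + t2 + 1)"
| LetIn: "\<lbrakk>evaluates P env e1 v1 t1; evaluates P (v1 # env) e2 v t2\<rbrakk>
     \<Longrightarrow> evaluates P env (LetIn e1 e2) v (t1 + t2 + 1)"
| Call: "\<lbrakk>f < length P; evaluates P env e v1 t1; evaluates P [v1] (P ! f) v t2\<rbrakk>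
     \<Longrightarrow> evaluates P env (Call f e) v (t1 + t2 + 1)"

inductive_cases evaluates_elims:
  "evaluates P env (Var i) v t" "evaluates P env (Lit z) v t" "evaluates P env (Arith p e1 e2) v t"
  "evaluates P env Empty v t" "evaluates P env (Cell e1 e2) v t" "evaluates P env (Fst e) v t"
  "evaluates P env (Snd e) v t" "evaluates P env (IfLe e1 e2 e3 e4) v t"
  "evaluates P env (IfEmpty e1 e2 e3) v t" "evaluates P env (LetIn e1 e2) v t" "evaluates P env (Call f e) v t"

lemma evaluates_deterministic:
  "evaluates P env e v t \<Longrightarrow> evaluates P env e v' t' \<Longrightarrow> v = v' \<and> t = t'"
proof (induction arbitrary: v' t' rule: evaluates.induct)
  case Var then show ?case by (auto elim: evaluates_elims)
next
  case Lit then show ?case by (auto elim: evaluates_elims)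
next
  case Arith from Arith.prems show ?case by (rule evaluates_elims) (auto dest!: Arith.IH)
next
  case Empty then show ?case by (auto elim: evaluates_elims)
next
  case Cell from Cell.prems show ?case by (rule evaluates_elims) (auto dest!: Cell.IH)
next
  case Fst from Fst.prems show ?case by (rule evaluates_elims) (auto dest!: Fst.IH)
next
  case Snd from Snd.prems show ?case by (rule evaluates_elims) (auto dest!: Snd.IH)
next
  case IfLe_True
  from IfLe_True.prems show ?case
    by (rule evaluates_elims) (use IfLe_True.hyps in \<open>auto dest!: IfLe_True.IH\<close>)
next
  case IfLe_False
  from IfLe_False.prems show ?case
    by (rule evaluates_elims) (use IfLe_False.hyps in \<open>auto dest!: IfLe_False.IH\<close>)
next
  case IfEmpty_True
  from IfEmpty_True.prems show ?case by (rule evaluates_elims) (auto dest!: IfEmpty_True.IH)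
next
  case IfEmpty_False
  from IfEmpty_False.prems show ?case by (rule evaluates_elims) (auto dest!: IfEmpty_False.IH)
next
  case (LetIn env e1 v1 t1 e2 v t2)
  from LetIn.prems obtain u s1 s2
    where 1: "evaluates P env e1 u s1" and 2: "evaluates P (u # env) e2 v' s2" and t': "t' = s1 + s2 + 1"
    by (rule evaluates_elims) auto
  from LetIn.IH(1)[OF 1] have "v1 = u" "t1 = s1" by auto
  with LetIn.IH(2)[of v' s2] 2 t' show ?case by auto
next
  case (Call f env e v1 t1 v t2)
  from Call.prems obtain u s1 s2
    where 1: "evaluates P env e u s1" and 2: "evaluates P [u] (P ! f) v' s2" and t': "t' = s1 + s2 + 1"
    by (rule evaluates_elims) auto
  from Call.IH(1)[OF 1] have "v1 = u" "t1 = s1" by auto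
  with Call.IH(2)[of v' s2] 2 t' show ?case by auto
qed

definition runs :: "program \<Rightarrow> val \<Rightarrow> val \<Rightarrow> nat \<Rightarrow> bool" where
  "runs P inp out t \<longleftrightarrow> evaluates P [inp] (Call 0 (Var 0)) out t"

fun enc_list :: "val list \<Rightarrow> val" where
  "enc_list [] = Nl"
| "enc_list (v # vs) = Cs v (enc_list vs)"

definition enc_nat :: "nat \<Rightarrow> val" where
  "enc_nat k = Num (of_nat k)"

definition enc_request :: "request \<Rightarrow> val" where
  "enc_request \<rho> = enc_list [enc_nat (item \<rho>), Num (arrival \<rho>), Num (deadline \<rho>)]"

definition enc_instance :: "jrp_instance \<Rightarrow> val" where
  "enc_instance I = enc_list
     [Num (root_cost I), enc_list (map Num (item_costs I)), Num (holding_rate I),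
      Num (backlog_rate I), enc_list (map enc_request (requests I))]"

text \<open>Finite sets of naturals are written as increasing lists; the root is left implicit.\<close>

definition enc_service :: "service \<Rightarrow> val" where
  "enc_service s = enc_list
     [Num (time s),
      enc_list (map enc_nat (sorted_list_of_set {i. Leaf i \<in> subtree s})),
      enc_list (map enc_nat (sorted_list_of_set (served s)))]"

definition enc_schedule :: "schedule \<Rightarrow> val" where
  "enc_schedule S = enc_list (map enc_service S)"

definition instance_size :: "jrp_instance \<Rightarrow> nat" where
  "instance_size I = length (item_costs I) + length (requests I)"

text \<open>
  By the prefix property of online algorithms, a program for \<open>A\<close> also yields the decisions at
  time \<open>t\<close> in time polynomial in what is known at time \<open>t\<close>: run it on \<open>known t I\<close>.
\<close>

definition polynomial_time :: "(jrp_instance \<Rightarrow> schedule) \<Rightarrow> bool" where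
  "polynomial_time A \<longleftrightarrow>
     (\<exists>(P :: program) (q :: nat poly). \<forall>I. valid_instance I \<longrightarrow>
        (\<exists>t \<le> poly q (instance_size I). runs P (enc_instance I) (enc_schedule (A I)) t))"

end

theory Submission
  imports Defs
begin

text \<open>
  The algorithm waits until the backlog of the pending requests, counted per item beyond the leaf
  cost, reaches the root cost.  It then serves the items whose backlog covers their leaf cost.  In
  addition it looks ahead: as long as leaf costs of further items that would saturate by a time \<open>t\<close>
  plus the costs \<open>min (b * (t - d)) (h * (d - s))\<close> of the requests with deadline \<open>d\<close> between now
  (\<open>s\<close>) and \<open>t\<close> stay within half the root cost, these items and requests are served prematurely.
  Finally every served item may spend its leaf cost on holding requests in deadline order.

  The lower bound on the optimum rests on one observation: a request with deadline in an interval
  \<open>(s, t)\<close> during which a solution does not serve it costs that solution at least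
  \<open>min (b * (t - d)) (h * (d - s))\<close>, or \<open>b * (t - d)\<close> if it arrives after \<open>s\<close>.  Between
  consecutive services these costs, together with the leaf costs of items becoming saturated, add up
  to half the root cost, and between consecutive services of one item they add up to its leaf cost.
  As every request has its deadline in at most one (respectively two) of these intervals, charging
  each interval to a service of the solution inside it or to the delays of its requests gives the
  bound.
\<close>

section \<open>The selection rule\<close>

text \<open>The obstacle is that leaf, holding and backlog costs accrue on different time scales,
  while only the root cost forces a service. Everything is therefore measured at the trigger, where
  the overflow is exactly \<open>c0\<close>. The threshold \<open>c0 / 2\<close> of the look-ahead
  splits this amount: at the next trigger either the look-ahead total has passed
  \<open>c0 / 2\<close>, so that what was known at the previous service accounts for it, or at least
  \<open>c0 / 2\<close> stems from later arrivals, which no solution can serve before they arrive.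
  The same threshold keeps premature service affordable: it adds only multiples of
  \<open>c0 / 2\<close>, so a service costs at most \<open>4 * c0\<close> plus three times the leaf
  costs of its saturated items. The constant arises as 30 = 8 + 2 * 11; the full factor falls on the
  delays only.

  All times are exact: saturation and trigger times are minima of crossing times of finitely many
  linear pieces, so arithmetic operations and comparisons suffice to compute them. The running time
  follows from step budgets that are computed from the program text.\<close>

datatype entry = Entry (idx: nat) (itm: nat) (arr: real) (ddl: real)

lemma finite_obtain_max:
  fixes f :: "'a \<Rightarrow> real"
  assumes "finite A" "A \<noteq> {}"
  shows "\<exists>x\<in>A. \<forall>z\<in>A. f z \<le> f x"
proof -
  have "Max (f ` A) \<in> f ` A" using assms by (intro Max_in) auto
  then obtain x where x: "x \<in> A" "Max (f ` A) = f x" by blast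
  have "f z \<le> f x" if "z \<in> A" for z unfolding x(2)[symmetric] using assms that by (intro Max_ge) auto
  then show ?thesis using x(1) by blast
qed

text \<open>There are no assumptions here, so the definitions below are total functions of the costs
  and rates, and the algorithm is defined on every instance. Signs are added in
  \<open>jrp_costs\<close>.\<close>

locale jrp =
  fixes c0 h b :: real and c :: "nat \<Rightarrow> real"
begin

definition fam :: "entry set \<Rightarrow> nat \<Rightarrow> entry set" where
  "fam G i = {x \<in> G. itm x = i}"

definition backlog :: "entry set \<Rightarrow> nat \<Rightarrow> real \<Rightarrow> real" where
  "backlog G i t = (\<Sum>x\<in>fam G i. b * max 0 (t - ddl x))"

text \<open>The solution \<open>t\<close> of the linear equation in which the terms
  \<open>b * (t - ddl x)\<close>, over the requests of item \<open>i\<close> due by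
  \<open>y\<close>, sum to \<open>c i\<close>: the crossing time of one piece of the
  backlog.\<close>

definition cand :: "entry set \<Rightarrow> nat \<Rightarrow> real \<Rightarrow> real" where
  "cand G i y = (c i + b * (\<Sum>x | x \<in> fam G i \<and> ddl x \<le> y. ddl x)) /
     (b * card {x \<in> fam G i. ddl x \<le> y})"

text \<open>The backlog is convex and piecewise linear in time, so the time at which it reaches the leaf cost
  is the least of the times at which its linear pieces do.\<close>

definition sat :: "entry set \<Rightarrow> nat \<Rightarrow> real" where
  "sat G i = Min ((\<lambda>x. cand G i (ddl x)) ` fam G i)"

text \<open>The leaf cost is spread over the pending requests of the item, so that sums over requests count it
  once for each item.\<close>

definition share :: "entry set \<Rightarrow> entry \<Rightarrow> real" where
  "share G x = c (itm x) / card (fam G (itm x))"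

text \<open>The requests whose terms make up the linear piece of \<open>overflow\<close> indexed by
  \<open>y\<close>.\<close>

definition act :: "entry set \<Rightarrow> real \<Rightarrow> entry set" where
  "act G y = {x \<in> G. sat G (itm x) \<le> y \<and> ddl x \<le> y}"

text \<open>As for \<open>cand\<close> and \<open>sat\<close>, but for the time at which the total \<open>overflow\<close> reaches \<open>c0\<close>.\<close>

definition root :: "entry set \<Rightarrow> real \<Rightarrow> real" where
  "root G y = (c0 + (\<Sum>x | x \<in> G \<and> sat G (itm x) \<le> y. share G x) + b * (\<Sum>x\<in>act G y. ddl x)) /
     (b * card (act G y))"

text \<open>A request enters the total once its deadline has passed and its item is saturated, so
  the maxima of these two times are the breakpoints that index the pieces.\<close>

definition trig :: "entry set \<Rightarrow> real" where
  "trig G = Min ((\<lambda>x. root G (max (ddl x) (sat G (itm x)))) ` G)"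

definition overflow :: "entry set \<Rightarrow> real \<Rightarrow> real" where
  "overflow G t = (\<Sum>i\<in>itm ` G. max 0 (backlog G i t - c i))"

definition squeeze :: "real \<Rightarrow> real \<Rightarrow> entry \<Rightarrow> real" where
  "squeeze s t x = min (b * max 0 (t - ddl x)) (h * max 0 (ddl x - s))"

definition look :: "entry set \<Rightarrow> real \<Rightarrow> real \<Rightarrow> real" where
  "look G s t = (\<Sum>x\<in>G. (if s < sat G (itm x) \<and> sat G (itm x) \<le> t then share G x else 0) + squeeze s t x)"

text \<open>The sum is cumulative in deadline order, so that the test
  \<open>hold G s x \<le> c (itm x)\<close> admits a prefix of the requests of the item.\<close>

definition hold :: "entry set \<Rightarrow> real \<Rightarrow> entry \<Rightarrow> real" where
  "hold G s x = (\<Sum>z | z \<in> fam G (itm x) \<and> ddl z \<le> ddl x. h * max 0 (ddl z - s))"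

text \<open>Solves \<open>b * (reach s x - ddl x) = h * (ddl x - s)\<close>. For a deadline after
  \<open>s\<close>, the backlog is the smaller side of \<open>squeeze s t x\<close> for
  \<open>t\<close> up to \<open>reach s x\<close>, and the holding cost is from then on.\<close>

definition reach :: "real \<Rightarrow> entry \<Rightarrow> real" where
  "reach s x = ddl x + h / b * (ddl x - s)"

text \<open>The horizon is the item's own saturation time. As \<open>look\<close> grows with the
  horizon, ripeness passes to items that saturate earlier; it is automatic for items already
  saturated.\<close>

definition ripe :: "entry set \<Rightarrow> real \<Rightarrow> nat \<Rightarrow> bool" where
  "ripe G s i \<longleftrightarrow> look G s (sat G i) \<le> c0 / 2"

text \<open>Two budgets can pay for holding a request: the leaf cost of its item, and half of the
  root cost.\<close>

definition sel :: "entry set \<Rightarrow> real \<Rightarrow> entry \<Rightarrow> bool" where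
  "sel G s x \<longleftrightarrow> ripe G s (itm x) \<and> (hold G s x \<le> c (itm x) \<or> look G s (reach s x) \<le> c0 / 2)"

definition pick :: "entry set \<Rightarrow> real \<Rightarrow> entry set" where
  "pick G s = {x \<in> G. sel G s x}"

definition delay :: "entry \<Rightarrow> real \<Rightarrow> real" where
  "delay x t = (if t \<le> ddl x then h * (ddl x - t) else b * (t - ddl x))"

lemma finite_fam [simp]: "finite G \<Longrightarrow> finite (fam G i)"
  by (simp add: fam_def)

lemma fam_empty_iff: "fam G i = {} \<longleftrightarrow> i \<notin> itm ` G"
  by (auto simp: fam_def)

end

section \<open>Saturation times of single items\<close>

locale jrp_costs = jrp +
  assumes c0: "0 \<le> c0" and h: "0 \<le> h" and b: "0 < b" and c: "\<And>i. 0 \<le> c i"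
begin

text \<open>Dropping requests, and dropping the truncation at 0, can only lower the sum. Hence every
  linear piece lies below the backlog.\<close>

lemma sum_linear_le_backlog:
  assumes "finite G" "R \<subseteq> fam G i"
  shows "b * card R * t - b * (\<Sum>x\<in>R. ddl x) \<le> backlog G i t"
proof -
  have "b * card R * t - b * (\<Sum>x\<in>R. ddl x) = (\<Sum>x\<in>R. b * (t - ddl x))"
    by (simp add: sum_subtractf sum_distrib_left algebra_simps)
  also have "\<dots> \<le> (\<Sum>x\<in>R. b * max 0 (t - ddl x))"
    using b by (intro sum_mono mult_left_mono) auto
  also have "\<dots> \<le> backlog G i t"
    unfolding backlog_def using assms b by (intro sum_mono2) auto
  finally show ?thesis .
qed

lemma backlog_mono: "s \<le> t \<Longrightarrow> backlog G i s \<le> backlog G i t"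
  unfolding backlog_def using b by (intro sum_mono mult_left_mono) auto

lemma backlog_nonneg: "0 \<le> backlog G i t"
  unfolding backlog_def using b by (intro sum_nonneg) auto

lemma backlog_subset: "finite G \<Longrightarrow> fam G' i \<subseteq> fam G i \<Longrightarrow> backlog G' i t \<le> backlog G i t"
  unfolding backlog_def using b by (intro sum_mono2) auto

lemma sat_attained:
  assumes "finite G" "i \<in> itm ` G"
  obtains x where "x \<in> fam G i" "sat G i = cand G i (ddl x)"
proof -
  have "sat G i \<in> (\<lambda>x. cand G i (ddl x)) ` fam G i"
    unfolding sat_def using assms by (intro Min_in) (auto simp: fam_empty_iff)
  then show ?thesis using that by blast
qed

lemma card_prefix_pos:
  assumes "finite G" "x \<in> fam G i" shows "0 < card {z \<in> fam G i. ddl z \<le> ddl x}"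
  using assms by (auto simp: card_gt_0_iff)

lemma backlog_gt:
  assumes G: "finite G" "i \<in> itm ` G" and t: "sat G i < t"
  shows "c i < backlog G i t"
proof -
  obtain x where x: "x \<in> fam G i" "sat G i = cand G i (ddl x)" using sat_attained[OF G] .
  let ?R = "{z \<in> fam G i. ddl z \<le> ddl x}"
  have p: "0 < b * card ?R" using b card_prefix_pos[OF G(1) x(1)] by simp
  have "c i < b * card ?R * t - b * (\<Sum>x\<in>?R. ddl x)"
    using t x(2) p by (simp add: cand_def pos_divide_less_eq algebra_simps)
  also have "\<dots> \<le> backlog G i t" using G by (intro sum_linear_le_backlog) auto
  finally show ?thesis .
qed

lemma backlog_ge:
  assumes G: "finite G" "i \<in> itm ` G" and t: "sat G i \<le> t"
  shows "c i \<le> backlog G i t"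
proof -
  obtain x where x: "x \<in> fam G i" "sat G i = cand G i (ddl x)" using sat_attained[OF G] .
  let ?R = "{z \<in> fam G i. ddl z \<le> ddl x}"
  have p: "0 < b * card ?R" using b card_prefix_pos[OF G(1) x(1)] by simp
  have "c i \<le> b * card ?R * t - b * (\<Sum>x\<in>?R. ddl x)"
    using t x(2) p by (simp add: cand_def pos_divide_le_eq algebra_simps)
  also have "\<dots> \<le> backlog G i t" using G by (intro sum_linear_le_backlog) auto
  finally show ?thesis .
qed

text \<open>At time \<open>t\<close> the piece formed by the deadlines before \<open>t\<close>
  equals the backlog. If it exceeded \<open>c i\<close>, it would have crossed \<open>c i\<close>
  before \<open>t\<close>, contrary to \<open>sat\<close> being the least crossing time.\<close>

lemma backlog_le:
  assumes G: "finite G" "i \<in> itm ` G" and t: "t \<le> sat G i"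
  shows "backlog G i t \<le> c i"
proof (rule ccontr)
  assume "\<not> ?thesis"
  then have gt: "c i < backlog G i t" by simp
  let ?L = "{z \<in> fam G i. ddl z < t}"
  have bl: "backlog G i t = (\<Sum>z\<in>?L. b * (t - ddl z))"
    unfolding backlog_def using G
    by (intro sum.mono_neutral_cong_right) auto
  have ne: "?L \<noteq> {}"
  proof
    assume "?L = {}"
    then have "backlog G i t = 0" unfolding bl by (simp only: sum.empty)
    then show False using gt c[of i] by simp
  qed
  have fin: "finite ?L" using G by simp
  obtain x where x: "x \<in> ?L" and mx: "\<And>z. z \<in> ?L \<Longrightarrow> ddl z \<le> ddl x"
    using finite_obtain_max[OF fin ne, of ddl] by blast
  \<comment> \<open>The deadlines before \<open>t\<close> form a prefix determined by its latest
    member, so this piece is one of the candidates in \<open>sat\<close>.\<close>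
  have eq: "{z \<in> fam G i. ddl z \<le> ddl x} = ?L" using x mx by force
  have p: "0 < b * card ?L" using ne fin b by (simp add: card_gt_0_iff)
  have "c i < b * card ?L * t - b * (\<Sum>z\<in>?L. ddl z)"
    using gt bl by (simp add: sum_subtractf sum_distrib_left algebra_simps)
  then have "cand G i (ddl x) < t"
    unfolding cand_def eq using p by (simp add: pos_divide_less_eq algebra_simps eq)
  moreover have "sat G i \<le> cand G i (ddl x)"
    unfolding sat_def using G x by (intro Min_le) auto
  ultimately show False using t by simp
qed

text \<open>Before the earliest deadline the backlog is 0, whereas after the saturation time it
  exceeds the nonnegative leaf cost.\<close>

lemma ex_ddl_le_sat:
  assumes G: "finite G" "i \<in> itm ` G"
  shows "\<exists>x\<in>fam G i. ddl x \<le> sat G i"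
proof (rule ccontr)
  assume *: "\<not> ?thesis"
  let ?m = "Min (ddl ` fam G i)"
  have ne: "finite (ddl ` fam G i)" "ddl ` fam G i \<noteq> {}" using G by (auto simp: fam_empty_iff)
  have "?m \<in> ddl ` fam G i" using ne by (rule Min_in)
  then have "sat G i < ?m" using * by auto
  then have "c i < backlog G i ?m" by (rule backlog_gt[OF G])
  moreover have "backlog G i ?m = 0"
    unfolding backlog_def using ne by (intro sum.neutral) auto
  ultimately show False using c[of i] by simp
qed

lemma sum_share:
  assumes "finite G"
  shows "(\<Sum>x | x \<in> G \<and> Q (itm x). share G x) = (\<Sum>i | i \<in> itm ` G \<and> Q i. c i)"
proof -
  let ?A = "{x \<in> G. Q (itm x)}" and ?B = "{i \<in> itm ` G. Q i}"
  have "(\<Sum>i\<in>?B. \<Sum>x | x \<in> ?A \<and> itm x = i. share G x) = (\<Sum>x\<in>?A. share G x)"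
    using assms by (intro sum.group) auto
  moreover have "(\<Sum>x | x \<in> ?A \<and> itm x = i. share G x) = c i" if "i \<in> ?B" for i
  proof -
    have eq: "{x. x \<in> ?A \<and> itm x = i} = fam G i" using that by (auto simp: fam_def)
    have "card (fam G i) \<noteq> 0" using assms that fam_empty_iff[of G i] by simp
    moreover have "(\<Sum>x\<in>fam G i. share G x) = (\<Sum>x\<in>fam G i. c i / card (fam G i))"
      by (rule sum.cong) (auto simp: share_def fam_def)
    ultimately show ?thesis unfolding eq by simp
  qed
  ultimately show ?thesis by simp
qed

lemma sum_fam:
  assumes "finite G"
  shows "(\<Sum>i\<in>itm ` G. \<Sum>x\<in>fam G i. f x) = (\<Sum>x\<in>G. f x)"
  unfolding fam_def using assms by (intro sum.group) auto

section \<open>The overflow and the trigger time\<close>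

lemma overflow_mono: "s \<le> t \<Longrightarrow> overflow G s \<le> overflow G t"
  unfolding overflow_def by (intro sum_mono max.mono diff_mono backlog_mono order.refl)

text \<open>Needed when requests arrive: a deadline is never before the arrival, so a new request
  leaves the overflow at its arrival time unchanged.\<close>

lemma overflow_future:
  assumes "finite G" "finite N" "\<And>x. x \<in> N \<Longrightarrow> t \<le> ddl x"
  shows "overflow (G \<union> N) t = overflow G t"
proof -
  have bl: "backlog (G \<union> N) i t = backlog G i t" for i
    unfolding backlog_def using assms by (intro sum.mono_neutral_right) (auto simp: fam_def)
  have "overflow (G \<union> N) t = (\<Sum>i\<in>itm ` (G \<union> N). max 0 (backlog G i t - c i))"
    by (simp add: overflow_def bl)
  also have "\<dots> = overflow G t" unfolding overflow_def
  proof (intro sum.mono_neutral_right ballI)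
    fix i assume "i \<in> itm ` (G \<union> N) - itm ` G"
    then have "fam G i = {}" by (simp add: fam_empty_iff)
    then show "max 0 (backlog G i t - c i) = 0" using c[of i] by (simp add: backlog_def)
  qed (use assms in auto)
  finally show ?thesis .
qed

lemma act_linear:
  assumes G: "finite G"
  shows "b * card (act G y) * t - b * (\<Sum>x\<in>act G y. ddl x)
    = (\<Sum>i | i \<in> itm ` G \<and> sat G i \<le> y. \<Sum>x | x \<in> fam G i \<and> ddl x \<le> y. b * (t - ddl x))"
proof -
  have "b * card (act G y) * t - b * (\<Sum>x\<in>act G y. ddl x) = (\<Sum>x\<in>act G y. b * (t - ddl x))"
    by (simp add: sum_subtractf sum_distrib_left algebra_simps)
  also have "\<dots> = (\<Sum>i | i \<in> itm ` G \<and> sat G i \<le> y. \<Sum>x | x \<in> act G y \<and> itm x = i. b * (t - ddl x))"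
    using G by (intro sum.group[symmetric]) (auto simp: act_def)
  also have "\<dots> = (\<Sum>i | i \<in> itm ` G \<and> sat G i \<le> y. \<Sum>x | x \<in> fam G i \<and> ddl x \<le> y. b * (t - ddl x))"
    by (intro sum.cong) (auto simp: act_def fam_def)
  finally show ?thesis .
qed

text \<open>Item by item, the piece lies below the backlog; the truncation at 0 and the items not
  saturated by \<open>y\<close> only add to the overflow.\<close>

lemma linear_le_overflow:
  assumes G: "finite G"
  shows "b * card (act G y) * t - b * (\<Sum>x\<in>act G y. ddl x)
    - (\<Sum>x | x \<in> G \<and> sat G (itm x) \<le> y. share G x) \<le> overflow G t"
proof -
  let ?S = "{i \<in> itm ` G. sat G i \<le> y}"
  have "(\<Sum>x | x \<in> fam G i \<and> ddl x \<le> y. b * (t - ddl x)) \<le> backlog G i t" for i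
    using sum_linear_le_backlog[OF G, of "{x \<in> fam G i. ddl x \<le> y}" i t]
    by (simp add: sum_subtractf sum_distrib_left algebra_simps)
  then have "b * card (act G y) * t - b * (\<Sum>x\<in>act G y. ddl x)
    - (\<Sum>x | x \<in> G \<and> sat G (itm x) \<le> y. share G x) \<le> (\<Sum>i\<in>?S. backlog G i t - c i)"
    unfolding act_linear[OF G] sum_share[OF G, of "\<lambda>i. sat G i \<le> y"] sum_subtractf
    by (simp add: sum_mono)
  also have "\<dots> \<le> (\<Sum>i\<in>?S. max 0 (backlog G i t - c i))" by (intro sum_mono) auto
  also have "\<dots> \<le> overflow G t" unfolding overflow_def using G by (intro sum_mono2) auto
  finally show ?thesis .
qed

lemma act_pos:
  assumes "finite G" "x \<in> G"
  shows "0 < card (act G (max (ddl x) (sat G (itm x))))"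
proof -
  have "x \<in> act G (max (ddl x) (sat G (itm x)))" using assms by (simp add: act_def)
  moreover have "finite (act G (max (ddl x) (sat G (itm x))))" using assms by (simp add: act_def)
  ultimately show ?thesis by (auto simp: card_gt_0_iff)
qed

lemma trig_attained:
  assumes "finite G" "G \<noteq> {}"
  obtains x where "x \<in> G" "trig G = root G (max (ddl x) (sat G (itm x)))"
proof -
  have "trig G \<in> (\<lambda>x. root G (max (ddl x) (sat G (itm x)))) ` G"
    unfolding trig_def using assms by (intro Min_in) auto
  then show ?thesis using that by blast
qed

lemma overflow_gt:
  assumes G: "finite G" "G \<noteq> {}" and t: "trig G < t"
  shows "c0 < overflow G t"
proof -
  obtain x where x: "x \<in> G" "trig G = root G (max (ddl x) (sat G (itm x)))"
    using trig_attained[OF G] .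
  let ?y = "max (ddl x) (sat G (itm x))"
  have p: "0 < b * card (act G ?y)" using b act_pos[OF G(1) x(1)] by simp
  then have "c0 < b * card (act G ?y) * t - b * (\<Sum>x\<in>act G ?y. ddl x)
    - (\<Sum>x | x \<in> G \<and> sat G (itm x) \<le> ?y. share G x)"
    using t x(2) by (simp add: root_def pos_divide_less_eq algebra_simps)
  then show ?thesis using linear_le_overflow[OF G(1), of ?y t] by linarith
qed

text \<open>The piece attaining the minimum lies below the overflow, which gives one inequality. For
  the other, the piece of the latest breakpoint up to \<open>trig G\<close> coincides with the
  overflow there; were it above \<open>c0\<close>, it would have crossed \<open>c0\<close> before
  the least crossing time.\<close>

lemma overflow_trig:
  assumes G: "finite G" "G \<noteq> {}"
  shows "overflow G (trig G) = c0"
proof (rule antisym)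
  obtain x where x: "x \<in> G" "trig G = root G (max (ddl x) (sat G (itm x)))"
    using trig_attained[OF G] .
  let ?y = "max (ddl x) (sat G (itm x))"
  have "0 < b * card (act G ?y)" using b act_pos[OF G(1) x(1)] by simp
  then have "c0 \<le> b * card (act G ?y) * trig G - b * (\<Sum>x\<in>act G ?y. ddl x)
    - (\<Sum>x | x \<in> G \<and> sat G (itm x) \<le> ?y. share G x)"
    using x(2) by (simp add: root_def field_simps)
  then show "c0 \<le> overflow G (trig G)" using linear_le_overflow[OF G(1), of ?y "trig G"] by linarith
next
  show "overflow G (trig G) \<le> c0"
  proof (rule ccontr)
    let ?t = "trig G"
    assume "\<not> ?thesis"
    then have gt: "c0 < overflow G ?t" by simp
    let ?y = "\<lambda>x. max (ddl x) (sat G (itm x))"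
    let ?A = "{x \<in> G. ?y x \<le> ?t}"
    have "\<exists>i\<in>itm ` G. sat G i \<le> ?t"
    proof (rule ccontr)
      assume "\<not> ?thesis"
      then have "overflow G ?t = 0" unfolding overflow_def
        using backlog_le[OF G(1), of _ ?t] by (intro sum.neutral ballI max_absorb1) (meson diff_le_0_iff_le less_imp_le not_le)
      then show False using gt c0 by simp
    qed
    then obtain i where i: "i \<in> itm ` G" "sat G i \<le> ?t" by blast
    \<comment> \<open>A saturated item has a request due by its saturation time, so this time is
      itself a breakpoint. Hence no item saturates between the latest breakpoint and
      \<open>?t\<close>.\<close>
    have ex: "\<exists>x\<in>?A. itm x = i \<and> ?y x = sat G i" if i: "i \<in> itm ` G" "sat G i \<le> ?t" for i
    proof -
      obtain x where "x \<in> fam G i" "ddl x \<le> sat G i" using ex_ddl_le_sat[OF G(1) i(1)] by blast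
      then show ?thesis using i(2) by (intro bexI[of _ x]) (simp_all add: fam_def max_def)
    qed
    then have ne: "?A \<noteq> {}" using i by blast
    have fin: "finite ?A" using G by simp
    obtain x where x: "x \<in> ?A" and mx: "\<And>z. z \<in> ?A \<Longrightarrow> ?y z \<le> ?y x"
      using finite_obtain_max[OF fin ne, of ?y] by blast
    have S: "{i \<in> itm ` G. sat G i \<le> ?y x} = {i \<in> itm ` G. sat G i \<le> ?t}" (is "?S = ?T")
    proof -
      have "sat G i \<le> ?y x \<longleftrightarrow> sat G i \<le> ?t" if i: "i \<in> itm ` G" for i
      proof
        assume "sat G i \<le> ?y x"
        also have "?y x \<le> ?t" using x by blast
        finally show "sat G i \<le> ?t" .
      next
        assume "sat G i \<le> ?t"
        then obtain z where z: "z \<in> ?A" "?y z = sat G i" using ex[OF i] by blast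
        show "sat G i \<le> ?y x" using mx[OF z(1)] unfolding z(2) .
      qed
      then show ?thesis by blast
    qed
    have R: "ddl z \<le> ?y x \<longleftrightarrow> ddl z \<le> ?t" if "z \<in> fam G i" "i \<in> ?T" for z i
    proof
      assume "ddl z \<le> ?y x"
      also have "?y x \<le> ?t" using x by blast
      finally show "ddl z \<le> ?t" .
    next
      assume "ddl z \<le> ?t"
      then have "z \<in> ?A" using that by (auto simp: fam_def)
      then show "ddl z \<le> ?y x" using mx[of z] by linarith
    qed
    have "overflow G ?t = (\<Sum>i\<in>?T. backlog G i ?t - c i)"
      unfolding overflow_def
    proof (intro sum.mono_neutral_cong_right ballI)
      show "finite (itm ` G)" using G by simp
      show "max 0 (backlog G i ?t - c i) = 0" if "i \<in> itm ` G - ?T" for i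
        using backlog_le[OF G(1), of i ?t] that by (intro max_absorb1) auto
      show "max 0 (backlog G i ?t - c i) = backlog G i ?t - c i" if "i \<in> ?T" for i
        using backlog_ge[OF G(1), of i ?t] that by (intro max_absorb2) auto
    qed auto
    also have "\<dots> = (\<Sum>i\<in>?T. (\<Sum>z | z \<in> fam G i \<and> ddl z \<le> ?y x. b * (?t - ddl z)) - c i)"
    proof (intro sum.cong refl arg_cong2[where f = minus])
      fix i assume i: "i \<in> ?T"
      show "backlog G i ?t = (\<Sum>z | z \<in> fam G i \<and> ddl z \<le> ?y x. b * (?t - ddl z))"
        unfolding backlog_def
      proof (intro sum.mono_neutral_cong_right ballI)
        fix z assume "z \<in> fam G i - {z \<in> fam G i. ddl z \<le> ?y x}"
        then have "\<not> ddl z \<le> ?t" using R[OF _ i] by blast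
        then show "b * max 0 (?t - ddl z) = 0" by simp
      next
        fix z assume "z \<in> {z \<in> fam G i. ddl z \<le> ?y x}"
        then have "ddl z \<le> ?t" using R[OF _ i] by blast
        then show "b * max 0 (?t - ddl z) = b * (?t - ddl z)" by simp
      qed (use G in auto)
    qed
    also have "\<dots> = b * card (act G (?y x)) * ?t - b * (\<Sum>z\<in>act G (?y x). ddl z)
      - (\<Sum>z | z \<in> G \<and> sat G (itm z) \<le> ?y x. share G z)"
      unfolding act_linear[OF G(1)] sum_share[OF G(1), of "\<lambda>i. sat G i \<le> ?y x"] sum_subtractf S ..
    finally have "c0 < b * card (act G (?y x)) * ?t - b * (\<Sum>z\<in>act G (?y x). ddl z)
      - (\<Sum>z | z \<in> G \<and> sat G (itm z) \<le> ?y x. share G z)" using gt by simp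
    moreover have "0 < b * card (act G (?y x))" using b act_pos[OF G(1), of x] x by simp
    ultimately have "root G (?y x) < ?t"
      by (simp add: root_def pos_divide_less_eq algebra_simps)
    moreover have "?t \<le> root G (?y x)"
      unfolding trig_def using G x by (intro Min_le) auto
    ultimately show False by simp
  qed
qed

lemma le_trig: "finite G \<Longrightarrow> G \<noteq> {} \<Longrightarrow> overflow G t \<le> c0 \<Longrightarrow> t \<le> trig G"
  using overflow_gt[of G t] by (meson not_le)

text \<open>Up to the first saturation the overflow is 0, while after the trigger it is strictly
  above \<open>c0\<close>. The strictness covers the case \<open>c0 = 0\<close>.\<close>

lemma ex_sat_le_trig:
  assumes G: "finite G" "G \<noteq> {}"
  shows "\<exists>i\<in>itm ` G. sat G i \<le> trig G"
proof (rule ccontr)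
  assume *: "\<not> ?thesis"
  let ?m = "Min (sat G ` itm ` G)"
  have m: "?m \<in> sat G ` itm ` G" using G by (intro Min_in) auto
  then have "trig G < ?m" using * by auto
  then have "c0 < overflow G ?m" by (rule overflow_gt[OF G])
  moreover have "overflow G ?m = 0" unfolding overflow_def
  proof (intro sum.neutral ballI)
    fix i assume i: "i \<in> itm ` G"
    have "?m \<le> sat G i" using G i by (intro Min_le) auto
    from backlog_le[OF G(1) i this] show "max 0 (backlog G i ?m - c i) = 0" by simp
  qed
  ultimately show False using c0 by simp
qed

section \<open>The look-ahead and the selected requests\<close>

lemma look_alt:
  assumes "finite G"
  shows "look G s t = (\<Sum>i | i \<in> itm ` G \<and> s < sat G i \<and> sat G i \<le> t. c i) + (\<Sum>x\<in>G. squeeze s t x)"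
  unfolding look_def sum.distrib
  using sum_share[OF assms, of "\<lambda>i. s < sat G i \<and> sat G i \<le> t"] assms
  by (simp add: sum.inter_filter)

lemma squeeze_nonneg: "0 \<le> squeeze s t x"
  using b h by (simp add: squeeze_def)

lemma squeeze_mono: "t \<le> u \<Longrightarrow> squeeze s t x \<le> squeeze s u x"
  unfolding squeeze_def using b by (intro min.mono mult_left_mono order.refl) auto

lemma look_mono:
  assumes "finite G" "t \<le> u" shows "look G s t \<le> look G s u"
  unfolding look_alt[OF assms(1)] using assms c
  by (intro add_mono sum_mono2 sum_mono squeeze_mono) auto

lemma look_le_self: "finite G \<Longrightarrow> t \<le> s \<Longrightarrow> look G s t = 0"
proof -
  assume G: "finite G" "t \<le> s"
  have "squeeze s t x = 0" for x
    using squeeze_nonneg[of s t x] G b h by (cases "ddl x \<le> s") (simp_all add: squeeze_def)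
  then show ?thesis unfolding look_def using G by (intro sum.neutral) auto
qed

lemma ripe_if_sat_le: "finite G \<Longrightarrow> sat G i \<le> s \<Longrightarrow> ripe G s i"
  using c0 by (simp add: ripe_def look_le_self)

lemma hold_eq_0: "ddl x \<le> s \<Longrightarrow> hold G s x = 0"
  unfolding hold_def by (intro sum.neutral) auto

lemma sel_if_overdue: "ripe G s (itm x) \<Longrightarrow> ddl x \<le> s \<Longrightarrow> sel G s x"
  using c by (simp add: sel_def hold_eq_0)

text \<open>Every service makes progress: some item is saturated at the trigger, hence ripe, and its
  overdue requests are selected.\<close>

lemma pick_trig_nonempty:
  assumes G: "finite G" "G \<noteq> {}"
  shows "pick G (trig G) \<noteq> {}"
proof -
  obtain i where i: "i \<in> itm ` G" "sat G i \<le> trig G" using ex_sat_le_trig[OF G] by blast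
  obtain x where x: "x \<in> fam G i" "ddl x \<le> sat G i" using ex_ddl_le_sat[OF G(1) i(1)] by blast
  have "sel G (trig G) x"
    using ripe_if_sat_le[OF G(1) i(2)] x i(2) by (intro sel_if_overdue) (auto simp: fam_def)
  then show ?thesis using x by (auto simp: pick_def fam_def)
qed

text \<open>A saturated item is ripe and loses all its overdue requests; an unsaturated one has
  backlog at most its leaf cost. The remaining requests thus start afresh, with their trigger not
  before \<open>t\<close>.\<close>

lemma overflow_rest:
  assumes G: "finite G"
  shows "overflow (G - pick G t) t = 0"
  unfolding overflow_def
proof (intro sum.neutral ballI)
  fix i assume "i \<in> itm ` (G - pick G t)"
  let ?A = "G - pick G t"
  have "backlog ?A i t \<le> c i"
  proof (cases "i \<in> itm ` G \<and> t < sat G i")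
    case True
    have "backlog ?A i t \<le> backlog G i t" using G by (intro backlog_subset) (auto simp: fam_def)
    also have "\<dots> \<le> c i" using True by (intro backlog_le G) auto
    finally show ?thesis .
  next
    case False
    have "backlog ?A i t = 0" unfolding backlog_def
    proof (intro sum.neutral ballI)
      fix x assume "x \<in> fam ?A i"
      then have x: "x \<in> G" "x \<notin> pick G t" "itm x = i" by (auto simp: fam_def)
      then have "ripe G t (itm x)" using False by (intro ripe_if_sat_le G) auto
      then have "t \<le> ddl x" using sel_if_overdue[of G t x] x by (fastforce simp: pick_def)
      then show "b * max 0 (t - ddl x) = 0" by simp
    qed
    then show ?thesis using c by simp
  qed
  then show "max 0 (backlog ?A i t - c i) = 0" by simp
qed

end

section \<open>Saturated and premature items, and the cost of one service\<close>

context jrp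
begin

definition saturated :: "entry set \<Rightarrow> real \<Rightarrow> nat set" where
  "saturated G s = {i \<in> itm ` G. sat G i \<le> s}"

definition premature :: "entry set \<Rightarrow> real \<Rightarrow> nat set" where
  "premature G s = {i \<in> itm ` G. s < sat G i \<and> ripe G s i}"

end

context jrp_costs
begin

lemma delay_nonneg: "0 \<le> delay x t"
  using b h by (simp add: delay_def)

lemma delay_alt: "delay x t = b * max 0 (t - ddl x) + h * max 0 (ddl x - t)"
  by (simp add: delay_def)

text \<open>Service up to \<open>l\<close> means holding the request at least since
  \<open>l\<close>, service from \<open>r\<close> on means backlog at least until
  \<open>r\<close>.\<close>

lemma squeeze_le_delay:
  assumes "s \<le> l \<or> r \<le> s" shows "squeeze l r x \<le> delay x s"
  using assms
proof
  assume "s \<le> l"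
  then have "h * max 0 (ddl x - l) \<le> h * max 0 (ddl x - s)" using h by (intro mult_left_mono) auto
  then show ?thesis unfolding squeeze_def delay_alt using b by (intro min.coboundedI2) (simp add: add_increasing)
next
  assume "r \<le> s"
  then have "b * max 0 (r - ddl x) \<le> b * max 0 (s - ddl x)" using b by (intro mult_left_mono) auto
  then show ?thesis unfolding squeeze_def delay_alt using h by (intro min.coboundedI1) (simp add: add_increasing2)
qed

lemma squeeze_outside: "\<not> (l < ddl x \<and> ddl x < r) \<Longrightarrow> squeeze l r x = 0"
proof -
  assume *: "\<not> (l < ddl x \<and> ddl x < r)"
  have "squeeze l r x \<le> 0"
  proof (cases "l < ddl x")
    case True then show ?thesis using * unfolding squeeze_def by (intro min.coboundedI1) simp
  next
    case False then show ?thesis unfolding squeeze_def by (intro min.coboundedI2) simp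
  qed
  then show ?thesis using squeeze_nonneg[of l r x] by simp
qed

lemma finite_saturated [simp]: "finite G \<Longrightarrow> finite (saturated G s)"
  by (simp add: saturated_def)

lemma finite_premature [simp]: "finite G \<Longrightarrow> finite (premature G s)"
  by (simp add: premature_def)

lemma saturated_premature_disjoint: "saturated G s \<inter> premature G s = {}"
  by (auto simp: saturated_def premature_def)

lemma ripe_items:
  assumes "finite G" shows "{i \<in> itm ` G. ripe G s i} = saturated G s \<union> premature G s"
  using ripe_if_sat_le[OF assms] by (auto simp: saturated_def premature_def)

text \<open>The premature item that saturates last is ripe, and its look-ahead total contains the
  leaf costs of all premature items.\<close>

lemma sum_premature_le:
  assumes G: "finite G" shows "(\<Sum>i\<in>premature G s. c i) \<le> c0 / 2"
proof (cases "premature G s = {}")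
  case False
  obtain j where j: "j \<in> premature G s" and mx: "\<And>i. i \<in> premature G s \<Longrightarrow> sat G i \<le> sat G j"
    using finite_obtain_max[OF finite_premature[OF G] False, of "sat G"] by blast
  have "(\<Sum>i\<in>premature G s. c i) \<le> (\<Sum>i | i \<in> itm ` G \<and> s < sat G i \<and> sat G i \<le> sat G j. c i)"
    using G c mx by (intro sum_mono2) (auto simp: premature_def)
  also have "\<dots> \<le> look G s (sat G j)" unfolding look_alt[OF G]
    by (simp add: sum_nonneg squeeze_nonneg)
  also have "\<dots> \<le> c0 / 2" using j by (simp add: premature_def ripe_def)
  finally show ?thesis .
qed (use c0 in simp)

text \<open>At \<open>reach s x\<close> both sides of the minimum agree for \<open>x\<close>. A
  request with an earlier deadline has a smaller holding cost and a larger backlog, so for it the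
  holding cost is the minimum.\<close>

lemma squeeze_reach:
  assumes "ddl z \<le> ddl x" "s \<le> ddl x" shows "squeeze s (reach s x) z = h * max 0 (ddl z - s)"
proof -
  have "h * (ddl z - s) \<le> h * (ddl x - s)" using h assms by (intro mult_left_mono) auto
  then have "h * max 0 (ddl z - s) \<le> h * (ddl x - s)" using h assms by (simp add: max_def)
  also have "\<dots> = b * (reach s x - ddl x)" using b by (simp add: reach_def)
  also have "\<dots> \<le> b * max 0 (reach s x - ddl z)" using b assms by (intro mult_left_mono) auto
  finally show ?thesis by (simp add: squeeze_def min_def)
qed

lemma hold_budget:
  assumes G: "finite G"
  shows "(\<Sum>x | x \<in> G \<and> itm x \<in> J \<and> hold G s x \<le> c (itm x). h * max 0 (ddl x - s)) \<le> (\<Sum>i\<in>J \<inter> itm ` G. c i)"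
proof -
  let ?A = "{x \<in> G. itm x \<in> J \<and> hold G s x \<le> c (itm x)}"
  have "(\<Sum>x\<in>?A. h * max 0 (ddl x - s)) = (\<Sum>i\<in>J \<inter> itm ` G. \<Sum>x | x \<in> ?A \<and> itm x = i. h * max 0 (ddl x - s))"
    using G by (intro sum.group[symmetric]) auto
  also have "\<dots> \<le> (\<Sum>i\<in>J \<inter> itm ` G. c i)"
  proof (intro sum_mono)
    fix i
    let ?B = "{x \<in> ?A. itm x = i}"
    show "(\<Sum>x\<in>?B. h * max 0 (ddl x - s)) \<le> c i"
    proof (cases "?B = {}")
      case True
      then show ?thesis by (simp only: sum.empty c)
    next
      case False
      have fin: "finite ?B" using G by simp
      obtain x where x: "x \<in> ?B" and mx: "\<And>z. z \<in> ?B \<Longrightarrow> ddl z \<le> ddl x"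
        using finite_obtain_max[OF fin False, of ddl] by blast
      have "?B \<subseteq> {z \<in> fam G (itm x). ddl z \<le> ddl x}"
      proof
        fix z assume z: "z \<in> ?B"
        show "z \<in> {z \<in> fam G (itm x). ddl z \<le> ddl x}" using z mx[OF z] x by (auto simp: fam_def)
      qed
      then have "(\<Sum>x\<in>?B. h * max 0 (ddl x - s)) \<le> hold G s x"
        unfolding hold_def using G h by (intro sum_mono2) auto
      then show ?thesis using x by auto
    qed
  qed
  finally show ?thesis .
qed

lemma look_budget:
  assumes G: "finite G"
  shows "(\<Sum>x | x \<in> G \<and> look G s (reach s x) \<le> c0 / 2. h * max 0 (ddl x - s)) \<le> c0 / 2"
proof -
  let ?A = "{x \<in> G. look G s (reach s x) \<le> c0 / 2}"
  let ?B = "{x \<in> ?A. s \<le> ddl x}"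
  have eq: "(\<Sum>x\<in>?A. h * max 0 (ddl x - s)) = (\<Sum>x\<in>?B. h * max 0 (ddl x - s))"
    using G by (intro sum.mono_neutral_right) auto
  show ?thesis
  proof (cases "?B = {}")
    case True
    then show ?thesis unfolding eq using c0 by (simp only: sum.empty)
  next
    case False
    have fin: "finite ?B" using G by simp
    obtain x where x: "x \<in> ?B" and mx: "\<And>z. z \<in> ?B \<Longrightarrow> ddl z \<le> ddl x"
      using finite_obtain_max[OF fin False, of ddl] by blast
    have "(\<Sum>z\<in>?B. h * max 0 (ddl z - s)) = (\<Sum>z\<in>?B. squeeze s (reach s x) z)"
      using mx x by (intro sum.cong) (auto simp: squeeze_reach)
    also have "\<dots> \<le> (\<Sum>z\<in>G. squeeze s (reach s x) z)"
      using G by (intro sum_mono2) (auto simp: squeeze_nonneg)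
    also have "\<dots> \<le> look G s (reach s x)"
      unfolding look_alt[OF G] using c by (simp add: sum_nonneg)
    also have "\<dots> \<le> c0 / 2" using x by simp
    finally show ?thesis unfolding eq .
  qed
qed

lemma backlog_saturated_le:
  assumes G: "finite G" and ov: "overflow G s \<le> c0"
  shows "(\<Sum>i\<in>saturated G s. backlog G i s) \<le> c0 + (\<Sum>i\<in>saturated G s. c i)"
proof -
  have "(\<Sum>i\<in>saturated G s. backlog G i s) - (\<Sum>i\<in>saturated G s. c i) = (\<Sum>i\<in>saturated G s. backlog G i s - c i)"
    by (simp add: sum_subtractf)
  also have "\<dots> \<le> (\<Sum>i\<in>saturated G s. max 0 (backlog G i s - c i))" by (intro sum_mono) auto
  also have "\<dots> \<le> overflow G s" unfolding overflow_def using G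
    by (intro sum_mono2) (auto simp: saturated_def)
  finally show ?thesis using ov by simp
qed

text \<open>Let \<open>s\<close> and \<open>p\<close> be the leaf costs of the saturated and the
  premature items. The root costs \<open>c0\<close>, the leaves at most \<open>s + p\<close>, the
  backlog \<open>c0 + s + p\<close> and the holding \<open>s + p + c0 / 2\<close>. As
  \<open>p \<le> c0 / 2\<close>, this adds up to \<open>4 * c0 + 3 * s\<close>.\<close>

lemma pick_cost_le:
  assumes G: "finite G" and ov: "overflow G s \<le> c0"
  shows "c0 + (\<Sum>i\<in>itm ` pick G s. c i) + (\<Sum>x\<in>pick G s. delay x s) \<le> 4 * c0 + 3 * (\<Sum>i\<in>saturated G s. c i)"
proof -
  let ?S = "saturated G s" and ?P = "premature G s" and ?V = "pick G s"
  have pick: "itm ` ?V \<subseteq> ?S \<union> ?P" using ripe_items[OF G, of s] by (auto simp: pick_def sel_def)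
  have fin: "finite ?V" using G by (simp add: pick_def)
  have SP: "(\<Sum>i\<in>?S \<union> ?P. f i) = (\<Sum>i\<in>?S. f i) + (\<Sum>i\<in>?P. f i)" for f :: "nat \<Rightarrow> real"
    using G saturated_premature_disjoint by (intro sum.union_disjoint) auto
  have 1: "(\<Sum>i\<in>itm ` ?V. c i) \<le> (\<Sum>i\<in>?S. c i) + (\<Sum>i\<in>?P. c i)"
    unfolding SP[symmetric] using G c pick by (intro sum_mono2) auto
  have "(\<Sum>x\<in>?V. b * max 0 (s - ddl x)) = (\<Sum>i\<in>?S \<union> ?P. \<Sum>x | x \<in> ?V \<and> itm x = i. b * max 0 (s - ddl x))"
    using G pick fin by (intro sum.group[symmetric]) auto
  also have "\<dots> \<le> (\<Sum>i\<in>?S \<union> ?P. backlog G i s)"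
    unfolding backlog_def using G b by (intro sum_mono sum_mono2) (auto simp: fam_def pick_def)
  also have "\<dots> \<le> (c0 + (\<Sum>i\<in>?S. c i)) + (\<Sum>i\<in>?P. c i)"
    unfolding SP using backlog_saturated_le[OF G ov]
    by (intro add_mono sum_mono backlog_le G) (auto simp: premature_def)
  finally have 2: "(\<Sum>x\<in>?V. b * max 0 (s - ddl x)) \<le> c0 + (\<Sum>i\<in>?S. c i) + (\<Sum>i\<in>?P. c i)" .
  let ?A = "{x \<in> G. itm x \<in> ?S \<union> ?P \<and> hold G s x \<le> c (itm x)}"
  let ?B = "{x \<in> G. look G s (reach s x) \<le> c0 / 2}"
  have "(\<Sum>x\<in>?V. h * max 0 (ddl x - s)) \<le> (\<Sum>x\<in>?A \<union> ?B. h * max 0 (ddl x - s))"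
    using G h pick by (intro sum_mono2) (auto simp: pick_def sel_def)
  also have "\<dots> \<le> (\<Sum>x\<in>?A. h * max 0 (ddl x - s)) + (\<Sum>x\<in>?B. h * max 0 (ddl x - s))"
  proof -
    have "0 \<le> (\<Sum>x\<in>?A \<inter> ?B. h * max 0 (ddl x - s))" using h by (intro sum_nonneg) auto
    moreover have "finite ?A" "finite ?B" using G by auto
    ultimately show ?thesis using sum.union_inter[of ?A ?B "\<lambda>x. h * max 0 (ddl x - s)"] by linarith
  qed
  also have "\<dots> \<le> (\<Sum>i\<in>(?S \<union> ?P) \<inter> itm ` G. c i) + c0 / 2"
    by (intro add_mono hold_budget look_budget G)
  also have "(?S \<union> ?P) \<inter> itm ` G = ?S \<union> ?P" by (auto simp: saturated_def premature_def)
  finally have 3: "(\<Sum>x\<in>?V. h * max 0 (ddl x - s)) \<le> (\<Sum>i\<in>?S. c i) + (\<Sum>i\<in>?P. c i) + c0 / 2"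
    unfolding SP by simp
  have "(\<Sum>x\<in>?V. delay x s) = (\<Sum>x\<in>?V. b * max 0 (s - ddl x)) + (\<Sum>x\<in>?V. h * max 0 (ddl x - s))"
    unfolding delay_alt by (rule sum.distrib)
  then show ?thesis using 1 2 3 sum_premature_le[OF G, of s] by linarith
qed

end

text \<open>The charging scheme. A window with some \<open>T z\<close> strictly inside is paid by
  that \<open>z\<close>, at most \<open>C\<close>; any other one by the weights of the points
  \<open>p y\<close> strictly inside. Each \<open>z\<close> and each \<open>y\<close> lies in at
  most \<open>m\<close> windows.\<close>

lemma window_cover:
  fixes l r v :: "'w \<Rightarrow> real" and T :: "'z \<Rightarrow> real" and p g :: "'y \<Rightarrow> real" and C :: real and m :: nat
  assumes fin: "finite W" "finite Z" "finite Y"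
    and mult: "\<And>x. card {w \<in> W. l w < x \<and> x < r w} \<le> m"
    and v: "\<And>w. w \<in> W \<Longrightarrow> v w \<le> C" and C: "0 \<le> C" and g: "\<And>y. y \<in> Y \<Longrightarrow> 0 \<le> g y"
    and cov: "\<And>w. w \<in> W \<Longrightarrow> (\<And>z. z \<in> Z \<Longrightarrow> T z \<le> l w \<or> r w \<le> T z) \<Longrightarrow>
      v w \<le> (\<Sum>y | y \<in> Y \<and> l w < p y \<and> p y < r w. g y)"
  shows "(\<Sum>w\<in>W. v w) \<le> m * (C * card Z + (\<Sum>y\<in>Y. g y))"
proof -
  have count: "(\<Sum>w\<in>W. if l w < x \<and> x < r w then a else 0) \<le> m * a" if "0 \<le> a" for x a :: real
  proof -
    have "(\<Sum>w\<in>W. if l w < x \<and> x < r w then a else 0) = card {w \<in> W. l w < x \<and> x < r w} * a"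
      using fin by (simp add: sum.inter_filter[symmetric])
    also have "\<dots> \<le> m * a" using mult[of x] that by (intro mult_right_mono) auto
    finally show ?thesis .
  qed
  have "(\<Sum>w\<in>W. v w) \<le> (\<Sum>w\<in>W. (\<Sum>z\<in>Z. if l w < T z \<and> T z < r w then C else 0)
      + (\<Sum>y\<in>Y. if l w < p y \<and> p y < r w then g y else 0))"
  proof (intro sum_mono)
    fix w assume w: "w \<in> W"
    let ?s = "\<Sum>z\<in>Z. if l w < T z \<and> T z < r w then C else 0"
    let ?d = "\<Sum>y\<in>Y. if l w < p y \<and> p y < r w then g y else 0"
    have s0: "0 \<le> ?s" using C by (intro sum_nonneg) auto
    have d0: "0 \<le> ?d" using g by (intro sum_nonneg) auto
    show "v w \<le> ?s + ?d"
    proof (cases "\<exists>z\<in>Z. l w < T z \<and> T z < r w")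
      case True
      then obtain z where z: "z \<in> Z" "l w < T z" "T z < r w" by blast
      have "C \<le> ?s" using member_le_sum[OF z(1), of "\<lambda>z. if l w < T z \<and> T z < r w then C else 0"] z C fin by simp
      then show ?thesis using v[OF w] d0 by linarith
    next
      case False
      then have "v w \<le> (\<Sum>y | y \<in> Y \<and> l w < p y \<and> p y < r w. g y)" using cov[OF w] by force
      also have "\<dots> = ?d" using fin by (simp add: sum.inter_filter)
      finally show ?thesis using s0 by linarith
    qed
  qed
  also have "\<dots> = (\<Sum>z\<in>Z. \<Sum>w\<in>W. if l w < T z \<and> T z < r w then C else 0)
      + (\<Sum>y\<in>Y. \<Sum>w\<in>W. if l w < p y \<and> p y < r w then g y else 0)"
    unfolding sum.distrib by (intro arg_cong2[where f = plus] sum.swap)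
  also have "\<dots> \<le> (\<Sum>z\<in>Z. m * C) + (\<Sum>y\<in>Y. m * g y)"
    by (intro add_mono sum_mono count C g)
  also have "\<dots> = m * (C * card Z + (\<Sum>y\<in>Y. g y))" by (simp add: sum_distrib_left algebra_simps)
  finally show ?thesis .
qed

section \<open>Competitiveness of a run\<close>

text \<open>What the cost analysis needs to know of a run: \<open>K\<close> services at times
  \<open>t k\<close>, where \<open>G k\<close> is the set of requests pending immediately before
  service \<open>k\<close>.\<close>

locale jrp_run = jrp_costs +
  fixes X :: "entry set" and K :: nat and t :: "nat \<Rightarrow> real" and G :: "nat \<Rightarrow> entry set"
  assumes finite_X: "finite X"
    and arr_le_ddl: "\<And>x. x \<in> X \<Longrightarrow> arr x \<le> ddl x"
    and t_mono: "\<And>j k. j \<le> k \<Longrightarrow> k < K \<Longrightarrow> t j \<le> t k"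
    and pending: "\<And>k. k < K \<Longrightarrow> G k = {x \<in> X. arr x \<le> t k \<and> (\<forall>j<k. x \<notin> pick (G j) (t j))}"
    and nonempty: "\<And>k. k < K \<Longrightarrow> G k \<noteq> {}"
    and t_trig: "\<And>k. k < K \<Longrightarrow> t k = trig (G k)"
begin

text \<open>A time before every arrival. It replaces the time of the preceding service or visit
  where there is none.\<close>

definition low :: real where
  "low = Min (insert 0 (arr ` X)) - 1"

lemma low_less: "x \<in> X \<Longrightarrow> low < arr x"
proof -
  assume "x \<in> X"
  then have "Min (insert 0 (arr ` X)) \<le> arr x" using finite_X by (intro Min_le) auto
  then show ?thesis by (simp add: low_def)
qed

lemma G_subset: "k < K \<Longrightarrow> G k \<subseteq> X"
  using pending by auto

lemma finite_G: "k < K \<Longrightarrow> finite (G k)"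
  using G_subset finite_X finite_subset by metis

lemma overflow_t: "k < K \<Longrightarrow> overflow (G k) (t k) = c0"
  using overflow_trig[OF finite_G nonempty] t_trig by simp

lemma unpicked:
  assumes "x \<in> G k" "j < k" "k < K" "arr x \<le> t j"
  shows "x \<in> G j" "x \<notin> pick (G j) (t j)"
  using assms pending[of k] pending[of j] by auto

abbreviation S :: "nat \<Rightarrow> nat set" where "S k \<equiv> saturated (G k) (t k)"
abbreviation P :: "nat \<Rightarrow> nat set" where "P k \<equiv> premature (G k) (t k)"

section \<open>Root cost accrued between consecutive services\<close>

definition start :: "nat \<Rightarrow> real" where
  "start k = (case k of 0 \<Rightarrow> low | Suc j \<Rightarrow> t j)"

text \<open>The sum includes requests served by the previous service of the algorithm: a solution
  that is idle in between pays \<open>squeeze\<close> for them as well.\<close>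

definition due_old :: "nat \<Rightarrow> real" where
  "due_old k = (case k of 0 \<Rightarrow> 0 | Suc j \<Rightarrow> \<Sum>x\<in>G j. squeeze (t j) (t k) x)"

text \<open>These requests cannot be served before the window, so an idle solution incurs their
  whole backlog; the holding side of \<open>squeeze\<close> does not arise.\<close>

definition due_new :: "nat \<Rightarrow> real" where
  "due_new k = (\<Sum>x | x \<in> G k \<and> start k < arr x. b * max 0 (t k - ddl x))"

definition ripening :: "nat \<Rightarrow> nat set" where
  "ripening k = (case k of 0 \<Rightarrow> {} | Suc j \<Rightarrow> {i \<in> itm ` G j. t j < sat (G j) i \<and> sat (G j) i \<le> t k})"

text \<open>The overflow at the next trigger is \<open>c0\<close>. If the look-ahead total up to
  then is within \<open>c0 / 2\<close>, the older requests contribute at most that total, and the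
  remaining \<open>c0 / 2\<close> must come from new ones.\<close>

lemma due_new_large:
  assumes k: "Suc k < K" and look: "look (G k) (t k) (t (Suc k)) \<le> c0 / 2"
  shows "c0 / 2 \<le> due_new (Suc k)"
proof -
  let ?H = "G (Suc k)" and ?e = "t (Suc k)"
  let ?new = "{x \<in> ?H. t k < arr x}" and ?old = "{x \<in> ?H. \<not> t k < arr x}"
  let ?Q = "S k \<union> P k"
  have k': "k < K" using k by simp
  note fin = finite_G[OF k'] finite_G[OF k]
  have old: "x \<in> G k" "x \<notin> pick (G k) (t k)" if "x \<in> ?old" for x
    using unpicked[of x "Suc k" k] that k by auto
  have Q: "?Q = {i \<in> itm ` G k. ripe (G k) (t k) i}" using ripe_items[OF fin(1)] by simp
  \<comment> \<open>If such an item saturated by \<open>?e\<close>, monotonicity of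
    \<open>look\<close> would make it ripe.\<close>
  have notQ: "?e < sat (G k) i" if "i \<in> itm ` G k" "i \<notin> ?Q" for i
  proof (rule ccontr)
    assume "\<not> ?thesis"
    then have "look (G k) (t k) (sat (G k) i) \<le> c0 / 2"
      using look_mono[OF fin(1), of "sat (G k) i" ?e "t k"] look by linarith
    then show False using that Q by (simp add: ripe_def)
  qed
  \<comment> \<open>A request left behind by a ripe item failed the second test of
    \<open>sel\<close>, so its \<open>reach\<close> lies beyond \<open>?e\<close>, and until then
    its backlog is the smaller side of \<open>squeeze\<close>.\<close>
  have inQ: "b * max 0 (?e - ddl x) \<le> squeeze (t k) ?e x" if x: "x \<in> ?old" "itm x \<in> ?Q" for x
  proof -
    have "ripe (G k) (t k) (itm x)" using x(2) Q by auto
    then have ns: "\<not> look (G k) (t k) (reach (t k) x) \<le> c0 / 2" "t k < ddl x"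
      using old[OF x(1)] sel_if_overdue[of "G k" "t k" x] by (auto simp: pick_def sel_def not_le[symmetric])
    then have "?e < reach (t k) x"
      using look_mono[OF fin(1), of "reach (t k) x" ?e "t k"] look by linarith
    then have "b * (?e - ddl x) \<le> b * (reach (t k) x - ddl x)" using b by (intro mult_left_mono) auto
    also have "\<dots> = h * (ddl x - t k)" using b by (simp add: reach_def)
    finally have "b * max 0 (?e - ddl x) \<le> h * max 0 (ddl x - t k)" using ns(2) h by (simp add: max_def)
    then show ?thesis by (simp add: squeeze_def)
  qed
  have "overflow ?H ?e \<le> (\<Sum>i\<in>itm ` ?H. (\<Sum>x | x \<in> fam ?H i \<and> x \<in> ?new. b * max 0 (?e - ddl x))
      + (\<Sum>x | x \<in> fam ?H i \<and> x \<in> ?old. squeeze (t k) ?e x))"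
    unfolding overflow_def
  proof (intro sum_mono)
    fix i
    let ?n = "\<Sum>x | x \<in> fam ?H i \<and> x \<in> ?new. b * max 0 (?e - ddl x)"
    let ?o = "\<Sum>x | x \<in> fam ?H i \<and> x \<in> ?old. b * max 0 (?e - ddl x)"
    let ?s = "\<Sum>x | x \<in> fam ?H i \<and> x \<in> ?old. squeeze (t k) ?e x"
    have split: "backlog ?H i ?e = ?n + ?o"
      unfolding backlog_def using fin by (subst sum.union_disjoint[symmetric]) (auto simp: fam_def intro!: sum.cong)
    have n0: "0 \<le> ?n" using b by (intro sum_nonneg) auto
    have s0: "0 \<le> ?s" by (intro sum_nonneg squeeze_nonneg)
    \<comment> \<open>The old requests are either dominated by \<open>squeeze\<close> or fit into
      the leaf cost, which the overflow deducts anyway.\<close>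
    have "?o \<le> ?s \<or> ?o \<le> c i"
    proof (cases "i \<in> ?Q \<or> i \<notin> itm ` G k")
      case True
      have "?o \<le> ?s"
      proof (intro sum_mono)
        fix x assume "x \<in> {x. x \<in> fam ?H i \<and> x \<in> ?old}"
        then have x: "x \<in> ?old" "itm x = i" by (auto simp: fam_def)
        then have "i \<in> ?Q" using True old[OF x(1)] by blast
        then show "b * max 0 (?e - ddl x) \<le> squeeze (t k) ?e x" using inQ x by blast
      qed
      then show ?thesis ..
    next
      case False
      have "?o \<le> backlog (G k) i ?e"
        unfolding backlog_def using fin b old by (intro sum_mono2) (auto simp: fam_def)
      also have "\<dots> \<le> c i" using False notQ[of i] by (intro backlog_le fin) auto
      finally show ?thesis ..
    qed
    then show "max 0 (backlog ?H i ?e - c i) \<le> ?n + ?s"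
      unfolding split using n0 s0 c[of i] by auto
  qed
  also have "\<dots> = (\<Sum>i\<in>itm ` ?H. \<Sum>x\<in>fam ?H i. (if x \<in> ?new then b * max 0 (?e - ddl x) else 0)
      + (if x \<in> ?old then squeeze (t k) ?e x else 0))"
    using fin by (simp add: sum.distrib sum.inter_filter)
  also have "\<dots> = (\<Sum>x\<in>?H. (if x \<in> ?new then b * max 0 (?e - ddl x) else 0)
      + (if x \<in> ?old then squeeze (t k) ?e x else 0))"
    by (rule sum_fam[OF fin(2)])
  also have "\<dots> = due_new (Suc k) + (\<Sum>x\<in>?old. squeeze (t k) ?e x)"
    unfolding sum.distrib due_new_def start_def using fin by (simp add: sum.inter_filter)
  also have "(\<Sum>x\<in>?old. squeeze (t k) ?e x) \<le> (\<Sum>x\<in>G k. squeeze (t k) ?e x)"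
    using fin old squeeze_nonneg by (intro sum_mono2) auto
  also have "\<dots> \<le> look (G k) (t k) ?e" unfolding look_alt[OF fin(1)] using c by (simp add: sum_nonneg)
  finally show ?thesis using look overflow_t[OF k] by linarith
qed

text \<open>At the first service every request counts as new, because \<open>low\<close> precedes
  all arrivals.\<close>

lemma due_new_0:
  assumes "0 < K" shows "c0 \<le> due_new 0"
proof -
  have "c0 = overflow (G 0) (t 0)" using overflow_t assms by simp
  also have "\<dots> \<le> (\<Sum>i\<in>itm ` G 0. \<Sum>x\<in>fam (G 0) i. b * max 0 (t 0 - ddl x))"
    unfolding overflow_def backlog_def[symmetric] using c backlog_nonneg by (intro sum_mono) auto
  also have "\<dots> = (\<Sum>x\<in>G 0. b * max 0 (t 0 - ddl x))" using assms by (intro sum_fam finite_G)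
  also have "\<dots> = due_new 0" unfolding due_new_def start_def
    using G_subset[OF assms] low_less by (intro sum.cong) auto
  finally show ?thesis .
qed

text \<open>An item that is not ripe at service \<open>k\<close> keeps all its requests. Its pending
  requests can then only increase in number, and saturation can only move earlier.\<close>

lemma ripening_subset:
  assumes "Suc k < K" shows "ripening (Suc k) \<subseteq> P k \<union> S (Suc k)"
proof
  fix i assume i: "i \<in> ripening (Suc k)"
  let ?H = "G (Suc k)"
  have k': "k < K" using assms by simp
  note fin = finite_G[OF k'] finite_G[OF assms]
  have i': "i \<in> itm ` G k" "t k < sat (G k) i" "sat (G k) i \<le> t (Suc k)"
    using i by (auto simp: ripening_def)
  show "i \<in> P k \<union> S (Suc k)"
  proof (cases "i \<in> P k")
    case False
    then have "\<not> ripe (G k) (t k) i" using i' by (auto simp: premature_def)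
    then have sub: "fam (G k) i \<subseteq> fam ?H i"
      using pending[OF k'] pending[OF assms] t_mono[of k "Suc k"] assms
      by (auto simp: fam_def less_Suc_eq pick_def sel_def)
    then have iH: "i \<in> itm ` ?H" using i'(1) fam_empty_iff[of "G k" i] fam_empty_iff[of ?H i] by auto
    have "sat ?H i \<le> sat (G k) i"
    proof (rule ccontr)
      assume "\<not> ?thesis"
      then have lt: "sat (G k) i < sat ?H i" by simp
      have "c i < backlog (G k) i (sat ?H i)" by (rule backlog_gt[OF fin(1) i'(1) lt])
      also have "\<dots> \<le> backlog ?H i (sat ?H i)" by (rule backlog_subset[OF fin(2) sub])
      also have "\<dots> \<le> c i" by (rule backlog_le[OF fin(2) iH order.refl])
      finally show False by simp
    qed
    then show ?thesis using iH i' by (simp add: saturated_def)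
  qed simp
qed

text \<open>The two amounts are each bounded by the same delays, so the definition chooses one of
  them instead of adding.\<close>

definition due :: "nat \<Rightarrow> real" where
  "due k = (if c0 / 2 \<le> due_new k then due_new k else due_old k)"

text \<open>If the new requests fall short of \<open>c0 / 2\<close>, the look-ahead total exceeds
  it, and that total consists of \<open>due_old\<close> and the ripening leaf costs. The cap at
  \<open>c0\<close> lets a single service of the compared solution pay for a window.\<close>

lemma root_cost_le_due:
  assumes k: "k < K"
  shows "c0 / 2 \<le> min c0 (due k) + (\<Sum>i\<in>ripening k. c i)"
proof -
  have r0: "0 \<le> (\<Sum>i\<in>ripening k. c i)" using c by (simp add: sum_nonneg)
  show ?thesis
  proof (cases "c0 / 2 \<le> due_new k")
    case True
    then show ?thesis using r0 c0 by (simp add: due_def)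
  next
    case False
    then obtain j where j: "k = Suc j" using due_new_0 k c0 by (cases k) auto
    then have "\<not> look (G j) (t j) (t k) \<le> c0 / 2" using due_new_large[of j] False k by auto
    then have "c0 / 2 < due k + (\<Sum>i\<in>ripening k. c i)"
      using False look_alt[OF finite_G, of j] k j by (simp add: due_def due_old_def ripening_def)
    then show ?thesis using r0 c0 by (simp add: min_def)
  qed
qed

end

text \<open>The compared solution: services \<open>Z\<close> at times \<open>T z\<close> with leaves
  \<open>M z\<close>, where \<open>f x\<close> is the service satisfying \<open>x\<close>.\<close>

locale jrp_run_vs = jrp_run +
  fixes Z :: "'z set" and T :: "'z \<Rightarrow> real" and M :: "'z \<Rightarrow> nat set" and f :: "entry \<Rightarrow> 'z"
  assumes finite_Z: "finite Z" and finite_M: "\<And>z. z \<in> Z \<Longrightarrow> finite (M z)"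
    and f: "\<And>x. x \<in> X \<Longrightarrow> f x \<in> Z" "\<And>x. x \<in> X \<Longrightarrow> itm x \<in> M (f x)" "\<And>x. x \<in> X \<Longrightarrow> arr x \<le> T (f x)"
begin

abbreviation g :: "entry \<Rightarrow> real" where "g x \<equiv> delay x (T (f x))"

lemma overdue_le_delay: "r \<le> s \<Longrightarrow> b * max 0 (r - ddl x) \<le> delay x s"
proof -
  assume "r \<le> s"
  then have "b * max 0 (r - ddl x) \<le> b * max 0 (s - ddl x)" using b by (intro mult_left_mono) auto
  then show ?thesis unfolding delay_alt using h by (simp add: add_increasing2)
qed

text \<open>A request that arrives inside the window is served at its end or later; for an older one
  \<open>squeeze_le_delay\<close> applies. All terms with deadline outside the open window vanish,
  which is what makes the charges disjoint.\<close>

lemma due_le_delay: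
  assumes k: "k < K" and out: "\<And>z. z \<in> Z \<Longrightarrow> T z \<le> start k \<or> t k \<le> T z"
  shows "due k \<le> (\<Sum>x | x \<in> X \<and> start k < ddl x \<and> ddl x < t k. g x)"
proof -
  let ?D = "\<Sum>x | x \<in> X \<and> start k < ddl x \<and> ddl x < t k. g x"
  have 0: "0 \<le> ?D" by (intro sum_nonneg delay_nonneg)
  have "due_new k = (\<Sum>x | x \<in> G k \<and> start k < arr x \<and> ddl x < t k. b * max 0 (t k - ddl x))"
    unfolding due_new_def using finite_G[OF k] by (intro sum.mono_neutral_right) auto
  also have "\<dots> \<le> (\<Sum>x | x \<in> G k \<and> start k < arr x \<and> ddl x < t k. g x)"
  proof (intro sum_mono overdue_le_delay)
    fix x assume "x \<in> {x \<in> G k. start k < arr x \<and> ddl x < t k}"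
    then have "x \<in> X" "start k < arr x" using G_subset[OF k] by auto
    then show "t k \<le> T (f x)" using out[OF f(1)] f(3) by fastforce
  qed
  also have "\<dots> \<le> ?D"
    using finite_X G_subset[OF k] arr_le_ddl by (intro sum_mono2 delay_nonneg) fastforce+
  finally have new: "due_new k \<le> ?D" .
  have "due_old k \<le> ?D"
  proof (cases k)
    case 0
    then show ?thesis using \<open>0 \<le> ?D\<close> by (simp add: due_old_def)
  next
    case (Suc j)
    have sj: "start k = t j" by (simp add: start_def Suc)
    have j: "j < K" using k Suc by simp
    have "due_old k = (\<Sum>x | x \<in> G j \<and> start k < ddl x \<and> ddl x < t k. squeeze (t j) (t k) x)"
      unfolding due_old_def Suc using finite_G[OF j] sj Suc
      by (auto intro!: sum.mono_neutral_right squeeze_outside)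
    also have "\<dots> \<le> (\<Sum>x | x \<in> G j \<and> start k < ddl x \<and> ddl x < t k. g x)"
      using out f(1) G_subset[OF j] by (intro sum_mono squeeze_le_delay) (auto simp: sj)
    also have "\<dots> \<le> ?D"
      using finite_X G_subset[OF j] by (intro sum_mono2 delay_nonneg) auto
    finally show ?thesis .
  qed
  then show ?thesis using new by (simp add: due_def)
qed

lemma card_le_1: "(\<And>a b. a \<in> A \<Longrightarrow> b \<in> A \<Longrightarrow> a = b) \<Longrightarrow> card A \<le> Suc 0"
  by (cases "finite A") (auto simp: card_le_Suc0_iff_eq)

lemma t_le_start: "j < k \<Longrightarrow> k < K \<Longrightarrow> t j \<le> start k"
  by (cases k) (auto simp: start_def intro: t_mono)

text \<open>Windows between consecutive services are disjoint, so \<open>window_cover\<close>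
  applies with multiplicity 1.\<close>

lemma sum_due_le: "(\<Sum>k<K. min c0 (due k)) \<le> c0 * card Z + (\<Sum>x\<in>X. g x)"
proof -
  have "(\<Sum>k<K. min c0 (due k)) \<le> (1::nat) * (c0 * card Z + (\<Sum>x\<in>X. g x))"
  proof (rule window_cover[where l = start and r = t and T = T and p = ddl])
    fix x show "card {k \<in> {..<K}. start k < x \<and> x < t k} \<le> 1"
    proof (simp, intro card_le_1)
      fix j k assume *: "j \<in> {k. k < K \<and> start k < x \<and> x < t k}" "k \<in> {k. k < K \<and> start k < x \<and> x < t k}"
      show "j = k" using * t_le_start[of j k] t_le_start[of k j] by (cases j k rule: linorder_cases) auto
    qed
  next
    fix k assume k: "k \<in> {..<K}" and out: "\<And>z. z \<in> Z \<Longrightarrow> T z \<le> start k \<or> t k \<le> T z"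
    then show "min c0 (due k) \<le> (\<Sum>x | x \<in> X \<and> start k < ddl x \<and> ddl x < t k. g x)"
      using due_le_delay[of k] by (intro min.coboundedI2) auto
  qed (use finite_X finite_Z c0 delay_nonneg in auto)
  then show ?thesis by simp
qed

section \<open>Leaf cost accrued between visits of an item\<close>

definition charged :: "nat \<Rightarrow> nat set" where
  "charged i = {k. k < K \<and> (i \<in> S k \<or> i \<in> P k \<and> Suc k < K \<and> i \<in> ripening (Suc k))}"

text \<open>A visit means that the item was ripe, whether or not one of its requests was selected. A
  request left behind at a visit has therefore failed both tests of \<open>sel\<close>.\<close>

definition visits :: "nat \<Rightarrow> nat \<Rightarrow> nat set" where
  "visits i k = {j. j < k \<and> i \<in> S j \<union> P j}"

definition last_visit :: "nat \<Rightarrow> nat \<Rightarrow> real" where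
  "last_visit i k = (if visits i k = {} then low else t (Max (visits i k)))"

text \<open>A prematurely visited item saturates only later, so its window runs on to the following
  service. Premature visits that do not ripen by then are not charged; their leaf costs are covered
  by \<open>sum_premature_le\<close>.\<close>

definition until :: "nat \<Rightarrow> nat \<Rightarrow> real" where
  "until i k = (if i \<in> S k then t k else t (Suc k))"

lemma finite_visits: "finite (visits i k)"
  by (simp add: visits_def)

lemma charged_props:
  assumes "k \<in> charged i"
  shows "k < K" "i \<in> itm ` G k" "i \<in> S k \<union> P k" "c i \<le> backlog (G k) i (until i k)" "t k \<le> until i k"
    and "until i k \<noteq> t k \<Longrightarrow> Suc k < K \<and> until i k = t (Suc k)"
proof -
  show k: "k < K" and i: "i \<in> itm ` G k" and "i \<in> S k \<union> P k"
    using assms by (auto simp: charged_def saturated_def premature_def)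
  show "c i \<le> backlog (G k) i (until i k)"
    using assms by (intro backlog_ge finite_G k i) (auto simp: charged_def until_def ripening_def saturated_def)
  show "t k \<le> until i k" using assms t_mono[of k "Suc k"] by (auto simp: charged_def until_def)
  show "until i k \<noteq> t k \<Longrightarrow> Suc k < K \<and> until i k = t (Suc k)"
    using assms by (auto simp: charged_def until_def)
qed

lemma t_le_last_visit:
  assumes "j \<in> visits i k" "k < K" shows "t j \<le> last_visit i k"
proof -
  have "Max (visits i k) \<in> visits i k" using assms finite_visits by (intro Max_in) auto
  then have "Max (visits i k) < K" using assms by (auto simp: visits_def)
  moreover have "j \<le> Max (visits i k)" using assms finite_visits by (intro Max_ge) auto
  ultimately have "t j \<le> t (Max (visits i k))" by (intro t_mono)
  then show ?thesis using assms by (auto simp: last_visit_def)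
qed

lemma new_or_held:
  assumes k: "k < K" and x: "x \<in> G k" "itm x = i"
  shows "last_visit i k < arr x \<or> (\<exists>j<k. last_visit i k = t j \<and> i \<in> S j \<union> P j \<and> x \<in> G j \<and> x \<notin> pick (G j) (t j))"
proof (cases "visits i k = {}")
  case True
  then show ?thesis using low_less G_subset[OF k] x by (auto simp: last_visit_def)
next
  case False
  let ?j = "Max (visits i k)"
  have "?j \<in> visits i k" using False finite_visits by (intro Max_in) auto
  then have "?j < k" "i \<in> S ?j \<union> P ?j" by (auto simp: visits_def)
  moreover have "last_visit i k = t ?j" using False by (simp add: last_visit_def)
  ultimately show ?thesis using unpicked[OF x(1), of ?j] k by (metis not_le)
qed

text \<open>Requests that arrived since the last visit incur their whole backlog, older ones at
  least \<open>squeeze\<close>. Let \<open>y\<close> be the older pending request due first. If its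
  backlog is at most its holding cost, so it is for all later deadlines, and the pending backlog, at
  least \<open>c i\<close>, is paid in full. Otherwise every request up to \<open>y\<close> pending
  at the last visit pays its holding cost, and these exceed \<open>c i\<close> because
  \<open>y\<close> was left behind.\<close>

lemma item_cost_le_delay:
  assumes k: "k \<in> charged i"
    and out: "\<And>z. z \<in> Z \<Longrightarrow> i \<in> M z \<Longrightarrow> T z \<le> last_visit i k \<or> until i k \<le> T z"
  shows "c i \<le> (\<Sum>x | x \<in> fam X i \<and> last_visit i k < ddl x \<and> ddl x < until i k. g x)"
proof -
  let ?l = "last_visit i k" and ?e = "until i k"
  let ?D = "\<Sum>x | x \<in> fam X i \<and> ?l < ddl x \<and> ddl x < ?e. g x"
  note k' = charged_props[OF k]
  note fin = finite_G[OF k'(1)]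
  have out': "T (f x) \<le> ?l \<or> ?e \<le> T (f x)" if "x \<in> X" "itm x = i" for x
    using out[OF f(1), of x] f(2)[of x] that by auto
  have bound: "(\<Sum>x\<in>A. w x) \<le> ?D"
    if A: "A \<subseteq> fam X i" and w: "\<And>x. x \<in> A \<Longrightarrow> w x \<le> g x"
      "\<And>x. x \<in> A \<Longrightarrow> \<not> (?l < ddl x \<and> ddl x < ?e) \<Longrightarrow> w x = 0" for A w
  proof -
    have finA: "finite A" using A finite_X finite_subset finite_fam by metis
    have "(\<Sum>x\<in>A. w x) = (\<Sum>x | x \<in> A \<and> ?l < ddl x \<and> ddl x < ?e. w x)"
      using finA w(2) by (intro sum.mono_neutral_right) auto
    also have "\<dots> \<le> (\<Sum>x | x \<in> A \<and> ?l < ddl x \<and> ddl x < ?e. g x)" using w(1) by (intro sum_mono) auto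
    also have "\<dots> \<le> ?D" using A finite_X by (intro sum_mono2 delay_nonneg) auto
    finally show ?thesis .
  qed
  have new: "b * max 0 (?e - ddl x) \<le> g x \<and> (\<not> (?l < ddl x \<and> ddl x < ?e) \<longrightarrow> b * max 0 (?e - ddl x) = 0)"
    if x: "x \<in> X" "itm x = i" "?l < arr x" for x
  proof
    have "?e \<le> T (f x)" using out'[OF x(1,2)] f(3)[OF x(1)] x(3) by auto
    then show "b * max 0 (?e - ddl x) \<le> g x" by (rule overdue_le_delay)
    show "\<not> (?l < ddl x \<and> ddl x < ?e) \<longrightarrow> b * max 0 (?e - ddl x) = 0"
      using arr_le_ddl[OF x(1)] x(3) by auto
  qed
  have sq: "squeeze ?l ?e x \<le> g x \<and> (\<not> (?l < ddl x \<and> ddl x < ?e) \<longrightarrow> squeeze ?l ?e x = 0)"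
    if "x \<in> X" "itm x = i" for x
    using squeeze_le_delay[OF out'[OF that], of x] squeeze_outside[of ?l x ?e] by blast
  let ?old = "{x \<in> fam (G k) i. \<not> ?l < arr x}"
  have late: "c i \<le> ?D"
    if eq: "\<And>x. x \<in> ?old \<Longrightarrow> squeeze ?l ?e x = b * max 0 (?e - ddl x)"
  proof -
    have "backlog (G k) i ?e \<le> ?D" unfolding backlog_def
    proof (rule bound)
      show "fam (G k) i \<subseteq> fam X i" using G_subset[OF k'(1)] by (auto simp: fam_def)
      fix x assume x: "x \<in> fam (G k) i"
      then have "x \<in> X" "itm x = i" using G_subset[OF k'(1)] by (auto simp: fam_def)
      then show "b * max 0 (?e - ddl x) \<le> g x"
        "\<not> (?l < ddl x \<and> ddl x < ?e) \<Longrightarrow> b * max 0 (?e - ddl x) = 0"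
        using new[of x] sq[of x] eq[of x] x by (cases "?l < arr x"; auto)+
    qed
    then show ?thesis using k'(4) by simp
  qed
  show ?thesis
  proof (cases "?old = {}")
    case True
    then show ?thesis by (intro late) (metis empty_iff)
  next
    case False
    have "finite ?old" using fin by simp
    from finite_obtain_max[OF this False, of "\<lambda>x. - ddl x"]
    obtain y where y: "y \<in> ?old" and mn: "\<And>x. x \<in> ?old \<Longrightarrow> ddl y \<le> ddl x" by auto
    obtain j where j: "j < k" "?l = t j" "i \<in> S j \<union> P j" "y \<in> G j" "y \<notin> pick (G j) (t j)"
      using new_or_held[OF k'(1), of y i] y by (auto simp: fam_def)
    have jK: "j < K" using j(1) k'(1) by simp
    note finj = finite_G[OF jK]
    have yi: "itm y = i" using y by (simp add: fam_def)
    have "ripe (G j) (t j) i" using j(3) ripe_items[OF finj, of "t j"] by blast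
    \<comment> \<open>The item was ripe at the visit, so leaving \<open>y\<close> behind means in
      particular that its prefix did not fit into the leaf cost.\<close>
    then have hold: "c i < hold (G j) ?l y" using j yi by (auto simp: pick_def sel_def)
    then have ly: "?l < ddl y" using hold_eq_0[of y ?l "G j"] c[of i] by (cases "ddl y \<le> ?l") auto
    show ?thesis
    proof (cases "b * max 0 (?e - ddl y) \<le> h * (ddl y - ?l)")
      case True
      show ?thesis
      proof (rule late)
        fix x assume x: "x \<in> ?old"
        have "b * max 0 (?e - ddl x) \<le> b * max 0 (?e - ddl y)"
          using b mn[OF x] by (intro mult_left_mono) auto
        also have "\<dots> \<le> h * (ddl y - ?l)" by fact
        also have "\<dots> \<le> h * max 0 (ddl x - ?l)" using h mn[OF x] by (intro mult_left_mono) auto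
        finally show "squeeze ?l ?e x = b * max 0 (?e - ddl x)" by (simp add: squeeze_def)
      qed
    next
      case False
      \<comment> \<open>Some of these requests may have been served at the last visit; the compared
        solution pays for them nevertheless.\<close>
      let ?A = "{x \<in> fam (G j) i. ddl x \<le> ddl y}"
      have eq: "squeeze ?l ?e x = h * max 0 (ddl x - ?l)" if x: "x \<in> ?A" for x
      proof -
        have "h * max 0 (ddl x - ?l) \<le> h * (ddl y - ?l)" using h x ly by (intro mult_left_mono) auto
        also have "\<dots> \<le> b * max 0 (?e - ddl y)" using False by simp
        also have "\<dots> \<le> b * max 0 (?e - ddl x)" using b x by (intro mult_left_mono) auto
        finally show ?thesis by (simp add: squeeze_def)
      qed
      have "hold (G j) ?l y = (\<Sum>x\<in>?A. squeeze ?l ?e x)"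
        unfolding hold_def yi using eq by (intro sum.cong) auto
      also have "\<dots> \<le> ?D"
      proof (rule bound)
        show "?A \<subseteq> fam X i" using G_subset[OF jK] by (auto simp: fam_def)
        fix x assume "x \<in> ?A"
        then have "x \<in> X" "itm x = i" using G_subset[OF jK] by (auto simp: fam_def)
        then show "squeeze ?l ?e x \<le> g x"
          "\<not> (?l < ddl x \<and> ddl x < ?e) \<Longrightarrow> squeeze ?l ?e x = 0" using sq by auto
      qed
      finally show ?thesis using hold by simp
    qed
  qed
qed

text \<open>Split each window at \<open>t k\<close>. The parts up to \<open>t k\<close> are
  disjoint, as a later window begins no earlier than the previous visit; the parts after
  \<open>t k\<close> lie between consecutive services.\<close>

lemma charged_multiplicity:
  "card {k \<in> charged i. last_visit i k < x \<and> x < until i k} \<le> 2"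
proof -
  let ?W = "{k \<in> charged i. last_visit i k < x \<and> x < until i k}"
  let ?A = "{k \<in> ?W. x \<le> t k}" and ?B = "{k \<in> ?W. t k < x}"
  have sep: "t j \<le> last_visit i k" if "j < k" "j \<in> charged i" "k \<in> charged i" for j k
    using that charged_props(1,3) by (intro t_le_last_visit) (auto simp: visits_def)
  have "card ?A \<le> Suc 0"
  proof (rule card_le_1)
    fix j k assume *: "j \<in> ?A" "k \<in> ?A"
    have "False" if "j < k" "j \<in> ?A" "k \<in> ?A" for j k
      using sep[of j k] that by auto
    then show "j = k" using * by (meson linorder_less_linear)
  qed
  moreover have "card ?B \<le> Suc 0"
  proof (rule card_le_1)
    fix j k assume *: "j \<in> ?B" "k \<in> ?B"
    have "False" if jk: "j < k" "j \<in> ?B" "k \<in> ?B" for j k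
    proof -
      have "until i j = t (Suc j)" "k < K" using jk charged_props(6)[of j i] charged_props(1)[of k i] by auto
      then show False using t_mono[of "Suc j" k] jk by auto
    qed
    then show "j = k" using * by (meson linorder_less_linear)
  qed
  moreover have "card ?W \<le> card ?A + card ?B"
  proof -
    have "card ?W = card (?A \<union> ?B)" by (rule arg_cong[of _ _ card]) auto
    also have "\<dots> \<le> card ?A + card ?B" by (rule card_Un_le)
    finally show ?thesis .
  qed
  ultimately show ?thesis by simp
qed

lemma item_charge_le:
  "c i * card (charged i) \<le> 2 * (c i * card {z \<in> Z. i \<in> M z} + (\<Sum>x\<in>fam X i. g x))"
proof -
  have "(\<Sum>k\<in>charged i. c i) \<le> (2::nat) * (c i * card {z \<in> Z. i \<in> M z} + (\<Sum>x\<in>fam X i. g x))"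
    using item_cost_le_delay charged_multiplicity finite_X finite_Z c delay_nonneg
    by (intro window_cover[where l = "last_visit i" and r = "until i" and T = T and p = ddl])
      (auto simp: charged_def)
  then show ?thesis by (simp add: mult.commute)
qed

definition item_charge :: real where
  "item_charge = (\<Sum>i\<in>itm ` X. c i * card (charged i))"

lemma item_charge_upper:
  "item_charge \<le> 2 * ((\<Sum>z\<in>Z. \<Sum>i\<in>M z. c i) + (\<Sum>x\<in>X. g x))"
proof -
  have "item_charge \<le> (\<Sum>i\<in>itm ` X. 2 * (c i * card {z \<in> Z. i \<in> M z} + (\<Sum>x\<in>fam X i. g x)))"
    unfolding item_charge_def by (intro sum_mono item_charge_le)
  also have "\<dots> = 2 * ((\<Sum>i\<in>itm ` X. \<Sum>z | z \<in> Z \<and> i \<in> M z. c i) + (\<Sum>x\<in>X. g x))"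
    by (simp add: sum_distrib_left[symmetric] sum.distrib sum_fam[OF finite_X] mult.commute)
  also have "(\<Sum>i\<in>itm ` X. \<Sum>z | z \<in> Z \<and> i \<in> M z. c i) = (\<Sum>z\<in>Z. \<Sum>i | i \<in> itm ` X \<and> i \<in> M z. c i)"
    using finite_X finite_Z by (intro sum.swap_restrict) auto
  also have "\<dots> \<le> (\<Sum>z\<in>Z. \<Sum>i\<in>M z. c i)"
    using finite_M c by (intro sum_mono sum_mono2) auto
  finally show ?thesis by simp
qed

text \<open>Saturated and premature items of a service are disjoint, so after exchanging the sums
  each charged pair of service and item is counted once.\<close>

lemma item_charge_lower:
  "(\<Sum>k<K. \<Sum>i\<in>S k. c i) + (\<Sum>k | Suc k < K. \<Sum>i\<in>P k \<inter> ripening (Suc k). c i) \<le> item_charge"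
proof -
  let ?R = "\<lambda>k. if Suc k < K then P k \<inter> ripening (Suc k) else {}"
  have fin: "finite (S k)" "finite (?R k)" if "k < K" for k using finite_G[OF that] by auto
  have sub: "S k \<union> ?R k \<subseteq> itm ` X" if "k < K" for k
    using G_subset[OF that] by (auto simp: saturated_def premature_def)
  have "(\<Sum>k | Suc k < K. \<Sum>i\<in>P k \<inter> ripening (Suc k). c i) = (\<Sum>k<K. \<Sum>i\<in>?R k. c i)"
    by (rule sum.mono_neutral_cong_left) auto
  then have "(\<Sum>k<K. \<Sum>i\<in>S k. c i) + (\<Sum>k | Suc k < K. \<Sum>i\<in>P k \<inter> ripening (Suc k). c i)
      = (\<Sum>k<K. (\<Sum>i\<in>S k. c i) + (\<Sum>i\<in>?R k. c i))" by (simp add: sum.distrib)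
  also have "\<dots> = (\<Sum>k<K. \<Sum>i\<in>S k \<union> ?R k. c i)"
  proof (intro sum.cong refl)
    fix k assume "k \<in> {..<K}"
    then have k: "k < K" by simp
    have "S k \<inter> ?R k = {}" using saturated_premature_disjoint[of "G k" "t k"] by auto
    then show "(\<Sum>i\<in>S k. c i) + (\<Sum>i\<in>?R k. c i) = (\<Sum>i\<in>S k \<union> ?R k. c i)"
      using fin[OF k] by (intro sum.union_disjoint[symmetric])
  qed
  also have "\<dots> = (\<Sum>k<K. \<Sum>i | i \<in> itm ` X \<and> i \<in> S k \<union> ?R k. c i)"
  proof (intro sum.cong refl)
    fix k assume "k \<in> {..<K}"
    then show "S k \<union> ?R k = {i. i \<in> itm ` X \<and> i \<in> S k \<union> ?R k}" using sub[of k] by blast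
  qed
  also have "\<dots> = (\<Sum>i\<in>itm ` X. \<Sum>k | k \<in> {..<K} \<and> i \<in> S k \<union> ?R k. c i)"
    using finite_X by (intro sum.swap_restrict) auto
  also have "\<dots> = item_charge"
    unfolding item_charge_def
  proof (intro sum.cong refl)
    fix i
    have "{k \<in> {..<K}. i \<in> S k \<union> ?R k} = charged i" by (auto simp: charged_def)
    then show "(\<Sum>k | k \<in> {..<K} \<and> i \<in> S k \<union> ?R k. c i) = c i * card (charged i)" by simp
  qed
  finally show ?thesis by simp
qed

text \<open>By \<open>ripening_subset\<close> a ripening item is charged at the later service as
  saturated or at the earlier one as premature. The first window has no ripening items, hence the
  index shift.\<close>

lemma ripening_le: "(\<Sum>k<K. \<Sum>i\<in>ripening k. c i) \<le> item_charge"
proof (cases K)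
  case 0
  moreover have "0 \<le> item_charge" using c by (simp add: item_charge_def sum_nonneg)
  ultimately show ?thesis by simp
next
  case (Suc n)
  have fin: "finite (G k)" if "k < K" for k using finite_G that .
  have "(\<Sum>k<K. \<Sum>i\<in>ripening k. c i) = (\<Sum>k<n. \<Sum>i\<in>ripening (Suc k). c i)"
    unfolding Suc sum.lessThan_Suc_shift by (simp add: ripening_def)
  also have "\<dots> \<le> (\<Sum>k<n. (\<Sum>i\<in>S (Suc k). c i) + (\<Sum>i\<in>P k \<inter> ripening (Suc k). c i))"
  proof (intro sum_mono)
    fix k assume "k \<in> {..<n}"
    then have k: "Suc k < K" "k < K" using Suc by auto
    have "(\<Sum>i\<in>ripening (Suc k). c i) \<le> (\<Sum>i\<in>S (Suc k) \<union> (P k \<inter> ripening (Suc k)). c i)"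
      using ripening_subset[OF k(1)] fin[OF k(1)] fin[OF k(2)] c by (intro sum_mono2) auto
    also have "\<dots> \<le> (\<Sum>i\<in>S (Suc k). c i) + (\<Sum>i\<in>P k \<inter> ripening (Suc k). c i)"
      using sum.union_inter[of "S (Suc k)" "P k \<inter> ripening (Suc k)" c] fin[OF k(1)] fin[OF k(2)]
        sum_nonneg[of "S (Suc k) \<inter> (P k \<inter> ripening (Suc k))" c] c by simp
    finally show "(\<Sum>i\<in>ripening (Suc k). c i) \<le> (\<Sum>i\<in>S (Suc k). c i) + (\<Sum>i\<in>P k \<inter> ripening (Suc k). c i)" .
  qed
  also have "\<dots> = (\<Sum>k<n. \<Sum>i\<in>S (Suc k). c i) + (\<Sum>k | Suc k < K. \<Sum>i\<in>P k \<inter> ripening (Suc k). c i)"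
    unfolding sum.distrib Suc by (simp add: lessThan_def)
  also have "(\<Sum>k<n. \<Sum>i\<in>S (Suc k). c i) \<le> (\<Sum>k<K. \<Sum>i\<in>S k. c i)"
    unfolding Suc sum.lessThan_Suc_shift using c by (simp add: sum_nonneg)
  finally show ?thesis using item_charge_lower by linarith
qed

text \<open>Write \<open>R\<close> for \<open>c0 * card Z\<close>, \<open>L\<close> for the leaf
  costs, \<open>D\<close> for the delays and \<open>Q\<close> for \<open>item_charge\<close>. The
  services cost at most \<open>4 * K * c0 + 3 * Q\<close>. Eight times the bound
  \<open>K * c0 / 2 \<le> R + D + Q\<close> turns this into \<open>8 * (R + D) + 11 * Q\<close>, and
  \<open>Q \<le> 2 * (L + D)\<close> into \<open>8 * R + 22 * L + 30 * D\<close>.\<close>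

theorem run_cost_le:
  "(\<Sum>k<K. c0 + (\<Sum>i\<in>itm ` pick (G k) (t k). c i) + (\<Sum>x\<in>pick (G k) (t k). delay x (t k)))
    \<le> 30 * (c0 * card Z + (\<Sum>z\<in>Z. \<Sum>i\<in>M z. c i) + (\<Sum>x\<in>X. g x))"
proof -
  let ?L = "\<Sum>z\<in>Z. \<Sum>i\<in>M z. c i" and ?D = "\<Sum>x\<in>X. g x"
  have "(\<Sum>k<K. c0 / 2) \<le> (\<Sum>k<K. min c0 (due k) + (\<Sum>i\<in>ripening k. c i))"
    using root_cost_le_due by (intro sum_mono) auto
  then have 1: "K * c0 / 2 \<le> c0 * card Z + ?D + item_charge"
    using sum_due_le ripening_le by (simp add: sum.distrib)
  have P0: "0 \<le> (\<Sum>k | Suc k < K. \<Sum>i\<in>P k \<inter> ripening (Suc k). c i)" using c by (simp add: sum_nonneg)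
  have "(\<Sum>k<K. c0 + (\<Sum>i\<in>itm ` pick (G k) (t k). c i) + (\<Sum>x\<in>pick (G k) (t k). delay x (t k)))
    \<le> (\<Sum>k<K. 4 * c0 + 3 * (\<Sum>i\<in>S k. c i))"
    using finite_G overflow_t by (intro sum_mono pick_cost_le) auto
  also have "\<dots> = 4 * (K * c0) + 3 * (\<Sum>k<K. \<Sum>i\<in>S k. c i)"
    by (simp add: sum.distrib sum_distrib_left)
  also have "\<dots> \<le> 4 * (K * c0) + 3 * item_charge" using item_charge_lower P0 by simp
  also have "\<dots> \<le> 8 * (c0 * card Z + ?D) + 11 * item_charge" using 1 by simp
  also have "\<dots> \<le> 8 * (c0 * card Z + ?D) + 22 * (?L + ?D)" using item_charge_upper by simp
  also have "\<dots> \<le> 30 * (c0 * card Z + ?L + ?D)"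
  proof -
    have "0 \<le> c0 * card Z" "0 \<le> ?L" using c0 c by (simp_all add: sum_nonneg)
    then show ?thesis by (simp add: algebra_simps)
  qed
  finally show ?thesis .
qed

end

section \<open>The online algorithm\<close>

context jrp
begin

definition rest :: "entry list \<Rightarrow> entry list" where
  "rest p = filter (\<lambda>x. \<not> sel (set p) (trig (set p)) x) p"

text \<open>The tests on the lengths always succeed; they only make the termination evident.\<close>

function trace :: "entry list \<Rightarrow> entry list \<Rightarrow> (real \<times> entry list) list" where
  "trace p [] = (if length (rest p) < length p then (trig (set p), p) # trace (rest p) [] else [])"
| "trace p (r # f) =
    (if p = [] \<or> arr r \<le> trig (set p) then trace (p @ [r]) f
     else if length (rest p) < length p then (trig (set p), p) # trace (rest p) (r # f) else [])"
  by pat_completeness auto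
termination by (relation "measure (\<lambda>(p, f). 2 * length f + length p)") auto

definition batch :: "real \<times> entry list \<Rightarrow> service" where
  "batch e = \<lparr>time = fst e, subtree = insert Root (Leaf ` itm ` pick (set (snd e)) (fst e)),
     served = idx ` pick (set (snd e)) (fst e)\<rparr>"

declare trace.simps [simp del]

end

section \<open>Invariants of the simulated run and its independence of the future\<close>

context jrp_costs
begin

text \<open>The invariant at the current time \<open>u\<close>, with \<open>p\<close> pending and
  \<open>f\<close> still to arrive. Its last part says that the trigger has not yet been
  passed.\<close>

definition ready :: "real \<Rightarrow> entry list \<Rightarrow> entry list \<Rightarrow> bool" where
  "ready u p f \<longleftrightarrow> sorted (map arr f) \<and> distinct (p @ f) \<and> (\<forall>x\<in>set p. arr x \<le> u) \<and>
     (\<forall>x\<in>set f. u \<le> arr x) \<and> (\<forall>x\<in>set (p @ f). arr x \<le> ddl x) \<and> overflow (set p) u \<le> c0"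

lemma set_rest: "set (rest p) = set p - pick (set p) (trig (set p))"
  by (auto simp: rest_def pick_def)

lemma rest_shorter: "p \<noteq> [] \<Longrightarrow> length (rest p) < length p"
  using pick_trig_nonempty[of "set p"] by (auto simp: rest_def pick_def intro: length_filter_less)

lemma trace_Nil_Nil [simp]: "trace [] [] = []"
  by (simp add: trace.simps)

lemma trace_Nil: "p \<noteq> [] \<Longrightarrow> trace p [] = (trig (set p), p) # trace (rest p) []"
  using rest_shorter[of p] trace.simps(1)[of p] by simp

lemma trace_Cons:
  "trace p (r # f) = (if p = [] \<or> arr r \<le> trig (set p) then trace (p @ [r]) f
     else (trig (set p), p) # trace (rest p) (r # f))"
  using rest_shorter[of p] trace.simps(2)[of p r f] by simp

lemma ready_le_trig: "ready u p f \<Longrightarrow> p \<noteq> [] \<Longrightarrow> u \<le> trig (set p)"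
  by (intro le_trig) (auto simp: ready_def)

lemma ready_serve:
  assumes R: "ready u p f" and p: "p \<noteq> []" and f: "\<And>r f'. f = r # f' \<Longrightarrow> trig (set p) < arr r"
  shows "ready (trig (set p)) (rest p) f" "\<And>x. x \<in> set f \<Longrightarrow> trig (set p) < arr x"
proof -
  show *: "trig (set p) < arr x" if "x \<in> set f" for x
    using that R f by (cases f) (force simp: ready_def)+
  have "arr x \<le> trig (set p)" if "x \<in> set p" for x
    using ready_le_trig[OF R p] that R by (force simp: ready_def)
  then show "ready (trig (set p)) (rest p) f"
    using R * overflow_rest[of "set p" "trig (set p)"] c0 by (auto simp: ready_def set_rest less_imp_le) (auto simp: rest_def)
qed

lemma ready_arrive:
  assumes R: "ready u p (r # f)" and r: "p = [] \<or> arr r \<le> trig (set p)"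
  shows "ready (arr r) (p @ [r]) f" "u \<le> arr r"
proof -
  have "overflow (set p) (arr r) \<le> c0"
  proof (cases "p = []")
    case True
    then show ?thesis using c0 by (simp add: overflow_def)
  next
    case False
    then show ?thesis using overflow_mono[of "arr r" "trig (set p)" "set p"] overflow_trig[of "set p"] r by auto
  qed
  moreover have "overflow (set p \<union> {r}) (arr r) = overflow (set p) (arr r)"
    using R by (intro overflow_future) (auto simp: ready_def)
  ultimately show "ready (arr r) (p @ [r]) f" "u \<le> arr r"
    using R by (force simp: ready_def)+
qed

lemma trace_time_ge: "ready u p f \<Longrightarrow> e \<in> set (trace p f) \<Longrightarrow> u \<le> fst e"
proof (induction p f arbitrary: u rule: trace.induct)
  case (1 p)
  then have p: "p \<noteq> []" by auto
  have "ready (trig (set p)) (rest p) []" using ready_serve(1)[OF 1(2) p] by simp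
  then show ?case using 1(1)[OF rest_shorter[OF p]] ready_le_trig[OF 1(2) p] 1(3)
    by (fastforce simp: trace_Nil[OF p])
next
  case (2 p r f)
  show ?case
  proof (cases "p = [] \<or> arr r \<le> trig (set p)")
    case True
    then show ?thesis using 2(1)[OF True ready_arrive(1)[OF 2(3) True]] ready_arrive(2)[OF 2(3) True] 2(4)
      by (simp add: trace_Cons[of p r f])
  next
    case False
    then have p: "p \<noteq> []" by simp
    have "ready (trig (set p)) (rest p) (r # f)" using ready_serve[OF 2(3) p] False by auto
    moreover have "e = (trig (set p), p) \<or> e \<in> set (trace (rest p) (r # f))"
      using 2(4) False by (simp add: trace_Cons[of p r f])
    ultimately show ?thesis using 2(2)[OF False rest_shorter[OF p]] ready_le_trig[OF 2(3) p] by force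
  qed
qed

lemma sorted_trace: "ready u p f \<Longrightarrow> sorted (map fst (trace p f))"
proof (induction p f arbitrary: u rule: trace.induct)
  case (1 p)
  show ?case
  proof (cases "p = []")
    case False
    have R: "ready (trig (set p)) (rest p) []" using ready_serve[OF 1(2) False] by simp
    show ?thesis using 1(1)[OF rest_shorter[OF False] R] trace_time_ge[OF R] by (simp add: trace_Nil[OF False])
  qed simp
next
  case (2 p r f)
  show ?case
  proof (cases "p = [] \<or> arr r \<le> trig (set p)")
    case True
    then show ?thesis using 2(1)[OF True ready_arrive(1)[OF 2(3) True]] by (simp add: trace_Cons[of p r f])
  next
    case False
    then have p: "p \<noteq> []" by simp
    have R: "ready (trig (set p)) (rest p) (r # f)" using ready_serve[OF 2(3) p] False by auto
    then show ?thesis using 2(2)[OF False rest_shorter[OF p] R] trace_time_ge[OF R] False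
      by (simp add: trace_Cons[of p r f])
  qed
qed

lemma trace_after:
  assumes "ready u p f" "t < u" shows "filter (\<lambda>e. fst e \<le> t) (trace p f) = []"
proof -
  have "\<not> fst e \<le> t" if "e \<in> set (trace p f)" for e using trace_time_ge[OF assms(1) that] assms(2) by simp
  then show ?thesis by (simp add: filter_empty_conv)
qed

lemma ready_filter:
  "ready u p f \<Longrightarrow> ready u p (filter Q f)"
proof -
  assume R: "ready u p f"
  have "set (filter Q f) \<subseteq> set f" by simp
  moreover have "sorted (map arr (filter Q f))" using R by (intro sorted_filter) (simp add: ready_def)
  moreover have "distinct (p @ filter Q f)" using R by (auto simp: ready_def)
  ultimately show ?thesis using R by (auto simp: ready_def)
qed

text \<open>Later arrivals influence the run only through the comparison with the trigger. If an
  arrival after \<open>t\<close> precedes the trigger, then the trigger is after \<open>t\<close>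
  too, and neither run serves by \<open>t\<close>; if the trigger comes first, both runs perform the
  same service.\<close>

lemma trace_prefix:
  "ready u p f \<Longrightarrow> filter (\<lambda>e. fst e \<le> t) (trace p f)
    = filter (\<lambda>e. fst e \<le> t) (trace p (filter (\<lambda>x. arr x \<le> t) f))"
proof (induction p f arbitrary: u rule: trace.induct)
  case (1 p)
  then show ?case by simp
next
  case (2 p r f)
  show ?case
  proof (cases "p = [] \<or> arr r \<le> trig (set p)")
    case True
    note R = ready_arrive(1)[OF 2(3) True]
    show ?thesis
    proof (cases "arr r \<le> t")
      case rt: True
      then show ?thesis using 2(1)[OF True R] True
        by (simp add: trace_Cons[of p r f] trace_Cons[of p r "filter (\<lambda>x. arr x \<le> t) f"])
    next
      case False
      then have f: "filter (\<lambda>x. arr x \<le> t) (r # f) = []" using 2(3) by (auto simp: ready_def filter_empty_conv)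
      have "filter (\<lambda>e. fst e \<le> t) (trace p (r # f)) = []"
        using trace_after[OF R, of t] False True by (simp add: trace_Cons[of p r f])
      moreover have "filter (\<lambda>e. fst e \<le> t) (trace p []) = []"
      proof (cases "p = []")
        case False
        have R': "ready u p []" using ready_filter[OF 2(3), of "\<lambda>_. False"] by simp
        have "t < trig (set p)" using True False \<open>\<not> arr r \<le> t\<close> by auto
        then show ?thesis using trace_after[OF ready_serve(1)[OF R' False], of t] by (simp add: trace_Nil[OF False])
      qed simp
      ultimately show ?thesis unfolding f by simp
    qed
  next
    case False
    then have p: "p \<noteq> []" by simp
    have R: "ready (trig (set p)) (rest p) (r # f)" using ready_serve[OF 2(3) p] False by auto
    have IH: "filter (\<lambda>e. fst e \<le> t) (trace (rest p) (r # f))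
      = filter (\<lambda>e. fst e \<le> t) (trace (rest p) (filter (\<lambda>x. arr x \<le> t) (r # f)))"
      using 2(2)[OF False rest_shorter[OF p] R] .
    have tr: "trace p (r # f) = (trig (set p), p) # trace (rest p) (r # f)"
      using False by (simp add: trace_Cons[of p r f])
    have tr': "trace p (filter (\<lambda>x. arr x \<le> t) (r # f))
      = (trig (set p), p) # trace (rest p) (filter (\<lambda>x. arr x \<le> t) (r # f))"
    proof (cases "filter (\<lambda>x. arr x \<le> t) (r # f)")
      case Nil
      then show ?thesis by (simp only: trace_Nil[OF p])
    next
      case (Cons r' f')
      then have "r' \<in> set (r # f)" by (metis filter_is_subset list.set_intros(1) subsetD)
      then have "trig (set p) < arr r'" using ready_serve(2)[OF 2(3) p] False by auto
      then show ?thesis unfolding Cons trace_Cons[of p r' f'] using p by simp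
    qed
    show ?thesis unfolding tr tr' filter.simps(2)[of _ "(trig (set p), p)"] IH ..
  qed
qed

abbreviation trace_pick :: "real \<times> entry list \<Rightarrow> entry set" where
  "trace_pick e \<equiv> pick (set (snd e)) (fst e)"

lemma Collect_remove:
  assumes "P' = P - Q" "\<And>x. x \<in> F \<Longrightarrow> x \<notin> Q"
  shows "{x \<in> P \<union> F. A x \<and> x \<notin> Q \<and> B x} = {x \<in> P' \<union> F. A x \<and> B x}"
  using assms by auto

text \<open>This supplies the assumptions \<open>pending\<close>, \<open>nonempty\<close> and
  \<open>t_trig\<close> of \<open>jrp_run\<close>. A request arriving exactly at the trigger time
  joins the pending ones before the service.\<close>

lemma trace_pending:
  "ready u p f \<Longrightarrow> k < length (trace p f) \<Longrightarrow>
    set (snd (trace p f ! k)) = {x \<in> set (p @ f). arr x \<le> fst (trace p f ! k) \<and>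
      (\<forall>j<k. x \<notin> trace_pick (trace p f ! j))} \<and>
    snd (trace p f ! k) \<noteq> [] \<and> fst (trace p f ! k) = trig (set (snd (trace p f ! k)))"
proof (induction p f arbitrary: u k rule: trace.induct)
  case (1 p)
  have p: "p \<noteq> []" using 1(3) by auto
  have R: "ready (trig (set p)) (rest p) []" using ready_serve(1)[OF 1(2) p] by simp
  note tr = trace_Nil[OF p]
  show ?case
  proof (cases k)
    case 0
    have "x \<in> set p \<Longrightarrow> arr x \<le> trig (set p)" for x
      using 1(2) ready_le_trig[OF 1(2) p] by (force simp: ready_def)
    then show ?thesis using p 0 by (auto simp: tr)
  next
    case (Suc k')
    then have k': "k' < length (trace (rest p) [])" using 1(3) by (simp add: tr)
    let ?L = "trace (rest p) []"
    have eq: "{x \<in> set (p @ []). arr x \<le> fst (?L ! k') \<and> (\<forall>j<Suc k'. x \<notin> trace_pick (((trig (set p), p) # ?L) ! j))}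
      = {x \<in> set (rest p @ []). arr x \<le> fst (?L ! k') \<and> (\<forall>j<k'. x \<notin> trace_pick (?L ! j))}"
      unfolding All_less_Suc2 nth_Cons_0 nth_Cons_Suc set_append fst_conv snd_conv
      by (rule Collect_remove[OF set_rest]) simp
    show ?thesis unfolding tr Suc nth_Cons_Suc eq by (rule 1(1)[OF rest_shorter[OF p] R k'])
  qed
next
  case (2 p r f)
  show ?case
  proof (cases "p = [] \<or> arr r \<le> trig (set p)")
    case True
    then have tr: "trace p (r # f) = trace (p @ [r]) f" by (simp add: trace_Cons[of p r f])
    have app: "(p @ [r]) @ f = p @ r # f" by simp
    show ?thesis unfolding tr
      by (rule 2(1)[OF True ready_arrive(1)[OF 2(3) True] 2(4)[unfolded tr], unfolded app])
  next
    case False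
    then have p: "p \<noteq> []" by simp
    have R: "ready (trig (set p)) (rest p) (r # f)" using ready_serve[OF 2(3) p] False by auto
    have late: "x \<in> set (r # f) \<Longrightarrow> trig (set p) < arr x" for x using ready_serve(2)[OF 2(3) p] False by auto
    have tr: "trace p (r # f) = (trig (set p), p) # trace (rest p) (r # f)" using False by (simp add: trace_Cons[of p r f])
    show ?thesis
    proof (cases k)
      case 0
      have "x \<in> set p \<Longrightarrow> arr x \<le> trig (set p)" for x
        using 2(3) ready_le_trig[OF 2(3) p] by (force simp: ready_def)
      moreover have "\<not> arr x \<le> trig (set p)" if "x \<in> set (r # f)" for x using late[OF that] by simp
      ultimately have "set p = {x \<in> set (p @ r # f). arr x \<le> trig (set p)}" by auto
      then show ?thesis unfolding tr 0 using p by simp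
    next
      case (Suc k')
      then have k': "k' < length (trace (rest p) (r # f))" using 2(4) by (simp add: tr)
      let ?L = "trace (rest p) (r # f)"
      have eq: "{x \<in> set (p @ r # f). arr x \<le> fst (?L ! k') \<and> (\<forall>j<Suc k'. x \<notin> trace_pick (((trig (set p), p) # ?L) ! j))}
        = {x \<in> set (rest p @ r # f). arr x \<le> fst (?L ! k') \<and> (\<forall>j<k'. x \<notin> trace_pick (?L ! j))}"
      proof -
        have d: "x \<in> set (r # f) \<Longrightarrow> x \<notin> pick (set p) (trig (set p))" for x
          using 2(3) by (auto simp: ready_def pick_def)
        show ?thesis
          unfolding All_less_Suc2 nth_Cons_0 nth_Cons_Suc set_append fst_conv snd_conv
          by (rule Collect_remove[OF set_rest d])
      qed
      show ?thesis unfolding tr Suc nth_Cons_Suc eq by (rule 2(2)[OF False rest_shorter[OF p] R k'])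
    qed
  qed
qed

lemma trace_served:
  "x \<in> set (p @ f) \<Longrightarrow> \<exists>e\<in>set (trace p f). x \<in> trace_pick e"
proof (induction p f rule: trace.induct)
  case (1 p)
  then have p: "p \<noteq> []" by auto
  show ?case using 1(1)[OF rest_shorter[OF p]] 1(2) p by (cases "x \<in> set (rest p)") (auto simp: trace_Nil[OF p] set_rest)
next
  case (2 p r f)
  show ?case
  proof (cases "p = [] \<or> arr r \<le> trig (set p)")
    case True
    then show ?thesis using 2(1)[OF True] 2(3) by (simp add: trace_Cons[of p r f])
  next
    case False
    then have p: "p \<noteq> []" by simp
    show ?thesis using 2(2)[OF False rest_shorter[OF p]] 2(3) False
      by (cases "x \<in> set (rest p @ r # f)") (auto simp: trace_Cons[of p r f] set_rest)
  qed
qed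

end

section \<open>From instances to entries and back\<close>

fun number :: "nat \<Rightarrow> request list \<Rightarrow> entry list" where
  "number j [] = []"
| "number j (\<rho> # rs) = Entry j (item \<rho>) (arrival \<rho>) (deadline \<rho>) # number (Suc j) rs"

lemma length_number [simp]: "length (number j rs) = length rs"
  by (induction j rs rule: number.induct) auto

lemma nth_number: "k < length rs \<Longrightarrow>
  number j rs ! k = Entry (j + k) (item (rs ! k)) (arrival (rs ! k)) (deadline (rs ! k))"
  by (induction j rs arbitrary: k rule: number.induct) (auto simp: nth_Cons')

lemma map_arr_number [simp]: "map arr (number j rs) = map arrival rs"
  by (induction j rs rule: number.induct) auto

lemma map_idx_number [simp]: "map idx (number j rs) = [j..<j + length rs]"
proof (induction j rs rule: number.induct)
  case (2 j \<rho> rs)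
  have "[j..<j + length (\<rho> # rs)] = j # [Suc j..<Suc j + length rs]" by (subst upt_conv_Cons) auto
  then show ?case using 2 by (simp del: upt_Suc)
qed simp

lemma filter_number:
  "sorted (map arrival rs) \<Longrightarrow>
    filter (\<lambda>x. arr x \<le> t) (number j rs) = number j (filter (\<lambda>\<rho>. arrival \<rho> \<le> t) rs)"
proof (induction j rs rule: number.induct)
  case (2 j \<rho> rs)
  show ?case
  proof (cases "arrival \<rho> \<le> t")
    case False
    then have "\<forall>\<rho>'\<in>set rs. \<not> arrival \<rho>' \<le> t" using 2(2) by auto
    moreover from this have "\<forall>x\<in>set (number (Suc j) rs). \<not> arr x \<le> t"
      using map_arr_number[of "Suc j" rs] by (metis image_iff list.set_map)
    ultimately show ?thesis using False by (simp add: filter_empty_conv)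
  qed (use 2 in simp)
qed simp

definition entries :: "jrp_instance \<Rightarrow> entry list" where
  "entries I = number 0 (requests I)"

text \<open>The value 0 beyond the last item makes costs nonnegative for every natural number, as
  \<open>jrp_costs\<close> demands.\<close>

definition leaf_cost :: "jrp_instance \<Rightarrow> nat \<Rightarrow> real" where
  "leaf_cost I i = (if i < length (item_costs I) then item_costs I ! i else 0)"

text \<open>With free backlog nothing is claimed about the cost, and any positive rate will do.\<close>

definition rate :: "jrp_instance \<Rightarrow> real" where
  "rate I = (if backlog_rate I \<le> 0 then 1 else backlog_rate I)"

abbreviation trace_of :: "jrp_instance \<Rightarrow> (real \<times> entry list) list" where
  "trace_of I \<equiv> jrp.trace (root_cost I) (holding_rate I) (rate I) (leaf_cost I) [] (entries I)"

definition replenish :: "jrp_instance \<Rightarrow> schedule" where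
  "replenish I = map (jrp.batch (root_cost I) (holding_rate I) (rate I) (leaf_cost I)) (trace_of I)"

lemma valid_jrp_costs:
  assumes I: "valid_instance I"
  shows "jrp_costs (root_cost I) (holding_rate I) (rate I) (leaf_cost I)"
proof
  show "0 \<le> root_cost I" using I by (force simp: valid_instance_def nodes_def)
  show "0 \<le> leaf_cost I i" for i
    using I by (force simp: valid_instance_def nodes_def leaf_cost_def)
qed (use I in \<open>auto simp: valid_instance_def rate_def\<close>)

context
  fixes I :: jrp_instance
  assumes I: "valid_instance I"
begin

interpretation jrp_costs "root_cost I" "holding_rate I" "rate I" "leaf_cost I"
  using I by (rule valid_jrp_costs)

lemma entries_props:
  assumes "x \<in> set (entries I)"
  shows "idx x < length (requests I)" "itm x = item (requests I ! idx x)"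
    "arr x = arrival (requests I ! idx x)" "ddl x = deadline (requests I ! idx x)"
    "entries I ! idx x = x" "itm x < length (item_costs I)" "arr x \<le> ddl x"
proof -
  obtain k where k: "k < length (requests I)" "x = entries I ! k"
    using assms by (auto simp: entries_def in_set_conv_nth)
  then show *: "idx x < length (requests I)" "itm x = item (requests I ! idx x)"
    "arr x = arrival (requests I ! idx x)" "ddl x = deadline (requests I ! idx x)"
    "entries I ! idx x = x"
    by (auto simp: entries_def nth_number)
  have "requests I ! idx x \<in> set (requests I)" using *(1) by simp
  then show "itm x < length (item_costs I)" "arr x \<le> ddl x"
    using I * by (auto simp: valid_instance_def nodes_def)
qed

lemma nth_entries:
  assumes "j < length (requests I)"
  shows "entries I ! j \<in> set (entries I)" "idx (entries I ! j) = j"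
proof -
  have "entries I ! j \<in> set (entries I)" using assms by (intro nth_mem) (simp add: entries_def)
  then show "entries I ! j \<in> set (entries I)" .
qed (use assms in \<open>simp add: entries_def nth_number\<close>)

lemma ready_entries: "ready (Min (insert 0 (arr ` set (entries I)))) [] (entries I)"
proof -
  have "distinct (map idx (entries I))" by (simp add: entries_def)
  then have "distinct (entries I)" by (simp add: distinct_map)
  moreover have "sorted (map arr (entries I))" using I by (simp add: entries_def valid_instance_def)
  ultimately show ?thesis using entries_props c0 by (auto simp: ready_def overflow_def)
qed

lemma filter_replenish:
  "filter (\<lambda>s. time s \<le> t) (replenish I)
    = map batch (filter (\<lambda>e. fst e \<le> t) (trace [] (entries (known t I))))"
proof -
  have "filter (\<lambda>s. time s \<le> t) (replenish I) = map batch (filter (\<lambda>e. fst e \<le> t) (trace [] (entries I)))"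
    by (simp add: replenish_def filter_map comp_def batch_def)
  also have "entries (known t I) = filter (\<lambda>x. arr x \<le> t) (entries I)"
    using I by (simp add: entries_def known_def filter_number valid_instance_def)
  ultimately show ?thesis using trace_prefix[OF ready_entries, of t] by simp
qed

abbreviation (input) Tr where "Tr \<equiv> trace [] (entries I)"

lemma Tr_props:
  assumes "k < length Tr"
  shows "set (snd (Tr ! k)) = {x \<in> set (entries I). arr x \<le> fst (Tr ! k) \<and> (\<forall>j<k. x \<notin> trace_pick (Tr ! j))}"
    "snd (Tr ! k) \<noteq> []" "fst (Tr ! k) = trig (set (snd (Tr ! k)))"
proof -
  note * = trace_pending[OF ready_entries assms, unfolded append_Nil]
  show "set (snd (Tr ! k)) = {x \<in> set (entries I). arr x \<le> fst (Tr ! k) \<and> (\<forall>j<k. x \<notin> trace_pick (Tr ! j))}"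
    by (rule *[THEN conjunct1])
  show "snd (Tr ! k) \<noteq> []" by (rule *[THEN conjunct2, THEN conjunct1])
  show "fst (Tr ! k) = trig (set (snd (Tr ! k)))" by (rule *[THEN conjunct2, THEN conjunct2])
qed

lemma Tr_pick:
  assumes "k < length Tr" "x \<in> trace_pick (Tr ! k)"
  shows "x \<in> set (entries I)" "arr x \<le> fst (Tr ! k)"
  using assms Tr_props(1)[OF assms(1)] by (auto simp: pick_def)

lemma feasible_replenish: "feasible I (replenish I)"
  unfolding feasible_def
proof (intro conjI ballI allI impI)
  fix s assume "s \<in> set (replenish I)"
  then obtain k where k: "k < length Tr" "s = batch (Tr ! k)"
    by (auto simp: replenish_def in_set_conv_nth)
  show "valid_service I s"
    unfolding valid_service_def
  proof (intro conjI ballI)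
    show "Root \<in> subtree s" by (simp add: k batch_def)
    show "subtree s \<subseteq> nodes I"
      using Tr_pick(1)[OF k(1)] entries_props(6) by (auto simp: k(2) batch_def nodes_def)
    fix j assume "j \<in> served s"
    then obtain x where x: "x \<in> trace_pick (Tr ! k)" "j = idx x" by (auto simp: k(2) batch_def)
    note X = Tr_pick[OF k(1) x(1)]
    show "j < length (requests I)" using entries_props(1)[OF X(1)] x(2) by simp
    show "Leaf (item (requests I ! j)) \<in> subtree s"
      using entries_props(2)[OF X(1), symmetric] x by (simp add: k(2) batch_def)
    show "arrival (requests I ! j) \<le> time s"
      using entries_props(3)[OF X(1)] X(2) x by (simp add: k(2) batch_def)
  qed
next
  fix j assume "j < length (requests I)"
  note x = nth_entries[OF this]
  obtain k where k: "k < length Tr" "entries I ! j \<in> trace_pick (Tr ! k)"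
    using trace_served[of "entries I ! j" "[]" "entries I"] x by (auto simp: in_set_conv_nth)
  have served: "j \<in> served (replenish I ! k) \<longleftrightarrow> entries I ! j \<in> trace_pick (Tr ! k)" if "k < length Tr" for k
  proof -
    have "j \<in> idx ` trace_pick (Tr ! k) \<longleftrightarrow> entries I ! j \<in> trace_pick (Tr ! k)"
    proof
      assume "j \<in> idx ` trace_pick (Tr ! k)"
      then obtain z where z: "z \<in> trace_pick (Tr ! k)" "j = idx z" by blast
      show "entries I ! j \<in> trace_pick (Tr ! k)"
        using entries_props(5)[OF Tr_pick(1)[OF that z(1)]] z by simp
    qed (use x(2) in \<open>metis imageI\<close>)
    then show ?thesis using that by (simp add: replenish_def batch_def)
  qed
  show "\<exists>!k. k < length (replenish I) \<and> j \<in> served (replenish I ! k)"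
  proof (intro ex1I[of _ k] conjI)
    show "k < length (replenish I)" "j \<in> served (replenish I ! k)"
      using k served by (auto simp: replenish_def)
    fix k' assume k': "k' < length (replenish I) \<and> j \<in> served (replenish I ! k')"
    then have l: "k' < length Tr" "entries I ! j \<in> trace_pick (Tr ! k')"
      using served by (auto simp: replenish_def)
    have "False" if "a < b" "b < length Tr" "entries I ! j \<in> trace_pick (Tr ! a)" "entries I ! j \<in> trace_pick (Tr ! b)" for a b
      using Tr_props(1)[OF that(2)] that by (auto simp: pick_def)
    then show "k' = k" using k l by (meson linorder_less_linear)
  qed
qed

lemma service_cost_alt:
  assumes "subtree s \<subseteq> nodes I" "Root \<in> subtree s"
  shows "service_cost I s = root_cost I + (\<Sum>i | Leaf i \<in> subtree s. leaf_cost I i)"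
proof -
  let ?L = "{i. Leaf i \<in> subtree s}"
  have eq: "subtree s = insert Root (Leaf ` ?L)"
  proof (intro set_eqI)
    show "u \<in> subtree s \<longleftrightarrow> u \<in> insert Root (Leaf ` ?L)" for u using assms(2) by (cases u) auto
  qed
  have sub: "?L \<subseteq> {..<length (item_costs I)}" using assms(1) by (auto simp: nodes_def)
  then have fin: "finite ?L" by (rule finite_subset) simp
  have "service_cost I s = root_cost I + (\<Sum>u\<in>Leaf ` ?L. node_cost I u)"
    unfolding service_cost_def by (subst eq, subst sum.insert) (use fin in auto)
  also have "(\<Sum>u\<in>Leaf ` ?L. node_cost I u) = (\<Sum>i\<in>?L. leaf_cost I i)"
    using sub by (subst sum.reindex) (auto simp: inj_on_def leaf_cost_def intro!: sum.cong)
  finally show ?thesis .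
qed

lemma sum_served:
  assumes A: "A \<subseteq> set (entries I)"
  shows "(\<Sum>j\<in>idx ` A. F j) = (\<Sum>x\<in>A. F (idx x))"
proof -
  have "inj_on idx A" using A entries_props(5) by (metis (no_types, lifting) inj_onI subsetD)
  then show ?thesis by (simp add: sum.reindex)
qed

context
  assumes b_pos: "0 < backlog_rate I"
begin

lemma delay_cost_alt: "x \<in> set (entries I) \<Longrightarrow> delay_cost I (requests I ! idx x) s = delay x s"
  unfolding delay_def using b_pos entries_props(4) by (simp add: delay_cost_def rate_def)

lemma cost_replenish:
  "cost I (replenish I) = (\<Sum>k<length Tr. root_cost I + (\<Sum>i\<in>itm ` trace_pick (Tr ! k). leaf_cost I i)
    + (\<Sum>x\<in>trace_pick (Tr ! k). delay x (fst (Tr ! k))))"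
proof -
  have "cost I (replenish I) = (\<Sum>k<length Tr. service_cost I (batch (Tr ! k))
      + (\<Sum>j\<in>served (batch (Tr ! k)). delay_cost I (requests I ! j) (time (batch (Tr ! k)))))"
    unfolding cost_def replenish_def by (subst sum_list_sum_nth) (simp add: atLeast0LessThan)
  also have "\<dots> = (\<Sum>k<length Tr. root_cost I + (\<Sum>i\<in>itm ` trace_pick (Tr ! k). leaf_cost I i)
    + (\<Sum>x\<in>trace_pick (Tr ! k). delay x (fst (Tr ! k))))"
  proof (intro sum.cong refl arg_cong2[where f = plus])
    fix k assume "k \<in> {..<length Tr}"
    then have k: "k < length Tr" by simp
    let ?V = "trace_pick (Tr ! k)"
    have V: "?V \<subseteq> set (entries I)" using Tr_pick(1)[OF k] by blast
    have "valid_service I (batch (Tr ! k))"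
      using feasible_replenish k by (auto simp: feasible_def replenish_def)
    moreover have "{i. Leaf i \<in> subtree (batch (Tr ! k))} = itm ` ?V" by (auto simp: batch_def)
    ultimately show "service_cost I (batch (Tr ! k)) = root_cost I + (\<Sum>i\<in>itm ` ?V. leaf_cost I i)"
      by (simp add: service_cost_alt valid_service_def)
    have "(\<Sum>j\<in>served (batch (Tr ! k)). delay_cost I (requests I ! j) (time (batch (Tr ! k))))
      = (\<Sum>x\<in>?V. delay_cost I (requests I ! idx x) (fst (Tr ! k)))"
      unfolding batch_def by (simp add: sum_served[OF V])
    also have "\<dots> = (\<Sum>x\<in>?V. delay x (fst (Tr ! k)))"
      using V delay_cost_alt by (intro sum.cong) auto
    finally show "(\<Sum>j\<in>served (batch (Tr ! k)). delay_cost I (requests I ! j) (time (batch (Tr ! k))))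
      = (\<Sum>x\<in>?V. delay x (fst (Tr ! k)))" .
  qed
  finally show ?thesis .
qed

lemma replenish_competitive_feasible:
  assumes S: "feasible I S"
  shows "cost I (replenish I) \<le> 30 * cost I S"
proof -
  define f where "f x = (THE k. k < length S \<and> idx x \<in> served (S ! k))" for x
  let ?T = "\<lambda>k. time (S ! k)" and ?M = "\<lambda>k. {i. Leaf i \<in> subtree (S ! k)}"
  have fS: "f x < length S" "idx x \<in> served (S ! f x)" if "x \<in> set (entries I)" for x
  proof -
    have "\<exists>!k. k < length S \<and> idx x \<in> served (S ! k)"
      using S entries_props(1)[OF that] by (auto simp: feasible_def)
    from theI'[OF this] show "f x < length S" "idx x \<in> served (S ! f x)" unfolding f_def by auto
  qed
  have funiq: "f x = k" if "x \<in> set (entries I)" "k < length S" "idx x \<in> served (S ! k)" for x k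
    using S entries_props(1)[OF that(1)] fS[OF that(1)] that unfolding feasible_def by blast
  have valid: "valid_service I (S ! k)" if "k < length S" for k
    using S that by (auto simp: feasible_def)
  have finM: "finite (?M k)" if "k < length S" for k
  proof -
    have "?M k \<subseteq> {..<length (item_costs I)}" using valid[OF that] by (auto simp: valid_service_def nodes_def)
    then show ?thesis by (rule finite_subset) simp
  qed
  interpret jrp_run_vs "root_cost I" "holding_rate I" "rate I" "leaf_cost I" "set (entries I)" "length Tr"
    "\<lambda>k. fst (Tr ! k)" "\<lambda>k. set (snd (Tr ! k))" "{..<length S}" ?T ?M f
  proof
    show "arr x \<le> ddl x" if "x \<in> set (entries I)" for x using entries_props(7)[OF that] .
    show "fst (Tr ! j) \<le> fst (Tr ! k)" if "j \<le> k" "k < length Tr" for j k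
      using sorted_trace[OF ready_entries] that by (auto simp: sorted_iff_nth_mono)
    show "set (snd (Tr ! k)) = {x \<in> set (entries I). arr x \<le> fst (Tr ! k) \<and> (\<forall>j<k. x \<notin> trace_pick (Tr ! j))}"
      if "k < length Tr" for k using Tr_props(1)[OF that] .
    show "set (snd (Tr ! k)) \<noteq> {}" if "k < length Tr" for k using Tr_props(2)[OF that] by simp
    show "fst (Tr ! k) = trig (set (snd (Tr ! k)))" if "k < length Tr" for k using Tr_props(3)[OF that] .
    show "finite (?M z)" if "z \<in> {..<length S}" for z using finM that by simp
    show "f x \<in> {..<length S}" "itm x \<in> ?M (f x)" "arr x \<le> time (S ! f x)" if "x \<in> set (entries I)" for x
      using fS[OF that] valid[of "f x"] entries_props[OF that] by (auto simp: valid_service_def)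
  qed auto
  have "cost I S = (\<Sum>k<length S. service_cost I (S ! k)
      + (\<Sum>j\<in>served (S ! k). delay_cost I (requests I ! j) (?T k)))"
    unfolding cost_def by (subst sum_list_sum_nth) (simp add: atLeast0LessThan)
  also have "\<dots> = (\<Sum>k<length S. (root_cost I + (\<Sum>i\<in>?M k. leaf_cost I i))
      + (\<Sum>x | x \<in> set (entries I) \<and> f x = k. g x))"
  proof (intro sum.cong refl arg_cong2[where f = plus])
    fix k assume "k \<in> {..<length S}"
    then have k: "k < length S" by simp
    show "service_cost I (S ! k) = root_cost I + (\<Sum>i\<in>?M k. leaf_cost I i)"
      using valid[OF k] by (intro service_cost_alt) (auto simp: valid_service_def)
    let ?A = "{x \<in> set (entries I). f x = k}"
    have "served (S ! k) = idx ` ?A"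
    proof (intro set_eqI iffI)
      fix j assume j: "j \<in> served (S ! k)"
      then have "j < length (requests I)" using valid[OF k] by (auto simp: valid_service_def)
      note x = nth_entries[OF this]
      show "j \<in> idx ` ?A" using funiq[OF x(1) k] x j by (intro image_eqI[of _ _ "entries I ! j"]) auto
    qed (use fS in auto)
    then show "(\<Sum>j\<in>served (S ! k). delay_cost I (requests I ! j) (?T k)) = (\<Sum>x\<in>?A. g x)"
      using sum_served[of ?A "\<lambda>j. delay_cost I (requests I ! j) (?T k)"] by (auto simp: delay_cost_alt intro!: sum.cong)
  qed
  also have "\<dots> = root_cost I * card {..<length S} + (\<Sum>k<length S. \<Sum>i\<in>?M k. leaf_cost I i)
      + (\<Sum>k<length S. \<Sum>x | x \<in> set (entries I) \<and> f x = k. g x)"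
    by (simp add: sum.distrib)
  also have "(\<Sum>k<length S. \<Sum>x | x \<in> set (entries I) \<and> f x = k. g x) = (\<Sum>x\<in>set (entries I). g x)"
    using fS(1) by (intro sum.group) auto
  finally show ?thesis using run_cost_le unfolding cost_replenish by simp
qed

lemma replenish_competitive: "cost I (replenish I) \<le> 30 * opt I"
proof -
  have "cost I (replenish I) / 30 \<le> opt I"
    unfolding opt_def
  proof (rule cInf_greatest)
    show "{cost I S |S. feasible I S} \<noteq> {}" using feasible_replenish by blast
    fix v assume "v \<in> {cost I S |S. feasible I S}"
    then obtain S where "feasible I S" "v = cost I S" by blast
    then show "cost I (replenish I) / 30 \<le> v" using replenish_competitive_feasible[of S] by simp
  qed
  then show ?thesis by simp
qed

end

end

lemma online_replenish: "online_algorithm replenish"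
  unfolding online_algorithm_def
proof (intro conjI allI impI)
  fix I J t assume IJ: "valid_instance I" "valid_instance J" and eq: "known t I = known t J"
  have "root_cost I = root_cost J" "holding_rate I = holding_rate J" "backlog_rate I = backlog_rate J"
    "item_costs I = item_costs J"
    using arg_cong[OF eq, of root_cost] arg_cong[OF eq, of holding_rate] arg_cong[OF eq, of backlog_rate]
      arg_cong[OF eq, of item_costs] by (simp_all add: known_def)
  moreover from this have "leaf_cost I = leaf_cost J" "rate I = rate J"
    by (auto simp: leaf_cost_def rate_def)
  ultimately show "filter (\<lambda>s. time s \<le> t) (replenish I) = filter (\<lambda>s. time s \<le> t) (replenish J)"
    using filter_replenish[OF IJ(1), of t] filter_replenish[OF IJ(2), of t] eq by simp
qed (rule feasible_replenish)

section \<open>Verified running times\<close>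

text \<open>A functional form of the semantics with the results of calls supplied by
  \<open>C\<close>. A body can thus be evaluated by rewriting with the equations of the functions it
  calls.\<close>

fun sem :: "(nat \<Rightarrow> val \<Rightarrow> val option) \<Rightarrow> val list \<Rightarrow> exp \<Rightarrow> val option" where
  "sem C env (Var i) = (if i < length env then Some (env ! i) else None)"
| "sem C env (Lit z) = Some (Num (of_int z))"
| "sem C env (Arith p e1 e2) = (case sem C env e1 of Some (Num x) \<Rightarrow> (case sem C env e2 of Some (Num y) \<Rightarrow>
     if p = Div \<and> y = 0 then None else Some (Num (apply_op p x y)) | _ \<Rightarrow> None) | _ \<Rightarrow> None)"
| "sem C env Empty = Some Nl"
| "sem C env (Cell e1 e2) = (case sem C env e1 of Some v \<Rightarrow> (case sem C env e2 of Some w \<Rightarrow> Some (Cs v w)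
     | None \<Rightarrow> None) | None \<Rightarrow> None)"
| "sem C env (Fst e) = (case sem C env e of Some (Cs v w) \<Rightarrow> Some v | _ \<Rightarrow> None)"
| "sem C env (Snd e) = (case sem C env e of Some (Cs v w) \<Rightarrow> Some w | _ \<Rightarrow> None)"
| "sem C env (IfLe e1 e2 e3 e4) = (case sem C env e1 of Some (Num x) \<Rightarrow> (case sem C env e2 of Some (Num y) \<Rightarrow>
     if x \<le> y then sem C env e3 else sem C env e4 | _ \<Rightarrow> None) | _ \<Rightarrow> None)"
| "sem C env (IfEmpty e1 e2 e3) = (case sem C env e1 of Some Nl \<Rightarrow> sem C env e2
     | Some (Cs v w) \<Rightarrow> sem C env e3 | _ \<Rightarrow> None)"
| "sem C env (LetIn e1 e2) = (case sem C env e1 of Some v \<Rightarrow> sem C (v # env) e2 | None \<Rightarrow> None)"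
| "sem C env (Call k e) = (case sem C env e of Some v \<Rightarrow> C k v | None \<Rightarrow> None)"

text \<open>Adding up both branches of a conditional keeps the bound polynomial in the bounds \<open>\<tau>\<close> for the
  calls.\<close>

fun cst :: "(nat \<Rightarrow> nat) \<Rightarrow> exp \<Rightarrow> nat" where
  "cst \<tau> (Var i) = 1"
| "cst \<tau> (Lit z) = 1"
| "cst \<tau> (Arith p e1 e2) = cst \<tau> e1 + cst \<tau> e2 + 1"
| "cst \<tau> Empty = 1"
| "cst \<tau> (Cell e1 e2) = cst \<tau> e1 + cst \<tau> e2 + 1"
| "cst \<tau> (Fst e) = cst \<tau> e + 1"
| "cst \<tau> (Snd e) = cst \<tau> e + 1"
| "cst \<tau> (IfLe e1 e2 e3 e4) = cst \<tau> e1 + cst \<tau> e2 + (cst \<tau> e3 + cst \<tau> e4) + 1"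
| "cst \<tau> (IfEmpty e1 e2 e3) = cst \<tau> e1 + (cst \<tau> e2 + cst \<tau> e3) + 1"
| "cst \<tau> (LetIn e1 e2) = cst \<tau> e1 + cst \<tau> e2 + 1"
| "cst \<tau> (Call k e) = cst \<tau> e + \<tau> k + 1"

fun calls_below :: "nat \<Rightarrow> exp \<Rightarrow> bool" where
  "calls_below n (Arith p e1 e2) \<longleftrightarrow> calls_below n e1 \<and> calls_below n e2"
| "calls_below n (Cell e1 e2) \<longleftrightarrow> calls_below n e1 \<and> calls_below n e2"
| "calls_below n (Fst e) \<longleftrightarrow> calls_below n e"
| "calls_below n (Snd e) \<longleftrightarrow> calls_below n e"
| "calls_below n (IfLe e1 e2 e3 e4) \<longleftrightarrow>
     calls_below n e1 \<and> calls_below n e2 \<and> calls_below n e3 \<and> calls_below n e4"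
| "calls_below n (IfEmpty e1 e2 e3) \<longleftrightarrow> calls_below n e1 \<and> calls_below n e2 \<and> calls_below n e3"
| "calls_below n (LetIn e1 e2) \<longleftrightarrow> calls_below n e1 \<and> calls_below n e2"
| "calls_below n (Call k e) \<longleftrightarrow> k < n \<and> calls_below n e"
| "calls_below n _ \<longleftrightarrow> True"

lemma cst_cong: "calls_below n e \<Longrightarrow> (\<And>k. k < n \<Longrightarrow> \<tau> k = \<tau>' k) \<Longrightarrow> cst \<tau> e = cst \<tau>' e"
  by (induction n e rule: calls_below.induct) auto

definition evalb :: "program \<Rightarrow> val list \<Rightarrow> exp \<Rightarrow> val \<Rightarrow> nat \<Rightarrow> bool" where
  "evalb P env e v B \<longleftrightarrow> (\<exists>t\<le>B. evaluates P env e v t)"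

lemma evalb_mono: "evalb P env e v A \<Longrightarrow> A \<le> B \<Longrightarrow> evalb P env e v B"
  unfolding evalb_def by (meson le_trans)

lemma sem_evalb:
  assumes "\<And>k v w. C k v = Some w \<Longrightarrow> k < length P \<and> evalb P [v] (P ! k) w (\<tau> k)"
  shows "sem C env e = Some v \<Longrightarrow> evalb P env e v (cst \<tau> e)"
proof (induction e arbitrary: env v)
  case (Var i)
  then have "i < length env" "v = env ! i" by (auto split: if_splits)
  then show ?case using evaluates.Var[of i env] by (auto simp: evalb_def)
next
  case (Lit z)
  then show ?case using evaluates.Lit[of P env z] by (auto simp: evalb_def)
next
  case (Arith p e1 e2)
  then obtain x y where xy: "sem C env e1 = Some (Num x)" "sem C env e2 = Some (Num y)" "p = Div \<Longrightarrow> y \<noteq> 0"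
    "v = Num (apply_op p x y)" by (auto split: option.splits val.splits if_splits)
  from Arith.IH(1)[OF xy(1)] Arith.IH(2)[OF xy(2)] obtain t1 t2 where t: "t1 \<le> cst \<tau> e1" "t2 \<le> cst \<tau> e2"
    "evaluates P env e1 (Num x) t1" "evaluates P env e2 (Num y) t2" by (auto simp: evalb_def)
  from evaluates.Arith[OF t(3,4) xy(3)] t(1,2) show ?case
    unfolding evalb_def xy(4) by (intro exI[of _ "t1 + t2 + 1"]) auto
next
  case Empty
  then show ?case using evaluates.Empty[of P env] by (auto simp: evalb_def)
next
  case (Cell e1 e2)
  then obtain x y where xy: "sem C env e1 = Some x" "sem C env e2 = Some y" "v = Cs x y"
    by (auto split: option.splits)
  from Cell.IH(1)[OF xy(1)] Cell.IH(2)[OF xy(2)] obtain t1 t2 where t: "t1 \<le> cst \<tau> e1" "t2 \<le> cst \<tau> e2"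
    "evaluates P env e1 x t1" "evaluates P env e2 y t2" by (auto simp: evalb_def)
  from evaluates.Cell[OF t(3,4)] t(1,2) show ?case
    unfolding evalb_def xy(3) by (intro exI[of _ "t1 + t2 + 1"]) auto
next
  case (Fst e)
  then obtain w where w: "sem C env e = Some (Cs v w)" by (auto split: option.splits val.splits)
  from Fst.IH[OF w] obtain t where "t \<le> cst \<tau> e" "evaluates P env e (Cs v w) t" by (auto simp: evalb_def)
  then show ?case unfolding evalb_def by (intro exI[of _ "t + 1"] conjI) (simp, rule evaluates.Fst)
next
  case (Snd e)
  then obtain w where w: "sem C env e = Some (Cs w v)" by (auto split: option.splits val.splits)
  from Snd.IH[OF w] obtain t where "t \<le> cst \<tau> e" "evaluates P env e (Cs w v) t" by (auto simp: evalb_def)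
  then show ?case unfolding evalb_def by (intro exI[of _ "t + 1"] conjI) (simp, rule evaluates.Snd)
next
  case (IfLe e1 e2 e3 e4)
  then obtain x y where xy: "sem C env e1 = Some (Num x)" "sem C env e2 = Some (Num y)"
    "x \<le> y \<Longrightarrow> sem C env e3 = Some v" "\<not> x \<le> y \<Longrightarrow> sem C env e4 = Some v"
    by (auto split: option.splits val.splits if_splits)
  from IfLe.IH(1)[OF xy(1)] IfLe.IH(2)[OF xy(2)] obtain t1 t2 where t: "t1 \<le> cst \<tau> e1" "t2 \<le> cst \<tau> e2"
    "evaluates P env e1 (Num x) t1" "evaluates P env e2 (Num y) t2" by (auto simp: evalb_def)
  show ?case
  proof (cases "x \<le> y")
    case True
    from IfLe.IH(3)[OF xy(3)[OF True]] obtain t3 where "t3 \<le> cst \<tau> e3" "evaluates P env e3 v t3"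
      by (auto simp: evalb_def)
    then show ?thesis using evaluates.IfLe_True[OF t(3,4) True, of e3 v t3 e4] t(1,2)
      unfolding evalb_def by (intro exI[of _ "t1 + t2 + t3 + 1"]) auto
  next
    case False
    from IfLe.IH(4)[OF xy(4)[OF False]] obtain t3 where "t3 \<le> cst \<tau> e4" "evaluates P env e4 v t3"
      by (auto simp: evalb_def)
    then show ?thesis using evaluates.IfLe_False[OF t(3,4) False, of e4 v t3 e3] t(1,2)
      unfolding evalb_def by (intro exI[of _ "t1 + t2 + t3 + 1"]) auto
  qed
next
  case (IfEmpty e1 e2 e3)
  then consider "sem C env e1 = Some Nl" "sem C env e2 = Some v"
    | x y where "sem C env e1 = Some (Cs x y)" "sem C env e3 = Some v"
    by (auto split: option.splits val.splits)
  then show ?case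
  proof cases
    case 1
    from IfEmpty.IH(1)[OF 1(1)] IfEmpty.IH(2)[OF 1(2)] obtain t1 t2 where "t1 \<le> cst \<tau> e1" "t2 \<le> cst \<tau> e2"
      "evaluates P env e1 Nl t1" "evaluates P env e2 v t2" by (auto simp: evalb_def)
    then show ?thesis unfolding evalb_def by (intro exI[of _ "t1 + t2 + 1"] conjI) (simp, rule evaluates.IfEmpty_True)
  next
    case 2
    from IfEmpty.IH(1)[OF 2(1)] IfEmpty.IH(3)[OF 2(2)] obtain t1 t2 where "t1 \<le> cst \<tau> e1" "t2 \<le> cst \<tau> e3"
      "evaluates P env e1 (Cs x y) t1" "evaluates P env e3 v t2" by (auto simp: evalb_def)
    then show ?thesis unfolding evalb_def by (intro exI[of _ "t1 + t2 + 1"] conjI) (simp, rule evaluates.IfEmpty_False)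
  qed
next
  case (LetIn e1 e2)
  then obtain x where x: "sem C env e1 = Some x" "sem C (x # env) e2 = Some v" by (auto split: option.splits)
  from LetIn.IH(1)[OF x(1)] LetIn.IH(2)[OF x(2)] obtain t1 t2 where "t1 \<le> cst \<tau> e1" "t2 \<le> cst \<tau> e2"
    "evaluates P env e1 x t1" "evaluates P (x # env) e2 v t2" by (auto simp: evalb_def)
  then show ?case unfolding evalb_def by (intro exI[of _ "t1 + t2 + 1"] conjI) (simp, rule evaluates.LetIn)
next
  case (Call k e)
  then obtain x where x: "sem C env e = Some x" "C k x = Some v" by (auto split: option.splits)
  from Call.IH[OF x(1)] assms[OF x(2)] obtain t1 t2 where "t1 \<le> cst \<tau> e" "t2 \<le> \<tau> k" "k < length P"
    "evaluates P env e x t1" "evaluates P [x] (P ! k) v t2" by (auto simp: evalb_def)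
  then show ?case unfolding evalb_def by (intro exI[of _ "t1 + t2 + 1"] conjI) (simp, rule evaluates.Call)
qed

text \<open>Undefined where evaluation needs more than \<open>\<tau> k\<close> steps, so an equation
  with \<open>Some w\<close> asserts the value and the running time at once.\<close>

definition calls :: "program \<Rightarrow> (nat \<Rightarrow> nat) \<Rightarrow> nat \<Rightarrow> val \<Rightarrow> val option" where
  "calls P \<tau> k v = (if k < length P \<and> (\<exists>w. evalb P [v] (P ! k) w (\<tau> k))
     then Some (THE w. evalb P [v] (P ! k) w (\<tau> k)) else None)"

lemma calls_iff: "calls P \<tau> k v = Some w \<longleftrightarrow> k < length P \<and> evalb P [v] (P ! k) w (\<tau> k)"
proof -
  have uniq: "w = w'" if "evalb P [v] (P ! k) w (\<tau> k)" "evalb P [v] (P ! k) w' (\<tau> k)" for w w'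
    using that evaluates_deterministic unfolding evalb_def by blast
  show ?thesis
  proof
    assume *: "calls P \<tau> k v = Some w"
    then obtain w' where w': "evalb P [v] (P ! k) w' (\<tau> k)" "k < length P"
      by (auto simp: calls_def split: if_splits)
    then have "(THE w. evalb P [v] (P ! k) w (\<tau> k)) = w'" using uniq by blast
    then show "k < length P \<and> evalb P [v] (P ! k) w (\<tau> k)" using * w' by (auto simp: calls_def split: if_splits)
  next
    assume *: "k < length P \<and> evalb P [v] (P ! k) w (\<tau> k)"
    then have "(THE w. evalb P [v] (P ! k) w (\<tau> k)) = w" using uniq by blast
    then show "calls P \<tau> k v = Some w" using * by (auto simp: calls_def)
  qed
qed

lemma sem_calls: "sem (calls P \<tau>) env e = Some v \<Longrightarrow> evalb P env e v (cst \<tau> e)"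
  by (rule sem_evalb) (simp_all add: calls_iff)

text \<open>The argument is a pair of a list and a parameter.  The body sees the value returned for the tail
  as variable 0 and the argument as variable 1.\<close>

definition loop :: "nat \<Rightarrow> exp \<Rightarrow> exp \<Rightarrow> exp" where
  "loop k base body = IfEmpty (Fst (Var 0)) base
     (LetIn (Call k (Cell (Snd (Fst (Var 0))) (Snd (Var 0)))) body)"

text \<open>A loop is \<open>foldr\<close>. Each element costs, besides the body, 2 steps for the
  test, 6 for the argument and 1 each for \<open>Call\<close>, \<open>LetIn\<close> and
  \<open>IfEmpty\<close>; the end of the list costs 3 besides \<open>base\<close>.\<close>

lemma loop_calls:
  assumes k: "k < length P" "P ! k = loop k base body"
    and \<tau>: "(cst \<tau> body + 11) * N + cst \<tau> base + 3 \<le> \<tau> k" and N: "length xs \<le> N"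
    and base: "sem (calls P \<tau>) [Cs Nl pv] base = Some (E b0)"
    and step: "\<And>ys x zs. xs = ys @ x # zs \<Longrightarrow>
      sem (calls P \<tau>) [E (foldr f zs b0), Cs (Cs (enc x) (enc_list (map enc zs))) pv] body = Some (E (f x (foldr f zs b0)))"
  shows "calls P \<tau> k (Cs (enc_list (map enc xs)) pv) = Some (E (foldr f xs b0))"
proof -
  have "evalb P [Cs (enc_list (map enc zs)) pv] (P ! k) (E (foldr f zs b0))
      ((cst \<tau> body + 11) * length zs + cst \<tau> base + 3)"
    if "xs = ys @ zs" for ys zs
    using that
  proof (induction zs arbitrary: ys)
    case Nil
    from sem_calls[OF base] obtain t where t: "t \<le> cst \<tau> base" "evaluates P [Cs Nl pv] base (E b0) t"
      by (auto simp: evalb_def)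
    have "evaluates P [Cs Nl pv] (Fst (Var 0)) Nl (1 + 1)"
      using evaluates.Fst[of P "[Cs Nl pv]" "Var 0" Nl pv 1] evaluates.Var[of 0 "[Cs Nl pv]" P] by simp
    from evaluates.IfEmpty_True[OF this t(2)] t(1) show ?case
      unfolding evalb_def k(2) loop_def by (intro exI[of _ "1 + 1 + t + 1"]) simp
  next
    case (Cons x zs)
    let ?arg = "Cs (Cs (enc x) (enc_list (map enc zs))) pv"
    from Cons.IH[of "ys @ [x]"] Cons.prems obtain t1 where
      t1: "t1 \<le> (cst \<tau> body + 11) * length zs + cst \<tau> base + 3"
        "evaluates P [Cs (enc_list (map enc zs)) pv] (P ! k) (E (foldr f zs b0)) t1" by (auto simp: evalb_def)
    from sem_calls[OF step[OF Cons.prems]] obtain t2 where t2: "t2 \<le> cst \<tau> body"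
      "evaluates P [E (foldr f zs b0), ?arg] body (E (f x (foldr f zs b0))) t2" by (auto simp: evalb_def)
    have v: "evaluates P [?arg] (Var 0) ?arg 1" using evaluates.Var[of 0 "[?arg]"] by simp
    note fst = evaluates.Fst[OF v]
    note arg = evaluates.Cell[OF evaluates.Snd[OF fst] evaluates.Snd[OF v]]
    note ev = evaluates.IfEmpty_False[OF fst evaluates.LetIn[OF evaluates.Call[OF k(1) arg t1(2)] t2(2)]]
    show ?case unfolding evalb_def k(2)
      using ev[of base] t1(1) t2(1) unfolding loop_def by (intro exI conjI) (auto simp: algebra_simps)
  qed
  from this[of "[]" xs] have "evalb P [Cs (enc_list (map enc xs)) pv] (P ! k) (E (foldr f xs b0))
      ((cst \<tau> body + 11) * length xs + cst \<tau> base + 3)" by simp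
  moreover have "(cst \<tau> body + 11) * length xs + cst \<tau> base + 3 \<le> \<tau> k"
    using \<tau> N by (meson add_le_mono1 le_trans mult_le_mono2)
  ultimately show ?thesis unfolding calls_iff using k(1) evalb_mono by blast
qed

lemma cst_poly: "\<exists>q. \<forall>n. cst (\<lambda>k. poly (qs k) n) e = poly q (n::nat)"
proof (induction e)
  case (Var i) show ?case by (rule exI[of _ 1]) simp
next
  case (Lit z) show ?case by (rule exI[of _ 1]) simp
next
  case (Arith p e1 e2)
  then obtain q1 q2 where "\<forall>n. cst (\<lambda>k. poly (qs k) n) e1 = poly q1 n" "\<forall>n. cst (\<lambda>k. poly (qs k) n) e2 = poly q2 n" by blast
  then show ?case by (intro exI[of _ "q1 + q2 + 1"]) simp
next
  case Empty show ?case by (rule exI[of _ 1]) simp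
next
  case (Cell e1 e2)
  then obtain q1 q2 where "\<forall>n. cst (\<lambda>k. poly (qs k) n) e1 = poly q1 n" "\<forall>n. cst (\<lambda>k. poly (qs k) n) e2 = poly q2 n" by blast
  then show ?case by (intro exI[of _ "q1 + q2 + 1"]) simp
next
  case (Fst e)
  then obtain q where "\<forall>n. cst (\<lambda>k. poly (qs k) n) e = poly q n" by blast
  then show ?case by (intro exI[of _ "q + 1"]) simp
next
  case (Snd e)
  then obtain q where "\<forall>n. cst (\<lambda>k. poly (qs k) n) e = poly q n" by blast
  then show ?case by (intro exI[of _ "q + 1"]) simp
next
  case (IfLe e1 e2 e3 e4)
  then obtain q1 q2 q3 q4 where "\<forall>n. cst (\<lambda>k. poly (qs k) n) e1 = poly q1 n" "\<forall>n. cst (\<lambda>k. poly (qs k) n) e2 = poly q2 n"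
    "\<forall>n. cst (\<lambda>k. poly (qs k) n) e3 = poly q3 n" "\<forall>n. cst (\<lambda>k. poly (qs k) n) e4 = poly q4 n" by blast
  then show ?case by (intro exI[of _ "q1 + q2 + (q3 + q4) + 1"]) simp
next
  case (IfEmpty e1 e2 e3)
  then obtain q1 q2 q3 where "\<forall>n. cst (\<lambda>k. poly (qs k) n) e1 = poly q1 n" "\<forall>n. cst (\<lambda>k. poly (qs k) n) e2 = poly q2 n"
    "\<forall>n. cst (\<lambda>k. poly (qs k) n) e3 = poly q3 n" by blast
  then show ?case by (intro exI[of _ "q1 + (q2 + q3) + 1"]) simp
next
  case (LetIn e1 e2)
  then obtain q1 q2 where "\<forall>n. cst (\<lambda>k. poly (qs k) n) e1 = poly q1 n" "\<forall>n. cst (\<lambda>k. poly (qs k) n) e2 = poly q2 n" by blast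
  then show ?case by (intro exI[of _ "q1 + q2 + 1"]) simp
next
  case (Call k e)
  then obtain q where "\<forall>n. cst (\<lambda>k. poly (qs k) n) e = poly q n" by blast
  then show ?case by (intro exI[of _ "q + qs k + 1"]) simp
qed

text \<open>A function of the program is either a straight expression or a loop with a base and a body.
  Straight ones are marked by the absence of a body.\<close>

type_synonym spec = "exp \<times> exp option"

fun compile :: "nat \<Rightarrow> spec \<Rightarrow> exp" where
  "compile k (e, None) = e"
| "compile k (base, Some body) = loop k base body"

fun spec_cost :: "nat \<Rightarrow> spec \<Rightarrow> (nat \<Rightarrow> nat) \<Rightarrow> nat" where
  "spec_cost N (e, None) \<tau> = cst \<tau> e"
| "spec_cost N (base, Some body) \<tau> = (cst \<tau> body + 11) * N + cst \<tau> base + 3"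

fun spec_below :: "nat \<Rightarrow> spec \<Rightarrow> bool" where
  "spec_below k (e, None) \<longleftrightarrow> calls_below k e"
| "spec_below k (base, Some body) \<longleftrightarrow> calls_below k base \<and> calls_below k body"

text \<open>Apart from the recursion inside a loop, functions from 2 on call only smaller indices,
  so budgets can be computed upwards. Positions 0 and 1 hold the main expression and the recursive
  simulation, which are bounded separately.\<close>

function budget :: "spec list \<Rightarrow> nat \<Rightarrow> nat \<Rightarrow> nat" where
  "budget S N k = (if 2 \<le> k \<and> k < length S + 2
     then spec_cost N (S ! (k - 2)) (\<lambda>j. if j < k then budget S N j else 0) else 0)"
  by pat_completeness auto
termination by (relation "measure (\<lambda>(S, N, k). k)") auto

declare budget.simps [simp del]

lemma spec_cost_poly: "\<exists>q. \<forall>N. spec_cost N s (\<lambda>j. poly (qs j) N) = poly q N"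
proof (cases s)
  case (Pair e o')
  show ?thesis
  proof (cases o')
    case None
    then show ?thesis using cst_poly[of qs e] Pair by simp
  next
    case (Some body)
    obtain q1 q2 where "\<forall>n. cst (\<lambda>k. poly (qs k) n) e = poly q1 n" "\<forall>n. cst (\<lambda>k. poly (qs k) n) body = poly q2 n"
      using cst_poly by metis
    then show ?thesis using Pair Some by (intro exI[of _ "(q2 + [:11:]) * [:0, 1:] + q1 + [:3:]"]) simp
  qed
qed

lemma budget_poly: "\<exists>q. \<forall>N. budget S N k = poly q N"
proof (induction k rule: less_induct)
  case (less k)
  then have "\<exists>qs. \<forall>j<k. \<forall>N. budget S N j = poly (qs j) N" by metis
  then obtain qs where qs: "\<And>j N. j < k \<Longrightarrow> budget S N j = poly (qs j) N" by blast
  obtain q where q: "\<forall>N. spec_cost N (S ! (k - 2)) (\<lambda>j. poly (if j < k then qs j else 0) N) = poly q N"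
    using spec_cost_poly[of _ "\<lambda>j. if j < k then qs j else 0"] by blast
  have eq: "(\<lambda>j. if j < k then budget S N j else 0) = (\<lambda>j. poly (if j < k then qs j else 0) N)" for N
    using qs by auto
  show ?case
  proof (cases "2 \<le> k \<and> k < length S + 2")
    case True
    then show ?thesis using q by (intro exI[of _ q]) (subst budget.simps, simp add: eq)
  next
    case False
    then have "budget S N k = 0" for N by (subst budget.simps) (simp only: if_False)
    then show ?thesis by (intro exI[of _ 0]) simp
  qed
qed

lemma budget_eq:
  assumes "2 \<le> k" "k < length S + 2" "spec_below k (S ! (k - 2))"
  shows "budget S N k = spec_cost N (S ! (k - 2)) (budget S N)"
proof -
  have "spec_cost N s (\<lambda>j. if j < k then budget S N j else 0) = spec_cost N s (budget S N)" if "spec_below k s" for s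
    using that by (cases "(N, s, budget S N)" rule: spec_cost.cases) (auto intro!: arg_cong2[where f = plus] arg_cong2[where f = times] cst_cong)
  then show ?thesis using assms by (subst budget.simps) simp
qed

definition program_of :: "exp \<Rightarrow> exp \<Rightarrow> spec list \<Rightarrow> program" where
  "program_of e0 e1 S = e0 # e1 # map (\<lambda>k. compile (k + 2) (S ! k)) [0..<length S]"

lemma program_of_nth: "2 \<le> k \<Longrightarrow> k < length S + 2 \<Longrightarrow> program_of e0 e1 S ! k = compile k (S ! (k - 2))"
proof -
  assume "2 \<le> k" "k < length S + 2"
  then obtain j where "k = Suc (Suc j)" "j < length S" by (auto simp: le_iff_add numeral_2_eq_2)
  then show ?thesis by (simp add: program_of_def)
qed

lemma length_program_of [simp]: "length (program_of e0 e1 S) = length S + 2"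
  by (simp add: program_of_def)

lemma straight_spec:
  assumes k: "2 \<le> k" "k < length S + 2" "snd (S ! (k - 2)) = None" "calls_below k (fst (S ! (k - 2)))"
    and e: "sem (calls (program_of e0 e1 S) (budget S N)) [v] (fst (S ! (k - 2))) = Some w"
  shows "calls (program_of e0 e1 S) (budget S N) k v = Some w"
proof -
  obtain e where "S ! (k - 2) = (e, None)" using k(3) by (metis prod.collapse)
  then show ?thesis using sem_calls[OF e] k budget_eq[of k S N] by (simp add: calls_iff program_of_nth)
qed

lemma loop_spec:
  fixes f :: "'a \<Rightarrow> 'b \<Rightarrow> 'b"
  assumes k: "2 \<le> k" "k < length S + 2" "snd (S ! (k - 2)) \<noteq> None"
    "calls_below k (fst (S ! (k - 2)))" "calls_below k (the (snd (S ! (k - 2))))"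
    and N: "length xs \<le> N"
    and base: "sem (calls (program_of e0 e1 S) (budget S N)) [Cs Nl pv] (fst (S ! (k - 2))) = Some (E b0)"
    and step: "\<And>ys x zs. xs = ys @ x # zs \<Longrightarrow>
      sem (calls (program_of e0 e1 S) (budget S N)) [E (foldr f zs b0), Cs (Cs (enc x) (enc_list (map enc zs))) pv]
        (the (snd (S ! (k - 2)))) = Some (E (f x (foldr f zs b0)))"
  shows "calls (program_of e0 e1 S) (budget S N) k (Cs (enc_list (map enc xs)) pv) = Some (E (foldr f xs b0))"
proof -
  obtain base body where S: "S ! (k - 2) = (base, Some body)" using k(3) by (metis not_Some_eq prod.collapse)
  have "program_of e0 e1 S ! k = loop k base body" using k S by (simp add: program_of_nth)
  moreover have "(cst (budget S N) body + 11) * N + cst (budget S N) base + 3 \<le> budget S N k"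
    using k S budget_eq[of k S N] by simp
  ultimately show ?thesis
    using k S by (intro loop_calls[OF _ _ _ N base[unfolded S fst_conv] step[unfolded S snd_conv option.sel]]) simp_all
qed

section \<open>The program\<close>

definition if_eq :: "exp \<Rightarrow> exp \<Rightarrow> exp \<Rightarrow> exp \<Rightarrow> exp" where
  "if_eq e1 e2 e3 e4 = IfLe e1 e2 (IfLe e2 e1 e3 e4) e4"

definition pos_part :: "exp \<Rightarrow> exp" where
  "pos_part e = LetIn e (IfLe (Var 0) (Lit 0) (Lit 0) (Var 0))"

text \<open>The second argument is evaluated with one more variable in the environment.\<close>

definition min_exp :: "exp \<Rightarrow> exp \<Rightarrow> exp" where
  "min_exp e1 e2 = LetIn e1 (LetIn e2 (IfLe (Var 1) (Var 0) (Var 1) (Var 0)))"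

lemma sem_if_eq [simp]:
  "sem C env e1 = Some (Num x) \<Longrightarrow> sem C env e2 = Some (Num y) \<Longrightarrow>
    sem C env (if_eq e1 e2 e3 e4) = (if x = y then sem C env e3 else sem C env e4)"
  by (simp add: if_eq_def)

lemma sem_pos_part [simp]:
  "sem C env e = Some (Num x) \<Longrightarrow> sem C env (pos_part e) = Some (Num (max 0 x))"
  by (simp add: pos_part_def)

lemma sem_min_exp [simp]:
  "sem C env e1 = Some (Num x) \<Longrightarrow> sem C (Num x # env) e2 = Some (Num y) \<Longrightarrow>
    sem C env (min_exp e1 e2) = Some (Num (min x y))"
  by (simp add: min_exp_def)

lemma calls_below_macros [simp]:
  "calls_below n (if_eq e1 e2 e3 e4) \<longleftrightarrow>
    calls_below n e1 \<and> calls_below n e2 \<and> calls_below n e3 \<and> calls_below n e4"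
  "calls_below n (pos_part e) \<longleftrightarrow> calls_below n e"
  "calls_below n (min_exp e1 e2) \<longleftrightarrow> calls_below n e1 \<and> calls_below n e2"
  by (auto simp: if_eq_def pos_part_def min_exp_def)

text \<open>In the body of a loop, whose argument is the variable \<open>d\<close>: the current element and the parameter.\<close>

abbreviation elem :: "nat \<Rightarrow> exp" where "elem d \<equiv> Fst (Fst (Var d))"
abbreviation param :: "nat \<Rightarrow> exp" where "param d \<equiv> Snd (Var d)"

abbreviation get_idx :: "exp \<Rightarrow> exp" where "get_idx e \<equiv> Fst e"
abbreviation get_itm :: "exp \<Rightarrow> exp" where "get_itm e \<equiv> Fst (Snd e)"
abbreviation get_arr :: "exp \<Rightarrow> exp" where "get_arr e \<equiv> Fst (Snd (Snd e))"
abbreviation get_ddl :: "exp \<Rightarrow> exp" where "get_ddl e \<equiv> Fst (Snd (Snd (Snd e)))"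
abbreviation get_cost :: "exp \<Rightarrow> exp" where "get_cost e \<equiv> Snd (Snd (Snd (Snd e)))"
abbreviation get_sat :: "exp \<Rightarrow> exp" where "get_sat e \<equiv> Fst e"
abbreviation get_share :: "exp \<Rightarrow> exp" where "get_share e \<equiv> Fst (Snd e)"
abbreviation get_entry :: "exp \<Rightarrow> exp" where "get_entry e \<equiv> Snd (Snd e)"
abbreviation get_start :: "exp \<Rightarrow> exp" where
  "get_start e \<equiv> IfLe (get_ddl (get_entry e)) (get_sat e) (get_sat e) (get_ddl (get_entry e))"

definition length_spec :: spec where
  "length_spec = (Lit 0, Some (Arith Add (Var 0) (Lit 1)))"

text \<open>The loop works from the end of the list, so positions are counted down from the length,
  passed as the parameter.\<close>

definition index_spec :: spec where
  "index_spec = (Cell (param 0) Empty,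
     Some (LetIn (Arith Sub (Fst (Var 0)) (Lit 1)) (Cell (Var 0) (Cell (Cell (Var 0) (elem 2)) (Snd (Var 1))))))"

definition lookup_spec :: spec where
  "lookup_spec = (Lit 0, Some (if_eq (Fst (elem 1)) (param 1) (Snd (elem 1)) (Var 0)))"

definition entries_spec :: spec where
  "entries_spec = (Empty, Some (Cell (Cell (get_idx (elem 1)) (Cell (get_itm (elem 1)) (Cell (get_arr (elem 1))
     (Cell (get_ddl (elem 1)) (Call 4 (Cell (param 1) (get_itm (elem 1)))))))) (Var 0)))"

definition family_count_spec :: spec where
  "family_count_spec = (Lit 0, Some (if_eq (get_itm (elem 1)) (param 1) (Arith Add (Var 0) (Lit 1)) (Var 0)))"

definition prefix_count_spec :: spec where
  "prefix_count_spec = (Lit 0, Some (if_eq (get_itm (elem 1)) (Fst (param 1))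
     (IfLe (get_ddl (elem 1)) (Snd (param 1)) (Arith Add (Var 0) (Lit 1)) (Var 0)) (Var 0)))"

definition prefix_sum_spec :: spec where
  "prefix_sum_spec = (Lit 0, Some (if_eq (get_itm (elem 1)) (Fst (param 1))
     (IfLe (get_ddl (elem 1)) (Snd (param 1)) (Arith Add (Var 0) (get_ddl (elem 1))) (Var 0)) (Var 0)))"

definition cand_spec :: spec where
  "cand_spec = (Arith Div
     (Arith Add (Fst (Snd (Snd (Var 0))))
       (Arith Mul (Snd (Snd (Snd (Var 0)))) (Call 8 (Cell (Fst (Var 0)) (Fst (Snd (Var 0)))))))
     (Arith Mul (Snd (Snd (Snd (Var 0)))) (Call 7 (Cell (Fst (Var 0)) (Fst (Snd (Var 0)))))), None)"

definition cand_call :: "exp \<Rightarrow> nat \<Rightarrow> exp" where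
  "cand_call y d = Call 9 (Cell (Fst (Fst (param d))) (Cell (Cell (get_itm (Snd (Fst (param d)))) y)
     (Cell (get_cost (Snd (Fst (param d)))) (Snd (param d)))))"

text \<open>The candidate of the request in the parameter is the initial value, so that the minimum
  needs no infinite element.\<close>

definition sat_spec :: spec where
  "sat_spec = (cand_call (get_ddl (Snd (Fst (param 0)))) 0,
     Some (if_eq (get_itm (elem 1)) (get_itm (Snd (Fst (param 1))))
       (min_exp (cand_call (get_ddl (elem 1)) 1) (Var 1)) (Var 0)))"

text \<open>Saturation times and shares are computed once per step and attached to the requests, for
  use by all later passes.\<close>

definition extend_spec :: spec where
  "extend_spec = (Empty, Some (Cell
     (Cell (Call 10 (Cell (Fst (param 1)) (Cell (Cell (Fst (param 1)) (elem 1)) (Snd (param 1)))))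
       (Cell (Arith Div (get_cost (elem 1)) (Call 6 (Cell (Fst (param 1)) (get_itm (elem 1))))) (elem 1)))
     (Var 0)))"

definition root_sum_spec :: spec where
  "root_sum_spec = (Lit 0, Some (IfLe (get_sat (elem 1)) (Fst (param 1))
     (Arith Add (Var 0) (Arith Add (get_share (elem 1)) (IfLe (get_ddl (get_entry (elem 1))) (Fst (param 1))
       (Arith Mul (Snd (param 1)) (get_ddl (get_entry (elem 1)))) (Lit 0)))) (Var 0)))"

definition root_count_spec :: spec where
  "root_count_spec = (Lit 0, Some (IfLe (get_sat (elem 1)) (param 1)
     (IfLe (get_ddl (get_entry (elem 1))) (param 1) (Arith Add (Var 0) (Lit 1)) (Var 0)) (Var 0)))"

definition root_spec :: spec where
  "root_spec = (Arith Div
     (Arith Add (Fst (Snd (Snd (Var 0))))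
       (Call 12 (Cell (Fst (Var 0)) (Cell (Fst (Snd (Var 0))) (Snd (Snd (Snd (Var 0))))))))
     (Arith Mul (Snd (Snd (Snd (Var 0)))) (Call 13 (Cell (Fst (Var 0)) (Fst (Snd (Var 0)))))), None)"

definition trig_spec :: spec where
  "trig_spec = (Call 14 (Cell (Fst (param 0)) (Cell (get_start (Fst (Fst (param 0)))) (Snd (param 0)))),
     Some (min_exp (Call 14 (Cell (Fst (param 1)) (Cell (get_start (elem 1)) (Snd (param 1))))) (Var 1)))"

definition look_spec :: spec where
  "look_spec = (Lit 0, Some (Arith Add (Var 0) (Arith Add
     (IfLe (get_sat (elem 1)) (Fst (Fst (param 1))) (Lit 0)
       (IfLe (get_sat (elem 1)) (Snd (Fst (param 1))) (get_share (elem 1)) (Lit 0)))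
     (min_exp
       (Arith Mul (Snd (Snd (param 1))) (pos_part (Arith Sub (Snd (Fst (param 1))) (get_ddl (get_entry (elem 1))))))
       (Arith Mul (Fst (Snd (param 2))) (pos_part (Arith Sub (get_ddl (get_entry (elem 2))) (Fst (Fst (param 2))))))))))"

definition hold_spec :: spec where
  "hold_spec = (Lit 0, Some (if_eq (get_itm (get_entry (elem 1))) (Fst (Fst (param 1)))
     (IfLe (get_ddl (get_entry (elem 1))) (Snd (Fst (param 1)))
       (Arith Add (Var 0) (Arith Mul (Snd (Snd (param 1)))
         (pos_part (Arith Sub (get_ddl (get_entry (elem 1))) (Fst (Snd (param 1)))))))
       (Var 0)) (Var 0)))"

text \<open>The parameter of the splitting loop is the list, the time, and the data \<open>c0\<close>, \<open>h\<close>, \<open>b\<close> and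
  the leaf costs, in this order.\<close>

abbreviation get_c0 :: "exp \<Rightarrow> exp" where "get_c0 e \<equiv> Fst e"
abbreviation get_h :: "exp \<Rightarrow> exp" where "get_h e \<equiv> Fst (Snd e)"
abbreviation get_b :: "exp \<Rightarrow> exp" where "get_b e \<equiv> Fst (Snd (Snd e))"
abbreviation get_costs :: "exp \<Rightarrow> exp" where "get_costs e \<equiv> Snd (Snd (Snd e))"

definition look_call :: "exp \<Rightarrow> exp" where
  "look_call e = Call 16 (Cell (Fst (param 1)) (Cell (Cell (Fst (Snd (param 1))) e)
     (Cell (get_h (Snd (Snd (param 1)))) (get_b (Snd (Snd (param 1)))))))"

definition split_spec :: spec where
  "split_spec = (Cell Empty Empty,
     Some (let x = get_entry (elem 1); s = Fst (Snd (param 1)); dat = Snd (Snd (param 1));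
       A = Cell (Cell x (Fst (Var 0))) (Snd (Var 0)); B = Cell (Fst (Var 0)) (Cell x (Snd (Var 0))) in
     IfLe (Arith Mul (look_call (get_sat (elem 1))) (Lit 2)) (get_c0 dat)
       (IfLe (Call 17 (Cell (Fst (param 1)) (Cell (Cell (get_itm x) (get_ddl x)) (Cell s (get_h dat))))) (get_cost x) A
         (IfLe (Arith Mul (look_call (Arith Add (get_ddl x)
             (Arith Mul (Arith Div (get_h dat) (get_b dat)) (Arith Sub (get_ddl x) s)))) (Lit 2)) (get_c0 dat) A B))
       B))"

definition idxs_spec :: spec where
  "idxs_spec = (Empty, Some (Cell (get_idx (elem 1)) (Var 0)))"

definition has_spec :: spec where
  "has_spec = (Lit 0, Some (if_eq (get_itm (elem 1)) (param 1) (Lit 1) (Var 0)))"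

text \<open>Running over all items instead of the served requests yields an increasing list without
  repetitions, as \<open>enc_service\<close> prescribes.\<close>

definition items_spec :: spec where
  "items_spec = (Empty, Some (IfLe (Lit 1) (Call 20 (Cell (param 1) (Fst (elem 1)))) (Cell (Fst (elem 1)) (Var 0)) (Var 0)))"

definition snoc_spec :: spec where
  "snoc_spec = (Cell (param 0) Empty, Some (Cell (elem 1) (Var 0)))"

text \<open>One step of the simulation yields the empty list if there is nothing left to do, and otherwise
  the list of the services performed (at most one) together with the new state.\<close>

definition arrive_exp :: "nat \<Rightarrow> exp" where
  "arrive_exp d = Cell Empty (Cell (Call 22 (Cell (Fst (Var d)) (Fst (Fst (Snd (Var d))))))
     (Cell (Snd (Fst (Snd (Var d)))) (Snd (Snd (Var d)))))"

definition serve_exp :: exp where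
  "serve_exp = LetIn (Call 18 (Cell (Var 1) (Cell (Var 1) (Cell (Var 0) (Snd (Snd (Var 2)))))))
     (Cell (Cell (Cell (Var 1) (Cell (Call 21 (Cell (get_costs (Snd (Snd (Var 3)))) (Fst (Var 0))))
         (Cell (Call 19 (Cell (Fst (Var 0)) Empty)) Empty))) Empty)
       (Cell (Snd (Var 0)) (Snd (Var 3))))"

definition step_spec :: spec where
  "step_spec = (IfEmpty (Fst (Var 0)) (IfEmpty (Fst (Snd (Var 0))) Empty (arrive_exp 0))
     (LetIn (Call 11 (Cell (Fst (Var 0)) (Cell (Fst (Var 0)) (get_b (Snd (Snd (Var 0)))))))
       (LetIn (Call 15 (Cell (Var 0) (Cell (Var 0) (Cell (get_c0 (Snd (Snd (Var 1)))) (get_b (Snd (Snd (Var 1))))))))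
         (IfEmpty (Fst (Snd (Var 2))) serve_exp
           (IfLe (get_arr (Fst (Fst (Snd (Var 2))))) (Var 0) (arrive_exp 2) serve_exp)))), None)"

text \<open>The only recursion that does not descend along the tail of a list; its time bound is
  therefore proved by hand.\<close>

definition trace_exp :: exp where
  "trace_exp = LetIn (Call 23 (Var 0)) (IfEmpty (Var 0) Empty (LetIn (Call 1 (Snd (Var 0)))
     (IfEmpty (Fst (Var 1)) (Var 0) (Cell (Fst (Fst (Var 1))) (Var 0)))))"

definition index_exp :: "exp \<Rightarrow> exp" where
  "index_exp e = Snd (Call 3 (Cell e (Call 2 (Cell e Empty))))"

definition main_exp :: exp where
  "main_exp = LetIn (index_exp (Fst (Snd (Var 0))))
     (LetIn (IfLe (Fst (Snd (Snd (Snd (Var 1))))) (Lit 0) (Lit 1) (Fst (Snd (Snd (Snd (Var 1))))))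
       (Call 1 (Cell Empty (Cell (Call 5 (Cell (index_exp (Fst (Snd (Snd (Snd (Snd (Var 2))))))) (Var 1)))
         (Cell (Fst (Var 2)) (Cell (Fst (Snd (Snd (Var 2)))) (Cell (Var 0) (Var 1))))))))"

definition specs :: "spec list" where
  "specs = [length_spec, index_spec, lookup_spec, entries_spec, family_count_spec, prefix_count_spec,
     prefix_sum_spec, cand_spec, sat_spec, extend_spec, root_sum_spec, root_count_spec, root_spec,
     trig_spec, look_spec, hold_spec, split_spec, idxs_spec, has_spec, items_spec, snoc_spec, step_spec]"

abbreviation prog :: program where
  "prog \<equiv> program_of main_exp trace_exp specs"

abbreviation func :: "nat \<Rightarrow> nat \<Rightarrow> val \<Rightarrow> val option" where
  "func N \<equiv> calls prog (budget specs N)"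

lemma length_specs [simp]: "length specs = 22"
  by (simp add: specs_def)

lemma specs_nth [simp]:
  "specs ! 0 = length_spec" "specs ! Suc 0 = index_spec" "specs ! 2 = lookup_spec" "specs ! 3 = entries_spec"
  "specs ! 4 = family_count_spec" "specs ! 5 = prefix_count_spec" "specs ! 6 = prefix_sum_spec"
  "specs ! 7 = cand_spec" "specs ! 8 = sat_spec" "specs ! 9 = extend_spec" "specs ! 10 = root_sum_spec"
  "specs ! 11 = root_count_spec" "specs ! 12 = root_spec" "specs ! 13 = trig_spec" "specs ! 14 = look_spec"
  "specs ! 15 = hold_spec" "specs ! 16 = split_spec" "specs ! 17 = idxs_spec" "specs ! 18 = has_spec"
  "specs ! 19 = items_spec" "specs ! 20 = snoc_spec" "specs ! 21 = step_spec"
  by (simp_all add: specs_def)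

lemmas loop_func = loop_spec[where S = specs and ?e0.0 = main_exp and ?e1.0 = trace_exp]
lemmas straight_func = straight_spec[where S = specs and ?e0.0 = main_exp and ?e1.0 = trace_exp]

section \<open>Correctness of the individual functions\<close>

lemma foldr_sum:
  fixes g :: "'a \<Rightarrow> real"
  assumes "distinct xs"
  shows "foldr (\<lambda>x a. a + g x) xs 0 = (\<Sum>x\<in>set xs. g x)"
  using assms by (induction xs) (auto simp: add.commute)

lemma foldr_sum_if:
  fixes g :: "'a \<Rightarrow> real"
  assumes "distinct xs"
  shows "foldr (\<lambda>x a. if Q x then a + g x else a) xs 0 = (\<Sum>x | x \<in> set xs \<and> Q x. g x)"
proof -
  have "(\<lambda>x a. if Q x then a + g x else a) = (\<lambda>x a. a + (if Q x then g x else 0))" by (auto simp: fun_eq_iff)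
  then show ?thesis using foldr_sum[OF assms, of "\<lambda>x. if Q x then g x else 0"] by (simp add: sum.inter_filter)
qed

lemma foldr_card_if:
  assumes "distinct xs"
  shows "foldr (\<lambda>x a. if Q x then a + 1 else a) xs 0 = real (card {x \<in> set xs. Q x})"
  using foldr_sum_if[OF assms, of Q "\<lambda>_. 1"] by simp

lemma foldr_Min_if:
  fixes g :: "'a \<Rightarrow> real"
  assumes "x0 \<in> set xs" "Q x0"
  shows "foldr (\<lambda>x a. if Q x then min (g x) a else a) xs (g x0) = Min (g ` {x \<in> set xs. Q x})"
proof -
  have "foldr (\<lambda>x a. if Q x then min (g x) a else a) ys a = Min (insert a (g ` {x \<in> set ys. Q x}))" for ys a
  proof (induction ys)
    case (Cons y ys)
    show ?case
    proof (cases "Q y")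
      case True
      then have "insert a (g ` {x \<in> set (y # ys). Q x}) = insert (g y) (insert a (g ` {x \<in> set ys. Q x}))" by auto
      then show ?thesis using Cons True by simp
    next
      case False
      then have "{x \<in> set (y # ys). Q x} = {x \<in> set ys. Q x}" by auto
      then show ?thesis using Cons False by simp
    qed
  qed simp
  moreover have "insert (g x0) (g ` {x \<in> set xs. Q x}) = g ` {x \<in> set xs. Q x}" using assms by auto
  ultimately show ?thesis by simp
qed

lemma length_call:
  assumes "length xs \<le> N"
  shows "func N 2 (Cs (enc_list (map enc xs)) v) = Some (Num (real (length xs)))"
proof -
  have "func N 2 (Cs (enc_list (map enc xs)) v) = Some (Num (foldr (\<lambda>x a. a + 1) xs 0))"
    using assms by (intro loop_func) (simp_all add: length_spec_def)
  moreover have "foldr (\<lambda>x a. a + 1) xs 0 = real (length xs)" by (induction xs) auto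
  ultimately show ?thesis by simp
qed

definition enc_indexed :: "('a \<Rightarrow> val) \<Rightarrow> nat \<times> 'a \<Rightarrow> val" where
  "enc_indexed enc e = Cs (Num (real (fst e))) (enc (snd e))"

lemma index_call:
  assumes N: "length xs \<le> N"
  shows "func N 3 (Cs (enc_list (map enc xs)) (Num (real (length xs))))
    = Some (Cs (Num 0) (enc_list (map (enc_indexed enc) (List.enumerate 0 xs))))"
proof -
  let ?f = "\<lambda>x (j :: nat, l). (j - 1, (j - 1, x) # l)"
  let ?E = "\<lambda>(j :: nat, l). Cs (Num (real j)) (enc_list (map (enc_indexed enc) l))"
  \<comment> \<open>After a suffix \<open>zs\<close> has been processed, the counter equals the
    number of elements before it.\<close>
  have fold: "foldr ?f zs (length ys + length zs, []) = (length ys, List.enumerate (length ys) zs)" for ys zs :: "'a list"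
  proof (induction zs arbitrary: ys)
    case (Cons z zs)
    from Cons[of "ys @ [z]"] show ?case by simp
  qed simp
  have "func N 3 (Cs (enc_list (map enc xs)) (Num (real (length xs)))) = Some (?E (foldr ?f xs (length xs, [])))"
  proof (rule loop_func[OF _ _ _ _ _ N])
    fix ys x zs assume xs: "xs = ys @ x # zs"
    then have "foldr ?f zs (length xs, []) = (length (ys @ [x]), List.enumerate (length (ys @ [x])) zs)"
      using fold[of zs "ys @ [x]"] by simp
    then show "sem (func N) [?E (foldr ?f zs (length xs, [])), Cs (Cs (enc x) (enc_list (map enc zs))) (Num (real (length xs)))]
        (the (snd (specs ! (3 - 2)))) = Some (?E (?f x (foldr ?f zs (length xs, []))))"
      by (simp add: index_spec_def enc_indexed_def)
  qed (simp_all add: index_spec_def)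
  then show ?thesis using fold[of xs "[]"] by simp
qed

context jrp
begin

definition enc_entry :: "entry \<Rightarrow> val" where
  "enc_entry x = Cs (Num (real (idx x))) (Cs (Num (real (itm x))) (Cs (Num (arr x)) (Cs (Num (ddl x)) (Num (c (itm x))))))"

definition enc_extended :: "entry set \<Rightarrow> entry \<Rightarrow> val" where
  "enc_extended G x = Cs (Num (sat G (itm x))) (Cs (Num (share G x)) (enc_entry x))"

abbreviation enc_entries :: "entry list \<Rightarrow> val" where
  "enc_entries p \<equiv> enc_list (map enc_entry p)"

abbreviation enc_ext :: "entry list \<Rightarrow> val" where
  "enc_ext p \<equiv> enc_list (map (enc_extended (set p)) p)"

lemma lookup_call:
  assumes cs: "\<And>i. c i = (if i < length cs then cs ! i else 0)" and N: "length cs \<le> N"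
  shows "func N 4 (Cs (enc_list (map (enc_indexed Num) (List.enumerate 0 cs))) (Num (real i))) = Some (Num (c i))"
proof -
  have "func N 4 (Cs (enc_list (map (enc_indexed Num) (List.enumerate 0 cs))) (Num (real i)))
      = Some (Num (foldr (\<lambda>e a. if fst e = i then snd e else a) (List.enumerate 0 cs) 0))"
    using N by (intro loop_func) (simp_all add: lookup_spec_def enc_indexed_def)
  moreover have "foldr (\<lambda>e a. if fst e = i then snd e else a) (List.enumerate j cs) 0
      = (if j \<le> i \<and> i < j + length cs then cs ! (i - j) else 0)" for j
    by (induction cs arbitrary: j) (auto simp: nth_Cons')
  ultimately show ?thesis using cs by simp
qed

lemma entries_call:
  assumes cs: "\<And>i. c i = (if i < length cs then cs ! i else 0)" and N: "length cs \<le> N" "length rs \<le> N"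
  shows "func N 5 (Cs (enc_list (map (enc_indexed enc_request) (List.enumerate 0 rs)))
      (enc_list (map (enc_indexed Num) (List.enumerate 0 cs)))) = Some (enc_entries (number 0 rs))"
proof -
  let ?e = "\<lambda>e. Entry (fst e) (item (snd e)) (arrival (snd e)) (deadline (snd e))"
  have "func N 5 (Cs (enc_list (map (enc_indexed enc_request) (List.enumerate 0 rs)))
      (enc_list (map (enc_indexed Num) (List.enumerate 0 cs))))
      = Some (enc_entries (foldr (\<lambda>e l. ?e e # l) (List.enumerate 0 rs) []))"
    using N lookup_call[OF cs N(1)]
    by (intro loop_func) (simp_all add: entries_spec_def enc_indexed_def enc_request_def enc_nat_def enc_entry_def)
  moreover have "foldr (\<lambda>e l. ?e e # l) (List.enumerate j rs) [] = number j rs" for j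
    by (induction rs arbitrary: j) auto
  ultimately show ?thesis by simp
qed

context
  fixes p :: "entry list" and N :: nat
  assumes p: "distinct p" "length p \<le> N"
begin

lemma family_count_call:
  "func N 6 (Cs (enc_entries p) (Num (real i))) = Some (Num (real (card (fam (set p) i))))"
proof -
  have "func N 6 (Cs (enc_entries p) (Num (real i))) = Some (Num (foldr (\<lambda>x a. if itm x = i then a + 1 else a) p 0))"
    using p by (intro loop_func) (simp_all add: family_count_spec_def enc_entry_def)
  then show ?thesis using foldr_card_if[OF p(1)] by (simp add: fam_def)
qed

lemma prefix_count_call:
  "func N 7 (Cs (enc_entries p) (Cs (Num (real i)) (Num y))) = Some (Num (real (card {x \<in> fam (set p) i. ddl x \<le> y})))"
proof -
  have "func N 7 (Cs (enc_entries p) (Cs (Num (real i)) (Num y)))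
      = Some (Num (foldr (\<lambda>x a. if itm x = i \<and> ddl x \<le> y then a + 1 else a) p 0))"
    using p by (intro loop_func) (simp_all add: prefix_count_spec_def enc_entry_def)
  then show ?thesis using foldr_card_if[OF p(1)] by (simp add: fam_def)
qed

lemma prefix_sum_call:
  "func N 8 (Cs (enc_entries p) (Cs (Num (real i)) (Num y))) = Some (Num (\<Sum>x | x \<in> fam (set p) i \<and> ddl x \<le> y. ddl x))"
proof -
  have "func N 8 (Cs (enc_entries p) (Cs (Num (real i)) (Num y)))
      = Some (Num (foldr (\<lambda>x a. if itm x = i \<and> ddl x \<le> y then a + ddl x else a) p 0))"
    using p by (intro loop_func) (simp_all add: prefix_sum_spec_def enc_entry_def)
  then show ?thesis using foldr_sum_if[OF p(1), of "\<lambda>x. itm x = i \<and> ddl x \<le> y" ddl] by (simp add: fam_def conj_assoc)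
qed

context
  assumes b: "0 < b"
begin

text \<open>The witness \<open>x\<close> makes the divisor nonzero; without it the program would
  have no value.\<close>

lemma cand_call:
  assumes "x \<in> fam (set p) i" "ddl x \<le> y"
  shows "func N 9 (Cs (enc_entries p) (Cs (Cs (Num (real i)) (Num y)) (Cs (Num (c i)) (Num b)))) = Some (Num (cand (set p) i y))"
proof -
  have "card {x \<in> fam (set p) i. ddl x \<le> y} \<noteq> 0" using assms by auto
  then show ?thesis using b
    by (intro straight_func)
      (auto simp add: cand_spec_def prefix_count_call prefix_sum_call cand_def)
qed

lemma sat_call:
  assumes x: "x \<in> set p"
  shows "func N 10 (Cs (enc_entries p) (Cs (Cs (enc_entries p) (enc_entry x)) (Num b))) = Some (Num (sat (set p) (itm x)))"
proof -
  let ?g = "\<lambda>z. cand (set p) (itm x) (ddl z)" and ?Q = "\<lambda>z. itm z = itm x"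
  have x': "x \<in> fam (set p) (itm x)" using x by (simp add: fam_def)
  have "func N 10 (Cs (enc_entries p) (Cs (Cs (enc_entries p) (enc_entry x)) (Num b)))
      = Some (Num (foldr (\<lambda>z a. if ?Q z then min (?g z) a else a) p (?g x)))"
  proof (rule loop_func[OF _ _ _ _ _ p(2)])
    fix ys z zs assume "p = ys @ z # zs"
    then have z: "z \<in> set p" by simp
    show "sem (func N) [Num (foldr (\<lambda>z a. if ?Q z then min (?g z) a else a) zs (?g x)),
        Cs (Cs (enc_entry z) (enc_entries zs)) (Cs (Cs (enc_entries p) (enc_entry x)) (Num b))] (the (snd (specs ! (10 - 2))))
      = Some (Num (if ?Q z then min (?g z) (foldr (\<lambda>z a. if ?Q z then min (?g z) a else a) zs (?g x))
          else foldr (\<lambda>z a. if ?Q z then min (?g z) a else a) zs (?g x)))"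
      using cand_call[of z "itm x" "ddl z"] z
      by (simp add: sat_spec_def cand_call_def enc_entry_def fam_def)
  qed (use cand_call[OF x' order.refl] in \<open>simp_all add: sat_spec_def cand_call_def enc_entry_def\<close>)
  then show ?thesis using foldr_Min_if[of x p ?Q ?g] x by (simp add: sat_def fam_def)
qed

lemma extend_call:
  "func N 11 (Cs (enc_entries p) (Cs (enc_entries p) (Num b))) = Some (enc_ext p)"
proof -
  let ?E = "\<lambda>l. enc_list (map (enc_extended (set p)) l)"
  have "func N 11 (Cs (enc_entries p) (Cs (enc_entries p) (Num b))) = Some (?E (foldr (\<lambda>x l. x # l) p []))"
  proof (rule loop_func[OF _ _ _ _ _ p(2)])
    fix ys x zs assume "p = ys @ x # zs"
    then have x: "x \<in> set p" by simp
    then have "fam (set p) (itm x) \<noteq> {}" by (auto simp: fam_def)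
    then have "card (fam (set p) (itm x)) \<noteq> 0" by (simp add: fam_def)
    moreover have "sem (func N) [v, Cs (Cs (enc_entry x) w) u] (get_itm (elem 1)) = Some (Num (real (itm x)))"
      "sem (func N) [v, Cs (Cs (enc_entry x) w) u] (get_cost (elem 1)) = Some (Num (c (itm x)))" for v w u
      by (simp_all add: enc_entry_def)
    ultimately show "sem (func N) [?E (foldr (\<lambda>x l. x # l) zs []), Cs (Cs (enc_entry x) (enc_entries zs)) (Cs (enc_entries p) (Num b))]
        (the (snd (specs ! (11 - 2)))) = Some (?E (x # foldr (\<lambda>x l. x # l) zs []))"
      using sat_call[OF x] family_count_call
      by (simp add: extend_spec_def enc_extended_def share_def enc_entry_def)
  qed (simp_all add: extend_spec_def)
  moreover have "foldr (\<lambda>x l. x # l) p [] = p" by (induction p) auto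
  ultimately show ?thesis by simp
qed

end

end

end

context jrp
begin

abbreviation enc_data :: "real list \<Rightarrow> val" where
  "enc_data cs \<equiv> Cs (Num c0) (Cs (Num h) (Cs (Num b) (enc_list (map (enc_indexed Num) (List.enumerate 0 cs)))))"

context
  fixes p :: "entry list" and N :: nat
  assumes p: "distinct p" "length p \<le> N" and b: "0 < b"
begin

lemma root_sum_call:
  "func N 12 (Cs (enc_ext p) (Cs (Num y) (Num b)))
    = Some (Num ((\<Sum>x | x \<in> set p \<and> sat (set p) (itm x) \<le> y. share (set p) x) + b * (\<Sum>x\<in>act (set p) y. ddl x)))"
proof -
  let ?g = "\<lambda>x. share (set p) x + (if ddl x \<le> y then b * ddl x else 0)"
  have "func N 12 (Cs (enc_ext p) (Cs (Num y) (Num b)))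
      = Some (Num (foldr (\<lambda>x a. if sat (set p) (itm x) \<le> y then a + ?g x else a) p 0))"
    using p by (intro loop_func) (simp_all add: root_sum_spec_def enc_extended_def enc_entry_def)
  also have "foldr (\<lambda>x a. if sat (set p) (itm x) \<le> y then a + ?g x else a) p 0
      = (\<Sum>x | x \<in> set p \<and> sat (set p) (itm x) \<le> y. ?g x)" using p(1) by (rule foldr_sum_if)
  also have "\<dots> = (\<Sum>x | x \<in> set p \<and> sat (set p) (itm x) \<le> y. share (set p) x)
      + (\<Sum>x | x \<in> set p \<and> sat (set p) (itm x) \<le> y. if ddl x \<le> y then b * ddl x else 0)"
    by (rule sum.distrib)
  also have "(\<Sum>x | x \<in> set p \<and> sat (set p) (itm x) \<le> y. if ddl x \<le> y then b * ddl x else 0)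
      = (\<Sum>x\<in>act (set p) y. b * ddl x)"
    by (rule sum.mono_neutral_cong_right) (auto simp: act_def)
  finally show ?thesis by (simp add: sum_distrib_left)
qed

lemma root_count_call:
  "func N 13 (Cs (enc_ext p) (Num y)) = Some (Num (real (card (act (set p) y))))"
proof -
  have "func N 13 (Cs (enc_ext p) (Num y))
      = Some (Num (foldr (\<lambda>x a. if sat (set p) (itm x) \<le> y \<and> ddl x \<le> y then a + 1 else a) p 0))"
    using p by (intro loop_func) (simp_all add: root_count_spec_def enc_extended_def enc_entry_def)
  then show ?thesis using foldr_card_if[OF p(1)] by (simp add: act_def)
qed

lemma root_call:
  assumes "x \<in> act (set p) y"
  shows "func N 14 (Cs (enc_ext p) (Cs (Num y) (Cs (Num c0) (Num b)))) = Some (Num (root (set p) y))"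
proof -
  have "finite (act (set p) y)" by (simp add: act_def)
  then have "card (act (set p) y) \<noteq> 0" using assms by auto
  then show ?thesis using b
    by (intro straight_func) (simp_all add: root_spec_def root_sum_call root_count_call root_def add.assoc)
qed

lemma trig_call:
  assumes "p \<noteq> []"
  shows "func N 15 (Cs (enc_ext p) (Cs (enc_ext p) (Cs (Num c0) (Num b)))) = Some (Num (trig (set p)))"
proof -
  obtain x0 p' where p': "p = x0 # p'" using assms by (cases p) auto
  then have x0: "x0 \<in> set p" by simp
  let ?y = "\<lambda>x. max (ddl x) (sat (set p) (itm x))"
  let ?g = "\<lambda>x. root (set p) (?y x)"
  have root: "func N 14 (Cs (enc_ext p) (Cs (Num (?y x)) (Cs (Num c0) (Num b)))) = Some (Num (?g x))"
    if "x \<in> set p" for x using that by (intro root_call[of x]) (simp add: act_def)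
  obtain v where v: "enc_ext p = Cs (enc_extended (set p) x0) v" using p' by simp
  have start: "sem (func N) env (get_start e) = Some (Num (?y x))"
    if "sem (func N) env e = Some (enc_extended (set p) x)" for env e x
    using that by (simp add: enc_extended_def enc_entry_def max_def)
  have "func N 15 (Cs (enc_ext p) (Cs (enc_ext p) (Cs (Num c0) (Num b))))
      = Some (Num (foldr (\<lambda>x a. if True then min (?g x) a else a) p (?g x0)))"
  proof (rule loop_func[OF _ _ _ _ _ p(2)])
    have "sem (func N) [Cs Nl (Cs (enc_ext p) (Cs (Num c0) (Num b)))] (Fst (Fst (param 0)))
        = Some (enc_extended (set p) x0)" using v by simp
    from start[OF this] root[OF x0]
    show "sem (func N) [Cs Nl (Cs (enc_ext p) (Cs (Num c0) (Num b)))] (fst (specs ! (15 - 2))) = Some (Num (?g x0))"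
      by (simp add: trig_spec_def del: sem.simps(8))
  next
    fix ys x zs assume "p = ys @ x # zs"
    then have x: "x \<in> set p" by simp
    let ?a = "foldr (\<lambda>x a. if True then min (?g x) a else a) zs (?g x0)"
    let ?env = "[Num ?a, Cs (Cs (enc_extended (set p) x) (enc_list (map (enc_extended (set p)) zs)))
      (Cs (enc_ext p) (Cs (Num c0) (Num b)))]"
    have "sem (func N) ?env (elem 1) = Some (enc_extended (set p) x)" by simp
    from start[OF this] root[OF x]
    show "sem (func N) ?env (the (snd (specs ! (15 - 2)))) = Some (Num (if True then min (?g x) ?a else ?a))"
      by (simp add: trig_spec_def del: sem.simps(8))
  qed (simp_all add: trig_spec_def)
  then show ?thesis using foldr_Min_if[of x0 p "\<lambda>_. True" ?g] x0 by (simp add: trig_def)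
qed

lemma look_call:
  "func N 16 (Cs (enc_ext p) (Cs (Cs (Num s) (Num t)) (Cs (Num h) (Num b)))) = Some (Num (look (set p) s t))"
proof -
  let ?g = "\<lambda>x. (if s < sat (set p) (itm x) \<and> sat (set p) (itm x) \<le> t then share (set p) x else 0) + squeeze s t x"
  have "func N 16 (Cs (enc_ext p) (Cs (Cs (Num s) (Num t)) (Cs (Num h) (Num b)))) = Some (Num (foldr (\<lambda>x a. a + ?g x) p 0))"
    using p by (intro loop_func) (simp_all add: look_spec_def enc_extended_def enc_entry_def squeeze_def)
  then show ?thesis using foldr_sum[OF p(1), of ?g] by (simp add: look_def)
qed

lemma hold_call:
  "func N 17 (Cs (enc_ext p) (Cs (Cs (Num (real (itm x))) (Num (ddl x))) (Cs (Num s) (Num h)))) = Some (Num (hold (set p) s x))"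
proof -
  let ?Q = "\<lambda>z. itm z = itm x \<and> ddl z \<le> ddl x" and ?g = "\<lambda>z. h * max 0 (ddl z - s)"
  have "func N 17 (Cs (enc_ext p) (Cs (Cs (Num (real (itm x))) (Num (ddl x))) (Cs (Num s) (Num h))))
      = Some (Num (foldr (\<lambda>z a. if ?Q z then a + ?g z else a) p 0))"
    using p by (intro loop_func) (simp_all add: hold_spec_def enc_extended_def enc_entry_def)
  then show ?thesis using foldr_sum_if[OF p(1), of ?Q ?g] by (simp add: hold_def fam_def conj_assoc)
qed

lemma split_call:
  "func N 18 (Cs (enc_ext p) (Cs (enc_ext p) (Cs (Num s) (enc_data cs))))
    = Some (Cs (enc_entries (filter (sel (set p) s) p)) (enc_entries (filter (\<lambda>x. \<not> sel (set p) s x) p)))"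
proof -
  let ?f = "\<lambda>x (u, w). if sel (set p) s x then (x # u, w) else (u, x # w)"
  let ?E = "\<lambda>(u, w). Cs (enc_entries u) (enc_entries w)"
  have fold: "foldr ?f zs ([], []) = (filter (sel (set p) s) zs, filter (\<lambda>x. \<not> sel (set p) s x) zs)" for zs
    by (induction zs) auto
  have "func N 18 (Cs (enc_ext p) (Cs (enc_ext p) (Cs (Num s) (enc_data cs)))) = Some (?E (foldr ?f p ([], [])))"
  proof (rule loop_func[OF _ _ _ _ _ p(2)])
    fix ys x zs assume "p = ys @ x # zs"
    show "sem (func N) [?E (foldr ?f zs ([], [])), Cs (Cs (enc_extended (set p) x) (enc_list (map (enc_extended (set p)) zs)))
        (Cs (enc_ext p) (Cs (Num s) (enc_data cs)))] (the (snd (specs ! (18 - 2)))) = Some (?E (?f x (foldr ?f zs ([], []))))"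
      unfolding fold using b look_call hold_call[of x s]
      by (simp add: split_spec_def Let_def look_call_def enc_extended_def enc_entry_def sel_def ripe_def reach_def)
  qed (simp_all add: split_spec_def Let_def look_call_def)
  then show ?thesis unfolding fold by simp
qed

end

lemma idxs_call:
  assumes "length v \<le> N"
  shows "func N 19 (Cs (enc_entries v) Nl) = Some (enc_list (map enc_nat (map idx v)))"
proof -
  have "func N 19 (Cs (enc_entries v) Nl) = Some (enc_list (map enc_nat (foldr (\<lambda>x l. idx x # l) v [])))"
    using assms by (intro loop_func) (simp_all add: idxs_spec_def enc_entry_def enc_nat_def)
  moreover have "foldr (\<lambda>x l. idx x # l) v [] = map idx v" by (induction v) auto
  ultimately show ?thesis by simp
qed

lemma has_call:
  assumes "length v \<le> N"
  shows "func N 20 (Cs (enc_entries v) (Num (real i))) = Some (Num (if i \<in> itm ` set v then 1 else 0))"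
proof -
  have "func N 20 (Cs (enc_entries v) (Num (real i))) = Some (Num (foldr (\<lambda>x a. if itm x = i then 1 else a) v 0))"
    using assms by (intro loop_func) (simp_all add: has_spec_def enc_entry_def)
  moreover have "foldr (\<lambda>x a. if itm x = i then 1 else a) v 0 = (if i \<in> itm ` set v then 1 else 0 :: real)"
    by (induction v) auto
  ultimately show ?thesis by simp
qed

lemma items_call:
  assumes "length v \<le> N" "length cs \<le> N"
  shows "func N 21 (Cs (enc_list (map (enc_indexed Num) (List.enumerate 0 cs))) (enc_entries v))
    = Some (enc_list (map enc_nat (filter (\<lambda>i. i \<in> itm ` set v) [0..<length cs])))"
proof -
  have "func N 21 (Cs (enc_list (map (enc_indexed Num) (List.enumerate 0 cs))) (enc_entries v))
      = Some (enc_list (map enc_nat (foldr (\<lambda>e l. if fst e \<in> itm ` set v then fst e # l else l) (List.enumerate 0 cs) [])))"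
    using assms has_call[OF assms(1)]
    by (intro loop_func) (simp_all add: items_spec_def enc_indexed_def enc_nat_def)
  moreover have "foldr (\<lambda>e l. if fst e \<in> itm ` set v then fst e # l else l) es [] = filter (\<lambda>i. i \<in> itm ` set v) (map fst es)"
    for es :: "(nat \<times> real) list" by (induction es) auto
  ultimately show ?thesis by simp
qed

lemma snoc_call:
  assumes "length p \<le> N"
  shows "func N 22 (Cs (enc_entries p) (enc_entry r)) = Some (enc_entries (p @ [r]))"
proof -
  have "func N 22 (Cs (enc_entries p) (enc_entry r)) = Some (enc_entries (foldr (\<lambda>x l. x # l) p [r]))"
    using assms by (intro loop_func) (simp_all add: snoc_spec_def)
  moreover have "foldr (\<lambda>x l. x # l) p [r] = p @ [r]" by (induction p) auto
  ultimately show ?thesis by simp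
qed

lemma step_done: "func N 23 (Cs Nl (Cs Nl d)) = Some Nl"
  by (intro straight_func) (simp_all add: step_spec_def arrive_exp_def serve_exp_def)

lemma step_arrive:
  assumes p: "distinct p" "length p \<le> N" "0 < b" and r: "p = [] \<or> arr r \<le> trig (set p)"
  shows "func N 23 (Cs (enc_entries p) (Cs (enc_entries (r # f)) (enc_data cs)))
    = Some (Cs Nl (Cs (enc_entries (p @ [r])) (Cs (enc_entries f) (enc_data cs))))"
proof (cases p)
  case Nil
  then show ?thesis using snoc_call[of "[]" N r]
    by (intro straight_func) (simp_all add: step_spec_def arrive_exp_def serve_exp_def)
next
  case (Cons x p')
  obtain v where v: "enc_entries p = Cs (enc_entry x) v" using Cons by simp
  obtain u1 u2 u3 where u: "enc_entry r = Cs u1 (Cs u2 (Cs (Num (arr r)) u3))" by (simp add: enc_entry_def)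
  show ?thesis
    using r Cons v extend_call[OF p] trig_call[OF p] snoc_call[OF p(2), of r] u
    by (intro straight_func) (simp_all add: step_spec_def arrive_exp_def serve_exp_def)
qed

text \<open>Entries stay in the order of their positions and items are listed in the order of the
  cost list, so the computed lists are already the sorted ones of
  \<open>enc_service\<close>.\<close>

lemma enc_batch:
  assumes "sorted_wrt (<) (map idx p)" "\<And>x. x \<in> set p \<Longrightarrow> itm x < n"
  shows "enc_service (batch (s, p)) = Cs (Num s)
    (Cs (enc_list (map enc_nat (filter (\<lambda>i. i \<in> itm ` set (filter (sel (set p) s) p)) [0..<n])))
      (Cs (enc_list (map enc_nat (map idx (filter (sel (set p) s) p)))) Nl))"
proof -
  let ?v = "filter (sel (set p) s) p"
  have pick: "pick (set p) s = set ?v" by (auto simp: pick_def)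
  have 1: "{i. Leaf i \<in> subtree (batch (s, p))} = set (filter (\<lambda>i. i \<in> itm ` set ?v) [0..<n])"
  proof -
    have "subtree (batch (s, p)) = insert Root (Leaf ` itm ` set ?v)" unfolding pick[symmetric] by (simp add: batch_def)
    then show ?thesis using assms(2) by auto
  qed
  have 2: "served (batch (s, p)) = idx ` set ?v" "time (batch (s, p)) = s"
    unfolding pick[symmetric] by (simp_all add: batch_def)
  have 3: "sorted_list_of_set (set (filter (\<lambda>i. i \<in> itm ` set ?v) [0..<n])) = filter (\<lambda>i. i \<in> itm ` set ?v) [0..<n]"
    by (intro sorted_list_of_set.idem_if_sorted_distinct) (simp_all add: sorted_wrt_filter)
  have 4: "sorted_list_of_set (idx ` set ?v) = map idx ?v"
  proof -
    have "sorted_wrt (<) (map idx ?v)" using assms(1) by (simp add: sorted_wrt_map sorted_wrt_filter)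
    then have "sorted_list_of_set (set (map idx ?v)) = map idx ?v"
      by (intro sorted_list_of_set.idem_if_sorted_distinct) (simp_all add: strict_sorted_iff)
    then show ?thesis by simp
  qed
  show ?thesis unfolding enc_service_def 1 2 3 4 by simp
qed

lemma step_serve:
  assumes p: "distinct p" "length p \<le> N" "0 < b" and ne: "p \<noteq> []"
    and f: "\<And>r f'. f = r # f' \<Longrightarrow> trig (set p) < arr r"
    and srt: "sorted_wrt (<) (map idx p)" and itm: "\<And>x. x \<in> set p \<Longrightarrow> itm x < length cs" and cs: "length cs \<le> N"
  shows "func N 23 (Cs (enc_entries p) (Cs (enc_entries f) (enc_data cs)))
    = Some (Cs (Cs (enc_service (batch (trig (set p), p))) Nl) (Cs (enc_entries (rest p)) (Cs (enc_entries f) (enc_data cs))))"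
proof -
  let ?s = "trig (set p)"
  let ?v = "filter (sel (set p) ?s) p"
  have len: "length ?v \<le> N" using p(2) le_trans length_filter_le by blast
  obtain x p' where Cons: "p = x # p'" using ne by (cases p) auto
  obtain v where v: "enc_entries p = Cs (enc_entry x) v" using Cons by simp
  \<comment> \<open>The encoded values are named so that the step can be evaluated on them as opaque
    values.\<close>
  define d where "d = enc_data cs"
  define q where "q = enc_ext p"
  define l where "l = enc_entries p"
  define ve where "ve = enc_entries ?v"
  define re where "re = enc_entries (rest p)"
  define ci where "ci = enc_list (map (enc_indexed Num) (List.enumerate 0 cs))"
  have d: "d = Cs (Num c0) (Cs (Num h) (Cs (Num b) ci))" by (simp add: d_def ci_def)
  have l: "l = Cs (enc_entry x) v" using v by (simp add: l_def)
  have 1: "func N 11 (Cs l (Cs l (Num b))) = Some q" using extend_call[OF p] by (simp add: l_def q_def)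
  have 2: "func N 15 (Cs q (Cs q (Cs (Num c0) (Num b)))) = Some (Num ?s)" using trig_call[OF p ne] by (simp add: q_def)
  have 3: "func N 18 (Cs q (Cs q (Cs (Num ?s) d))) = Some (Cs ve re)"
    using split_call[OF p, of ?s cs] by (simp add: q_def d_def ve_def re_def rest_def)
  have 4: "func N 19 (Cs ve Nl) = Some (enc_list (map enc_nat (map idx ?v)))"
    using idxs_call[OF len] by (simp add: ve_def)
  have 5: "func N 21 (Cs ci ve) = Some (enc_list (map enc_nat (filter (\<lambda>i. i \<in> itm ` set ?v) [0..<length cs])))"
    using items_call[OF len cs] by (simp add: ve_def ci_def)
  have "func N 23 (Cs l (Cs (enc_entries f) d)) = Some (Cs (Cs (Cs (Num ?s)
    (Cs (enc_list (map enc_nat (filter (\<lambda>i. i \<in> itm ` set ?v) [0..<length cs])))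
      (Cs (enc_list (map enc_nat (map idx ?v))) Nl))) Nl) (Cs re (Cs (enc_entries f) d)))"
  proof (cases f)
    case Nil
    then show ?thesis using 1 2 3 4 5 unfolding l d
      by (intro straight_func) (simp_all add: step_spec_def arrive_exp_def serve_exp_def del: filter.simps map_map)
  next
    case (Cons r f')
    obtain u1 u2 u3 where u: "enc_entry r = Cs u1 (Cs u2 (Cs (Num (arr r)) u3))" by (simp add: enc_entry_def)
    have "\<not> arr r \<le> ?s" using f[OF Cons] by simp
    then show ?thesis using 1 2 3 4 5 u Cons unfolding l d
      by (intro straight_func) (simp_all add: step_spec_def arrive_exp_def serve_exp_def del: map_map)
  qed
  then show ?thesis by (simp only: enc_batch[OF srt itm] l_def d_def re_def)
qed

end

section \<open>Running time of the whole program\<close>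

context jrp_costs
begin

definition listed :: "entry list \<Rightarrow> nat \<Rightarrow> nat \<Rightarrow> bool" where
  "listed l n N \<longleftrightarrow> sorted_wrt (<) (map idx l) \<and> length l \<le> N \<and> (\<forall>x\<in>set l. itm x < n)"

lemma listed_rest: "listed (p @ f) n N \<Longrightarrow> listed (rest p @ f) n N"
proof -
  assume l: "listed (p @ f) n N"
  have "length (rest p) \<le> length p" unfolding rest_def by (rule length_filter_le)
  moreover have "sorted_wrt (<) (map idx (rest p @ f))"
    using l by (auto simp: listed_def rest_def sorted_wrt_append sorted_wrt_map sorted_wrt_filter)
  ultimately show ?thesis using l by (auto simp: listed_def set_rest)
qed

lemma listed_props:
  assumes "listed (p @ f) n N"
  shows "distinct p" "length p \<le> N" "sorted_wrt (<) (map idx p)" "\<And>x. x \<in> set p \<Longrightarrow> itm x < n"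
proof -
  show s: "sorted_wrt (<) (map idx p)" using assms by (simp add: listed_def sorted_wrt_append)
  then have "distinct (map idx p)" by (simp add: strict_sorted_iff)
  then show "distinct p" by (simp add: distinct_map)
qed (use assms in \<open>auto simp: listed_def\<close>)

lemma sem_trace_exp:
  assumes "C 23 v = Some w" "sem C [w, v]
    (IfEmpty (Var 0) Empty (LetIn (Call 1 (Snd (Var 0)))
     (IfEmpty (Fst (Var 1)) (Var 0) (Cell (Fst (Fst (Var 1))) (Var 0))))) = Some u"
  shows "sem C [v] trace_exp = Some u"
  unfolding trace_exp_def sem.simps(10)[of _ _ "Call 23 (Var 0)"] using assms by (simp del: sem.simps(9))

text \<open>Here \<open>B\<close> is the time allowed to the recursive call, and 20 covers the fixed
  overhead of \<open>trace_exp\<close>. Changing the budget of function 1 leaves that of function 23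
  as it was.\<close>

lemma evalb_trace_exp_step:
  assumes "func N 23 v = Some w" "sem (calls prog ((budget specs N)(1 := B))) [w, v]
    (IfEmpty (Var 0) Empty (LetIn (Call 1 (Snd (Var 0)))
     (IfEmpty (Fst (Var 1)) (Var 0) (Cell (Fst (Fst (Var 1))) (Var 0))))) = Some u"
  shows "evalb prog [v] trace_exp u (B + (budget specs N 23 + 20))"
proof -
  let ?\<tau> = "(budget specs N)(1 := B)"
  have "calls prog ?\<tau> 23 v = Some w" using assms(1) unfolding calls_iff by simp
  from sem_calls[OF sem_trace_exp[OF this assms(2)]] show ?thesis by (rule evalb_mono) (simp add: trace_exp_def)
qed

text \<open>The first factor is the termination measure of \<open>trace\<close> plus one. An arrival
  lowers the measure by one, a service by at least one, and each step costs at most the second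
  factor.\<close>

lemma evalb_trace_exp:
  assumes cs: "length cs \<le> N"
  shows "listed (p @ f) (length cs) N \<Longrightarrow>
    evalb prog [Cs (enc_entries p) (Cs (enc_entries f) (enc_data cs))] trace_exp
      (enc_schedule (map batch (trace p f))) ((2 * length f + length p + 1) * (budget specs N 23 + 20))"
proof (induction p f rule: trace.induct)
  case (1 p)
  note P = listed_props[OF 1(2)]
  let ?K = "budget specs N 23 + 20"
  show ?case
  proof (cases "p = []")
    case True
    \<comment> \<open>With nothing left to do the recursive call is not reached, so its budget may
      be 0.\<close>
    show ?thesis using evalb_trace_exp_step[OF step_done, where B = 0] unfolding True
      by (simp add: enc_schedule_def)
  next
    case False
    let ?B = "(2 * length ([] :: entry list) + length (rest p) + 1) * ?K"
    let ?w = "Cs (enc_entries (rest p)) (Cs (enc_entries []) (enc_data cs))"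
    have "calls prog ((budget specs N)(1 := ?B)) 1 ?w = Some (enc_schedule (map batch (trace (rest p) [])))"
      using 1(1)[OF rest_shorter[OF False] listed_rest[OF 1(2)]]
      by (simp add: calls_iff program_of_def)
    then have "evalb prog [Cs (enc_entries p) (Cs (enc_entries []) (enc_data cs))] trace_exp
      (enc_schedule (map batch (trace p []))) (?B + ?K)"
      by (intro evalb_trace_exp_step[OF step_serve[OF P(1,2) b False _ P(3,4) cs]])
        (simp_all add: enc_schedule_def trace_Nil[OF False])
    moreover have "?B + ?K \<le> (2 * length ([] :: entry list) + length p + 1) * ?K"
    proof -
      have "?B + ?K = (2 * length ([] :: entry list) + length (rest p) + 2) * ?K" by (simp add: algebra_simps)
      also have "\<dots> \<le> (2 * length ([] :: entry list) + length p + 1) * ?K"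
        using rest_shorter[OF False] by (intro mult_le_mono1) simp
      finally show ?thesis .
    qed
    ultimately show ?thesis by (rule evalb_mono)
  qed
next
  case (2 p r f)
  note P = listed_props[OF 2(3)]
  let ?K = "budget specs N 23 + 20"
  show ?case
  proof (cases "p = [] \<or> arr r \<le> trig (set p)")
    case True
    let ?B = "(2 * length f + length (p @ [r]) + 1) * ?K"
    let ?w = "Cs (enc_entries (p @ [r])) (Cs (enc_entries f) (enc_data cs))"
    have "calls prog ((budget specs N)(1 := ?B)) 1 ?w = Some (enc_schedule (map batch (trace (p @ [r]) f)))"
      using 2(1)[OF True] 2(3) by (simp add: calls_iff program_of_def)
    then have "evalb prog [Cs (enc_entries p) (Cs (enc_entries (r # f)) (enc_data cs))] trace_exp
      (enc_schedule (map batch (trace p (r # f)))) (?B + ?K)"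
      using True
      by (intro evalb_trace_exp_step[OF step_arrive[OF P(1,2) b True]]) (simp add: trace_Cons[of p r f])
    then show ?thesis by (rule evalb_mono) (simp add: algebra_simps)
  next
    case False
    then have p: "p \<noteq> []" by simp
    let ?B = "(2 * length (r # f) + length (rest p) + 1) * ?K"
    let ?w = "Cs (enc_entries (rest p)) (Cs (enc_entries (r # f)) (enc_data cs))"
    have "calls prog ((budget specs N)(1 := ?B)) 1 ?w = Some (enc_schedule (map batch (trace (rest p) (r # f))))"
      using 2(2)[OF False rest_shorter[OF p] listed_rest[OF 2(3)]]
      by (simp add: calls_iff program_of_def)
    then have "evalb prog [Cs (enc_entries p) (Cs (enc_entries (r # f)) (enc_data cs))] trace_exp
      (enc_schedule (map batch (trace p (r # f)))) (?B + ?K)"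
      using False
      by (intro evalb_trace_exp_step[OF step_serve[OF P(1,2) b p _ P(3,4) cs]])
        (simp_all add: enc_schedule_def trace_Cons[of p r f])
    moreover have "?B + ?K \<le> (2 * length (r # f) + length p + 1) * ?K"
    proof -
      have "?B + ?K = (2 * length (r # f) + length (rest p) + 2) * ?K" by (simp add: algebra_simps)
      also have "\<dots> \<le> (2 * length (r # f) + length p + 1) * ?K"
        using rest_shorter[OF p] by (intro mult_le_mono1) simp
      finally show ?thesis .
    qed
    ultimately show ?thesis by (rule evalb_mono)
  qed
qed

end

lemma evalb_main_exp:
  assumes I: "valid_instance I"
  defines "N \<equiv> instance_size I"
  shows "evalb prog [enc_instance I] main_exp (enc_schedule (replenish I))
    (cst ((budget specs N)(1 := (3 * N + 1) * (budget specs N 23 + 20))) main_exp)"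
proof -
  interpret jrp_costs "root_cost I" "holding_rate I" "rate I" "leaf_cost I" using I by (rule valid_jrp_costs)
  let ?cs = "item_costs I" and ?rs = "requests I"
  define \<tau> where "\<tau> = (budget specs N)(1 := (3 * N + 1) * (budget specs N 23 + 20))"
  define C where "C = calls prog \<tau>"
  have N: "length ?cs \<le> N" "length ?rs \<le> N" by (simp_all add: N_def instance_size_def)
  have "listed ([] @ entries I) (length ?cs) N"
    using N entries_props(6)[OF I] strict_sorted_iff[of "[0..<length ?rs]"]
    by (auto simp: listed_def entries_def)
  from evalb_trace_exp[OF N(1) this]
  have "evalb prog [Cs Nl (Cs (enc_entries (entries I)) (enc_data ?cs))] trace_exp (enc_schedule (replenish I))
      ((2 * length (entries I) + 1) * (budget specs N 23 + 20))" by (simp add: replenish_def)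
  then have "evalb prog [Cs Nl (Cs (enc_entries (entries I)) (enc_data ?cs))] trace_exp (enc_schedule (replenish I))
      ((3 * N + 1) * (budget specs N 23 + 20))"
    by (rule evalb_mono) (use N in \<open>simp add: entries_def\<close>)
  then have 1: "C 1 (Cs Nl (Cs (enc_entries (entries I)) (enc_data ?cs))) = Some (enc_schedule (replenish I))"
    by (simp add: calls_iff program_of_def C_def \<tau>_def)
  \<comment> \<open>Whether \<open>calls\<close> has a value at \<open>k\<close> depends on the
    budget of \<open>k\<close> alone, so the equations for the other functions carry over.\<close>
  have same: "C k = func N k" if "k \<noteq> 1" for k
    using that by (intro ext) (simp add: calls_def C_def \<tau>_def)
  have index: "sem C env (index_exp e) = Some (enc_list (map (enc_indexed enc) (List.enumerate 0 xs)))"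
    if "sem C env e = Some (enc_list (map enc xs))" "length xs \<le> N"
    for env e and enc :: "'b \<Rightarrow> val" and xs
    using that length_call[OF that(2), of enc Nl] index_call[OF that(2), of enc]
    by (simp add: index_exp_def same)
  have ents: "C 5 (Cs (enc_list (map (enc_indexed enc_request) (List.enumerate 0 ?rs)))
      (enc_list (map (enc_indexed Num) (List.enumerate 0 ?cs)))) = Some (enc_entries (entries I))"
    using entries_call[OF _ N] by (simp add: same entries_def leaf_cost_def)
  have "sem C [enc_instance I] main_exp = Some (enc_schedule (replenish I))"
    unfolding main_exp_def using N 1 ents 
    by (cases "backlog_rate I \<le> 0") (simp_all add: index enc_instance_def rate_def)
  then show ?thesis unfolding C_def \<tau>_def by (rule sem_calls)
qed

theorem polynomial_time_replenish: "polynomial_time replenish"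
proof -
  obtain qs where qs: "\<And>N k. budget specs N k = poly (qs k) N" using budget_poly[of specs] by metis
  define qs' where "qs' = qs(1 := [:1, 3:] * (qs 23 + [:20:]))"
  have "(budget specs N)(1 := (3 * N + 1) * (budget specs N 23 + 20)) = (\<lambda>k. poly (qs' k) N)" for N
    by (auto simp: qs'_def qs fun_eq_iff)
  moreover obtain q where q: "\<And>N. cst (\<lambda>k. poly (qs' k) N) main_exp = poly q N" using cst_poly by blast
  ultimately have main: "\<exists>t\<le>poly q (instance_size I). evaluates prog [enc_instance I] main_exp (enc_schedule (replenish I)) t"
    if "valid_instance I" for I using evalb_main_exp[OF that] by (simp add: evalb_def)
  have "\<exists>t\<le>poly (q + 2) (instance_size I). runs prog (enc_instance I) (enc_schedule (replenish I)) t"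
    if I: "valid_instance I" for I
  proof -
    obtain t where t: "t \<le> poly q (instance_size I)" "evaluates prog [enc_instance I] main_exp (enc_schedule (replenish I)) t"
      using main[OF I] by blast
    have "evaluates prog [enc_instance I] (Call 0 (Var 0)) (enc_schedule (replenish I)) (1 + t + 1)"
      using evaluates.Call[of 0 prog "[enc_instance I]" "Var 0" "enc_instance I" 1] evaluates.Var[of 0 "[enc_instance I]" prog] t(2)
      by (simp add: program_of_def)
    then show ?thesis using t(1) unfolding runs_def by (intro exI[of _ "1 + t + 1"]) simp
  qed
  then show ?thesis unfolding polynomial_time_def by blast
qed

theorem theorem2:
  "\<exists>A. online_algorithm A \<and> polynomial_time A \<and>
     (\<forall>I. valid_instance I \<and> 0 < backlog_rate I \<longrightarrow> cost I (A I) \<le> 30 * opt I)"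
  using online_replenish polynomial_time_replenish replenish_competitive by blast

end
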